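(* Let $\mathcal{C}$ be a formation of finite groups. Every word is strongly concise in the class of groups consisting of pro-$\mathcal{C}$ completions of residually $\mathcal{C}$ linear groups. That is, for every word $w$ and every linear group $\Gamma$ that is residually $\mathcal{C}$, if $G$ denotes the pro-$\mathcal{C}$ completion of $\Gamma$ and $|w\{G\}|<2^{\aleph_0}$, then the verbal subgroup $w(G)$ is finite.
   Context: A word $w$ in $k$ variables is an element of the free group on $k$ generators; for a group $G$ it defines by substitution a map $w\colon G^k\to G$. The set of $w$-values is $w\{G\}=\{w(g_1,\dots,g_k)\mid g_i\in G\}$ and the verbal subgroup is the abstract subgroup $w(G)=\langle w\{G\}\rangle$. A word $w$ is strongly concise in a class $\mathfrak{C}$ of profinite groups if, for every $G$ in $\mathfrak{C}$, the subgroup $w(G)$ is finite whenever $|w\{G\}|<2^{\aleph_0}$. A formation of finite groups is a class (closed under isomorphism) of finite groups closed under taking quotients and (finite) subdirect products of its members. For a group $\Gamma$, the pro-$\mathcal{C}$ completion is the inverse limit $\varprojlim \Gamma/N$ over the normal subgroups $N$ of $\Gamma$ with $\Gamma/N\in\mathcal{C}$; $\Gamma$ is residually $\mathcal{C}$ if the intersection of all such $N$ is trivial. A group is linear if it embeds in $\mathrm{GL}_n(K)$ for some $n\in\mathbb{N}$ and some field $K$. *)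

theory Defs
  imports
    "HOL-Algebra.Algebra"
    "HOL-Library.Equipollence"
    "Jordan_Normal_Form.Matrix"
begin

section \<open>Words, word values and verbal subgroups\<close>

text \<open>
  The letter \<open>(i, True)\<close> stands for the generator \<open>x\<^sub>i\<close> and \<open>(i, False)\<close> for its inverse.
\<close>
type_synonym word = "(nat \<times> bool) list"

text \<open>
  The free group on \<open>x\<^sub>0, \<dots>, x\<^sub>k\<^sub>-\<^sub>1\<close>, each element being given by its unique freely reduced word.
\<close>
definition free_group_words :: "nat \<Rightarrow> word set" where
  "free_group_words k =
     {w. fst ` set w \<subseteq> {..<k} \<and>
         successively (\<lambda>(i, a) (j, b). \<not> (i = j \<and> a \<noteq> b)) w}"

primrec word_map :: "('g, 'c) monoid_scheme \<Rightarrow> word \<Rightarrow> (nat \<Rightarrow> 'g) \<Rightarrow> 'g" where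
  "word_map G [] g = \<one>\<^bsub>G\<^esub>"
| "word_map G (l # w) g =
     (if snd l then g (fst l) else inv\<^bsub>G\<^esub> (g (fst l))) \<otimes>\<^bsub>G\<^esub> word_map G w g"

definition word_values :: "('g, 'c) monoid_scheme \<Rightarrow> nat \<Rightarrow> word \<Rightarrow> 'g set" where
  "word_values G k w = word_map G w ` ({..<k} \<rightarrow>\<^sub>E carrier G)"

text \<open>The abstract subgroup generated by the values; no topological closure is taken.\<close>
definition verbal_subgroup :: "('g, 'c) monoid_scheme \<Rightarrow> nat \<Rightarrow> word \<Rightarrow> 'g set" where
  "verbal_subgroup G k w = generate G (word_values G k w)"


section \<open>Formations of finite groups\<close>

text \<open>
  A class of finite groups is represented by its members whose carrier is a set of natural
  numbers. As every finite group has an isomorphic copy of this kind, an isomorphism-closed class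
  is determined by these members; a group over an arbitrary type belongs to the class iff it is
  isomorphic to one of them.
\<close>
definition in_class :: "nat monoid set \<Rightarrow> ('g, 'c) monoid_scheme \<Rightarrow> bool" where
  "in_class \<C> G \<longleftrightarrow> (\<exists>H\<in>\<C>. G \<cong> H)"

definition class_of_finite_groups :: "nat monoid set \<Rightarrow> bool" where
  "class_of_finite_groups \<C> \<longleftrightarrow>
     (\<forall>G\<in>\<C>. group G \<and> finite (carrier G)) \<and>
     (\<forall>G\<in>\<C>. \<forall>H :: nat monoid. group H \<and> G \<cong> H \<longrightarrow> H \<in> \<C>)"

definition subdirect_product ::
  "('i \<Rightarrow> 'g) set \<Rightarrow> 'i set \<Rightarrow> ('i \<Rightarrow> ('g, 'c) monoid_scheme) \<Rightarrow> bool" where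
  "subdirect_product S I H \<longleftrightarrow>
     subgroup S (product_group I H) \<and> (\<forall>i\<in>I. (\<lambda>x. x i) ` S = carrier (H i))"

text \<open>
  Only subdirect products of nonempty families are required to belong to the class, so that the
  empty class is not excluded.
\<close>
definition formation :: "nat monoid set \<Rightarrow> bool" where
  "formation \<C> \<longleftrightarrow>
     class_of_finite_groups \<C> \<and>
     (\<forall>G\<in>\<C>. \<forall>N. N \<lhd> G \<longrightarrow> in_class \<C> (G Mod N)) \<and>
     (\<forall>n :: nat. \<forall>H S. n > 0 \<and> (\<forall>i<n. H i \<in> \<C>) \<and> subdirect_product S {..<n} H \<longrightarrow>
        in_class \<C> ((product_group {..<n} H)\<lparr>carrier := S\<rparr>))"


section \<open>Residually C groups and pro-C completions\<close>

definition class_normals :: "nat monoid set \<Rightarrow> ('a, 'c) monoid_scheme \<Rightarrow> 'a set set" where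
  "class_normals \<C> \<Gamma> = {N. N \<lhd> \<Gamma> \<and> in_class \<C> (\<Gamma> Mod N)}"

text \<open>
  Intersecting with the carrier matters only if the family is empty: the empty intersection of
  subgroups is the whole group.
\<close>
definition residually :: "nat monoid set \<Rightarrow> ('a, 'c) monoid_scheme \<Rightarrow> bool" where
  "residually \<C> \<Gamma> \<longleftrightarrow> carrier \<Gamma> \<inter> \<Inter> (class_normals \<C> \<Gamma>) = {\<one>\<^bsub>\<Gamma>\<^esub>}"

text \<open>
  The inverse limit of the quotients \<open>\<Gamma>/N\<close>, as the group of compatible families in their product.
  For \<open>N \<subseteq> M\<close> the canonical map from \<open>\<Gamma>/N\<close> to \<open>\<Gamma>/M\<close> sends a coset \<open>X = Ng\<close> to \<open>MX = Mg\<close>.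
\<close>
definition pro_completion ::
  "nat monoid set \<Rightarrow> ('a, 'c) monoid_scheme \<Rightarrow> ('a set \<Rightarrow> 'a set) monoid" where
  "pro_completion \<C> \<Gamma> =
     (let P = product_group (class_normals \<C> \<Gamma>) (\<lambda>N. \<Gamma> Mod N)
      in P\<lparr>carrier := {x \<in> carrier P.
             \<forall>N\<in>class_normals \<C> \<Gamma>. \<forall>M\<in>class_normals \<C> \<Gamma>. N \<subseteq> M \<longrightarrow> M <#>\<^bsub>\<Gamma>\<^esub> x N = x M}\<rparr>)"


section \<open>Linear groups\<close>

definition general_linear_group :: "'k::field itself \<Rightarrow> nat \<Rightarrow> 'k mat monoid" where
  "general_linear_group K n = units_of (ring_mat K n ())"

definition linear_group :: "'k::field itself \<Rightarrow> ('a, 'c) monoid_scheme \<Rightarrow> bool" where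
  "linear_group K \<Gamma> \<longleftrightarrow>
     group \<Gamma> \<and>
     (\<exists>n. \<exists>h \<in> hom \<Gamma> (general_linear_group K n). inj_on h (carrier \<Gamma>))"

end

theory Submission
  imports Defs
    "HOL-Algebra.Algebraic_Closure_Type"
    "HOL-Number_Theory.Cong"
    "Jordan_Normal_Form.Char_Poly"
begin

text \<open>
  Call a product of cosets \<open>N g\<^sub>i\<close> with \<open>N \<in> class_normals \<C> \<Gamma>\<close> a cell. If some cell contained no
  smaller one on which \<open>w\<close> is constant, then it could be split repeatedly into pairs of cells on
  which \<open>w\<close> differs modulo a member of \<open>class_normals \<C> \<Gamma>\<close>, and the limits along the branches of
  the resulting binary tree would give continuum many values of \<open>w\<close> in the completion. So
  every cell contains a smaller one on which \<open>w\<close> is constant. As the entries of word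
  values are polynomial functions of bounded degree, a Noetherian argument yields one \<open>N\<close> such
  that \<open>w\<close> is constant on all cells of this \<open>N\<close> in \<open>\<Gamma>\<close>. Hence \<open>w{G}\<close> is the finite set of
  images of the values of \<open>w\<close> on \<open>\<Gamma>\<close>, and by Dietzmann's lemma it remains to see that each of
  these values \<open>z\<close> is torsion.

  Let \<open>C\<close> be the centralizer in \<open>N\<close> of the values. In \<open>\<Gamma>/[C, C]\<close>, which is abelian by finite, a
  power of the crossed homomorphism extending \<open>b \<mapsto> b\<^sup>q\<close> on \<open>C/[C, C]\<close>, with \<open>q = |\<Gamma> : C|\<close>, gives
  endomorphisms that preserve every coset of \<open>C/[C, C]\<close> and therefore fix \<open>z\<close>; this forces
  \<open>z\<^sup>m \<in> [C, C]\<close> for \<open>m = q\<^sup>2\<close>. Since \<open>C\<close> acts on the eigenspaces of \<open>z\<close> with a multiplicative determinant,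
  all eigenvalues of \<open>z\<close> are roots of unity, and some power \<open>u\<close> of \<open>z\<close> is unipotent. In positive
  characteristic \<open>u\<close> is torsion. In characteristic \<open>0\<close>, if \<open>u \<noteq> 1\<close>, then \<open>u\<close> survives in a finite
  congruence quotient, where its order is divisible only by large primes; but no prime exceeding
  \<open>|\<Gamma> : N|\<close> divides the order of \<open>z\<close> in a finite quotient.
\<close>

section \<open>Words in abelian-by-finite groups\<close>

text \<open>A determinant on an eigenspace of \<open>z\<close> is a character, so it is trivial on
  commutators of elements that preserve the eigenspace. Hence \<open>N\<close> is shrunk to the
  centralizer \<open>C\<close>, and the aim is to place a power of \<open>z\<close> in
  \<open>[C, C]\<close>. Determinants see only eigenvalues, and in characteristic \<open>0\<close> a
  unipotent matrix can still have infinite order. There the constancy of \<open>w\<close> is used a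
  second time: in a finite quotient, \<open>z\<close> can be computed from arguments in any subgroup
  that meets all cosets of \<open>N\<close>. If a prime \<open>p\<close> does not divide the index
  of \<open>N\<close>, some such subgroup has order prime to \<open>p\<close>, and so has
  \<open>z\<close>. This restricts the primes in the same way for all finite quotients, whereas
  congruence quotients may have characteristics with only large prime factors. Bounded degree
  matters for the cells: the cell on which \<open>w\<close> becomes constant depends on the
  arguments, but the space of functions of bounded degree does not, and so one \<open>N\<close>
  serves for all arguments. Closure under subdirect products enters as closure of
  \<open>class_normals \<C> \<Gamma>\<close> under intersection, by which cells are refined.\<close>

context group begin

lemma mult_inv_cancel [simp]:
  assumes "x \<in> carrier G" "y \<in> carrier G"
  shows "x \<otimes> (inv x \<otimes> y) = y" "inv x \<otimes> (x \<otimes> y) = y"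
  using assms by (simp_all flip: m_assoc)

text \<open>A transfer-like average over a transversal \<open>r\<close>. The factor
  \<open>d r(U) r(dU)^-1\<close> measures how far \<open>r\<close> is from being equivariant. It
  lies in \<open>B\<close>, and since \<open>B\<close> is abelian the product over all cosets makes
  sense without an ordering. An element \<open>b\<close> of \<open>B\<close> fixes each coset, so
  every factor is \<open>b\<close> itself.\<close>

lemma crossed_hom_exists:
  assumes B: "B \<lhd> G" and ab: "\<And>x y. x \<in> B \<Longrightarrow> y \<in> B \<Longrightarrow> x \<otimes> y = y \<otimes> x"
    and fin: "finite (rcosets B)"
  shows "\<exists>f\<in>carrier G \<rightarrow> B.
    (\<forall>d\<in>carrier G. \<forall>e\<in>carrier G. f (d \<otimes> e) = f d \<otimes> (d \<otimes> f e \<otimes> inv d)) \<and>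
    (\<forall>b\<in>B. f b = b [^] card (rcosets B))"
proof -
  interpret N: normal B G by (rule B)
  have sub: "subgroup B G" using B normal_imp_subgroup by blast
  have Bc: "B \<subseteq> carrier G" using sub subgroup.subset by blast
  define GB where "GB = G\<lparr>carrier := B\<rparr>"
  interpret GB: comm_group GB
    unfolding GB_def using sub ab by (intro group.group_comm_groupI subgroup_imp_group) auto
  define r where "r U = (SOME x. x \<in> U)" for U :: "'a set"
  have r: "r U \<in> U" if "U \<in> rcosets B" for U
    using subgroup.rcosets_non_empty[OF sub that] unfolding r_def by (simp add: some_in_eq)
  have rc: "r U \<in> carrier G" if "U \<in> rcosets B" for U
    by (rule subsetD[OF subgroup.rcosets_carrier[OF sub group_axioms that] r[OF that]])
  have rU: "B #> r U = U" if U: "U \<in> rcosets B" for U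
  proof -
    obtain x where x: "x \<in> carrier G" "U = B #> x" using U by (auto simp: RCOSETS_def)
    have "r U \<in> B #> x" using r[OF U] x(2) by simp
    then show ?thesis unfolding x(2) by (rule repr_independence[OF _ x(1) sub, symmetric])
  qed
  \<comment> \<open>Right cosets of the normal subgroup \<open>B\<close> are also left cosets, so
    left multiplication permutes them.\<close>
  define act where "act d U = B #> (d \<otimes> r U)" for d U
  have act: "act d U \<in> rcosets B" if "d \<in> carrier G" "U \<in> rcosets B" for d U
    unfolding act_def using that rc Bc by (intro rcosetsI) auto
  have act_coset: "act d (B #> x) = B #> (d \<otimes> x)" if "d \<in> carrier G" "x \<in> carrier G" for d x
  proof -
    have U: "B #> x \<in> rcosets B" using that Bc by (intro rcosetsI) auto
    obtain b where b: "b \<in> B" "r (B #> x) = b \<otimes> x"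
      using r[OF U] unfolding r_coset_def by auto
    have "d \<otimes> (b \<otimes> x) = (d \<otimes> b \<otimes> inv d) \<otimes> (d \<otimes> x)"
      using that b Bc by (simp add: m_assoc subsetD)
    moreover have "d \<otimes> b \<otimes> inv d \<in> B" using b that N.inv_op_closed2 by blast
    ultimately have "d \<otimes> (b \<otimes> x) \<in> B #> (d \<otimes> x)"
      unfolding r_coset_def by auto
    then have "B #> (d \<otimes> x) = B #> (d \<otimes> (b \<otimes> x))"
      by (rule repr_independence[OF _ _ sub]) (use that in auto)
    then show ?thesis unfolding act_def b(2) by simp
  qed
  have act_mult: "act d (act e U) = act (d \<otimes> e) U"
    if "d \<in> carrier G" "e \<in> carrier G" "U \<in> rcosets B" for d e U
    using act_coset[of d "e \<otimes> r U"] that rc by (simp add: act_def m_assoc)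
  have act_B: "act b U = U" if "b \<in> B" "U \<in> rcosets B" for b U
  proof -
    have "b \<otimes> r U \<in> B #> r U" using that unfolding r_coset_def by auto
    then have "B #> r U = B #> (b \<otimes> r U)"
      by (rule repr_independence[OF _ _ sub]) (use that rc in auto)
    then show ?thesis unfolding act_def using rU that by simp
  qed
  have bij: "bij_betw (act e) (rcosets B) (rcosets B)" if e: "e \<in> carrier G" for e
  proof (rule bij_betw_byWitness[where f' = "act (inv e)"])
    show "\<forall>U\<in>rcosets B. act (inv e) (act e U) = U" "\<forall>U\<in>rcosets B. act e (act (inv e) U) = U"
      using e act_B[OF N.one_closed] by (auto simp: act_mult)
  qed (use e act in auto)
  define F where "F d U = d \<otimes> r U \<otimes> inv (r (act d U))" for d U
  have FB: "F d U \<in> B" if "d \<in> carrier G" "U \<in> rcosets B" for d U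
  proof -
    have "r (act d U) \<in> B #> (d \<otimes> r U)" using r[OF act[OF that]] by (simp add: act_def)
    then obtain b where "b \<in> B" "r (act d U) = b \<otimes> (d \<otimes> r U)" unfolding r_coset_def by auto
    then have "F d U = inv b" using that rc Bc
      by (simp add: F_def inv_mult_group m_assoc subsetD)
    then show ?thesis using \<open>b \<in> B\<close> by simp
  qed
  \<comment> \<open>The cocycle rule: on the right the two occurrences of \<open>r (act e U)\<close>
    cancel.\<close>
  have F_mult: "F (d \<otimes> e) U = (d \<otimes> F e U \<otimes> inv d) \<otimes> F d (act e U)"
    if "d \<in> carrier G" "e \<in> carrier G" "U \<in> rcosets B" for d e U
    using that rc act by (simp add: F_def act_mult m_assoc)
  define f where "f d = finprod GB (F d) (rcosets B)" for d
  have fB: "f d \<in> B" if "d \<in> carrier G" for d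
    unfolding f_def using FB[OF that] GB.finprod_closed[of "F d" "rcosets B"] by (auto simp: GB_def)
  have conj: "(\<lambda>x. d \<otimes> x \<otimes> inv d) \<in> hom GB GB" if "d \<in> carrier G" for d
    using that Bc N.inv_op_closed2 by (auto intro!: homI simp: GB_def m_assoc subsetD)
  have GB1: "\<one>\<^bsub>GB\<^esub> = \<one>" by (simp add: GB_def)
  have conj_prod: "d \<otimes> finprod GB h A \<otimes> inv d = finprod GB (\<lambda>U. d \<otimes> h U \<otimes> inv d) A"
    if "d \<in> carrier G" "h \<in> A \<rightarrow> B" for d h and A :: "'a set set"
    using that(2)
  proof (induction A rule: infinite_finite_induct)
    case (infinite A)
    then show ?case using that by (simp add: GB1)
  next
    case empty
    then show ?case using that by (simp add: GB1)
  next
    case (insert x A)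
    have 1: "finprod GB h A \<in> carrier GB" using insert.prems by (intro GB.finprod_closed) (auto simp: GB_def)
    have 2: "(\<lambda>U. d \<otimes> h U \<otimes> inv d) \<in> A \<rightarrow> carrier GB" "d \<otimes> h x \<otimes> inv d \<in> carrier GB"
      using insert.prems that N.inv_op_closed2 by (auto simp: GB_def)
    have "h \<in> A \<rightarrow> carrier GB" "h x \<in> carrier GB" using insert.prems by (auto simp: GB_def)
    then show ?case
      using insert 1 2 hom_mult[OF conj[OF that(1)], of "h x" "finprod GB h A"]
      by (simp add: Pi_iff)
  qed
  have f_mult: "f (d \<otimes> e) = f d \<otimes> (d \<otimes> f e \<otimes> inv d)"
    if d: "d \<in> carrier G" and e: "e \<in> carrier G" for d e
  proof -
    have cl: "(\<lambda>U. d \<otimes> F e U \<otimes> inv d) \<in> rcosets B \<rightarrow> carrier GB"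
      "(\<lambda>U. F d (act e U)) \<in> rcosets B \<rightarrow> carrier GB"
      using FB act d e N.inv_op_closed2 by (auto simp: GB_def)
    have "f (d \<otimes> e) = finprod GB (\<lambda>U. (d \<otimes> F e U \<otimes> inv d) \<otimes>\<^bsub>GB\<^esub> F d (act e U)) (rcosets B)"
      unfolding f_def using FB d e act N.inv_op_closed2
      by (intro GB.finprod_cong') (auto simp: F_mult, auto simp: GB_def)
    also have "\<dots> = finprod GB (\<lambda>U. d \<otimes> F e U \<otimes> inv d) (rcosets B) \<otimes>\<^bsub>GB\<^esub>
        finprod GB (\<lambda>U. F d (act e U)) (rcosets B)"
      using cl by (rule GB.finprod_multf)
    \<comment> \<open>The shift by \<open>act e\<close> disappears because it only permutes the
      factors.\<close>
    also have "finprod GB (\<lambda>U. F d (act e U)) (rcosets B) = f d"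
    proof -
      have "finprod GB (F d) (act e ` (rcosets B)) = finprod GB (\<lambda>U. F d (act e U)) (rcosets B)"
        using bij[OF e] FB d by (intro GB.finprod_reindex) (auto simp: bij_betw_def GB_def)
      then show ?thesis using bij[OF e] by (simp add: bij_betw_def f_def)
    qed
    also have "finprod GB (\<lambda>U. d \<otimes> F e U \<otimes> inv d) (rcosets B) = d \<otimes> f e \<otimes> inv d"
      unfolding f_def using conj_prod[OF d, of "F e"] FB e by simp
    finally show ?thesis
      using ab[OF fB[OF d] N.inv_op_closed2[OF d fB[OF e]]] by (simp add: GB_def)
  qed
  have f_B: "f b = b [^] card (rcosets B)" if b: "b \<in> B" for b
  proof -
    have "f b = finprod GB (\<lambda>U. b) (rcosets B)"
      unfolding f_def using b Bc rc by (intro GB.finprod_cong') (auto simp: F_def act_B m_assoc GB_def subsetD)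
    also have "\<dots> = b [^]\<^bsub>GB\<^esub> card (rcosets B)"
      using b by (intro GB.finprod_const) (auto simp: GB_def)
    finally show ?thesis using nat_pow_consistent by (simp add: GB_def)
  qed
  show ?thesis by (rule bexI[of _ f]) (use fB f_mult f_B in auto)
qed

text \<open>If \<open>f\<close> is a crossed homomorphism, then \<open>d \<mapsto> f(d)\<^sup>j d\<close> is an endomorphism.\<close>

lemma near_identity_endomorphism:
  assumes B: "B \<lhd> G" and ab: "\<And>x y. x \<in> B \<Longrightarrow> y \<in> B \<Longrightarrow> x \<otimes> y = y \<otimes> x"
    and fin: "finite (rcosets B)"
  shows "\<exists>\<theta>\<in>hom G G. (\<forall>d\<in>carrier G. \<exists>b\<in>B. \<theta> d = b \<otimes> d) \<and>
    (\<forall>b\<in>B. \<theta> b = b [^] (j * card (rcosets B) + 1))"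
proof -
  interpret N: normal B G by (rule B)
  have sub: "subgroup B G" using B normal_imp_subgroup by blast
  have Bc: "\<And>x. x \<in> B \<Longrightarrow> x \<in> carrier G" using sub subgroup.subset by blast
  obtain f where f: "f \<in> carrier G \<rightarrow> B"
    and fm: "\<And>d e. d \<in> carrier G \<Longrightarrow> e \<in> carrier G \<Longrightarrow> f (d \<otimes> e) = f d \<otimes> (d \<otimes> f e \<otimes> inv d)"
    and fb: "\<And>b. b \<in> B \<Longrightarrow> f b = b [^] card (rcosets B)"
    using crossed_hom_exists[OF B ab fin] by blast
  have powB: "b [^] n \<in> B" if "b \<in> B" for b and n :: nat
    using that by (induction n) auto
  have conj_pow: "(d \<otimes> x \<otimes> inv d) [^] n = d \<otimes> x [^] n \<otimes> inv d"
    if "d \<in> carrier G" "x \<in> carrier G" for d x and n :: nat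
    using that by (induction n) (auto simp: m_assoc)
  \<comment> \<open>The exponent \<open>j\<close> is left free. For word values \<open>j = 1\<close>
    is used; for supplements \<open>j\<close> is chosen such that \<theta> kills all of
    \<open>B\<close>.\<close>
  define \<theta> where "\<theta> d = f d [^] j \<otimes> d" for d
  have "\<theta> \<in> hom G G"

    proof (rule homI)
      show "\<theta> d \<in> carrier G" if "d \<in> carrier G" for d
        using that f Bc by (simp add: \<theta>_def Pi_iff)
      fix d e assume d: "d \<in> carrier G" and e: "e \<in> carrier G"
      have 1: "f d \<in> B" "d \<otimes> f e \<otimes> inv d \<in> B" "f e \<in> B" using d e f N.inv_op_closed2 by auto
      have c: "f d \<in> carrier G" "f e \<in> carrier G" "d \<otimes> f e \<otimes> inv d \<in> carrier G" using 1 Bc by auto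
      have "f (d \<otimes> e) [^] j = f d [^] j \<otimes> (d \<otimes> f e \<otimes> inv d) [^] j"
        unfolding fm[OF d e] by (rule pow_mult_distrib[OF ab[OF 1(1,2)] c(1,3)])
      also have "\<dots> = f d [^] j \<otimes> (d \<otimes> f e [^] j \<otimes> inv d)"
        unfolding conj_pow[OF d c(2)] ..
      finally have "\<theta> (d \<otimes> e) = f d [^] j \<otimes> (d \<otimes> f e [^] j \<otimes> inv d) \<otimes> (d \<otimes> e)"
        by (simp add: \<theta>_def)
      then show "\<theta> (d \<otimes> e) = \<theta> d \<otimes> \<theta> e"
        using c d e by (simp add: \<theta>_def m_assoc)
    qed
  moreover have "\<exists>b\<in>B. \<theta> d = b \<otimes> d" if "d \<in> carrier G" for d
      using that f powB unfolding \<theta>_def by blast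
  moreover have "\<theta> b = b [^] (j * card (rcosets B) + 1)" if "b \<in> B" for b
      using that Bc by (simp add: \<theta>_def fb nat_pow_pow mult.commute[of j])
  ultimately show ?thesis by blast
qed

end

section \<open>Word maps under homomorphisms, and word values modulo commutators\<close>

lemma word_map_closed:
  assumes "group G" "fst ` set w \<subseteq> {..<k}" "g \<in> {..<k} \<rightarrow> carrier G"
  shows "word_map G w g \<in> carrier G"
proof -
  interpret group G by fact
  show ?thesis using assms(2,3) by (induction w) (auto simp: Pi_iff)
qed

lemma word_map_cong:
  assumes "fst ` set w \<subseteq> {..<k}" "\<And>i. i < k \<Longrightarrow> g i = g' i"
  shows "word_map G w g = word_map G w g'"
  using assms by (induction w) auto

lemma word_map_in_subgroup:
  assumes "subgroup S G" "fst ` set w \<subseteq> {..<k}" "g \<in> {..<k} \<rightarrow> S"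
  shows "word_map G w g \<in> S"
  using assms(2,3) by (induction w) (auto simp: Pi_iff intro: subgroup.m_closed[OF assms(1)]
      subgroup.m_inv_closed[OF assms(1)] subgroup.one_closed[OF assms(1)])

lemma word_map_hom:
  assumes "group G" "group H" "h \<in> hom G H" "fst ` set w \<subseteq> {..<k}" "g \<in> {..<k} \<rightarrow> carrier G"
  shows "h (word_map G w g) = word_map H w (\<lambda>i. h (g i))"
proof -
  interpret G: group G by fact
  interpret h: group_hom G H h using assms by (simp add: group_hom_def group_hom_axioms_def)
  show ?thesis using assms(4,5)
  proof (induction w)
    case (Cons l w)
    then have "word_map G w g \<in> carrier G" using word_map_closed[OF assms(1)] by auto
    with Cons show ?case by (auto simp: Pi_iff)
  qed simp
qed

lemma word_map_subgroup_structure: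
  assumes "group G" "subgroup S G" "fst ` set w \<subseteq> {..<k}" "g \<in> {..<k} \<rightarrow> S"
  shows "word_map (G\<lparr>carrier := S\<rparr>) w g = word_map G w g"
  using assms(3,4)
  by (induction w) (auto simp: Pi_iff group.m_inv_consistent[OF assms(1,2)])

context group begin

lemma conj_hom: "x \<in> carrier G \<Longrightarrow> (\<lambda>y. x \<otimes> y \<otimes> inv x) \<in> hom G G"
  by (rule homI) (auto simp: m_assoc)

lemma word_map_conj:
  assumes "fst ` set w \<subseteq> {..<k}" "g \<in> {..<k} \<rightarrow> carrier G" "x \<in> carrier G"
  shows "x \<otimes> word_map G w g \<otimes> inv x = word_map G w (\<lambda>i. x \<otimes> g i \<otimes> inv x)"
  using word_map_hom[OF group_axioms group_axioms conj_hom[OF assms(3)] assms(1,2)] .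

lemma pow_card_rcosets:
  assumes "B \<lhd> G" "finite (rcosets B)" "x \<in> carrier G"
  shows "x [^] card (rcosets B) \<in> B"
proof -
  interpret N: normal B G by fact
  interpret Q: group "G Mod B" by (rule N.factorgroup_is_group)
  have sub: "subgroup B G" using assms(1) normal_imp_subgroup by blast
  have h: "group_hom G (G Mod B) (\<lambda>x. B #> x)"
    using N.r_coset_hom_Mod by (simp add: group_hom_def group_hom_axioms_def group_axioms Q.group_axioms)
  have "(B #> x) [^]\<^bsub>G Mod B\<^esub> Coset.order (G Mod B) = \<one>\<^bsub>G Mod B\<^esub>"
    using assms(2,3) by (intro Q.pow_order_eq_1) (auto simp: FactGroup_def RCOSETS_def)
  then have "B #> x [^] card (rcosets B) = B"
    using group_hom.hom_nat_pow[OF h assms(3), of "card (rcosets B)"]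
    by (simp add: Coset.order_def FactGroup_def)
  then show ?thesis using assms(3) sub by (metis nat_pow_closed rcos_self)
qed

text \<open>
  The word value \<open>z\<close> is fixed by an endomorphism that sends every element to its own \<open>B\<close>-coset.
\<close>

lemma abelian_by_finite_word_value:
  assumes B: "B \<lhd> G" and ab: "\<And>x y. x \<in> B \<Longrightarrow> y \<in> B \<Longrightarrow> x \<otimes> y = y \<otimes> x"
    and fin: "finite (rcosets B)"
    and w: "fst ` set w \<subseteq> {..<k}" "g \<in> {..<k} \<rightarrow> carrier G"
    and const: "\<And>g'. g' \<in> {..<k} \<rightarrow> carrier G \<Longrightarrow> (\<forall>i<k. \<exists>b\<in>B. g' i = b \<otimes> g i) \<Longrightarrow>
      word_map G w g' = word_map G w g"
  shows "word_map G w g [^] (card (rcosets B) * card (rcosets B)) = \<one>"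
proof -
  define z q where "z = word_map G w g" and "q = card (rcosets B)"
  have z: "z \<in> carrier G" unfolding z_def using word_map_closed[OF group_axioms w] .
  obtain \<theta> where \<theta>: "\<theta> \<in> hom G G" "\<forall>d\<in>carrier G. \<exists>b\<in>B. \<theta> d = b \<otimes> d"
    "\<forall>b\<in>B. \<theta> b = b [^] (1 * q + 1)"
    using near_identity_endomorphism[OF B ab fin, of 1] unfolding q_def by blast
  interpret h: group_hom G G \<theta>
    using \<theta>(1) by (simp add: group_hom_def group_hom_axioms_def group_axioms)
  have "\<theta> z = word_map G w (\<lambda>i. \<theta> (g i))"
    unfolding z_def by (rule word_map_hom[OF group_axioms group_axioms \<theta>(1) w])
  also have "\<dots> = z"
    unfolding z_def by (rule const) (use w \<theta>(2) h.hom_closed in \<open>auto simp: Pi_iff\<close>)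
  finally have \<theta>z: "\<theta> z = z" .
  \<comment> \<open>On \<open>B\<close> the map \<theta> raises to the power \<open>q + 1\<close>.
    As it fixes \<open>z\<close>, it fixes \<open>z [^] q\<close>, which forces the
    \<open>q\<close>-th power of the latter to be trivial.\<close>
  have zq: "z [^] q \<in> B" unfolding q_def by (rule pow_card_rcosets[OF B fin z])
  have "(z [^] q) [^] (1 * q + 1) = \<theta> (z [^] q)" using \<theta>(3) zq by simp
  also have "\<dots> = z [^] q" using h.hom_nat_pow[OF z, of q] \<theta>z by simp
  finally have "(z [^] q) [^] q \<otimes> z [^] q = z [^] q" by simp
  then have "(z [^] q) [^] q = \<one>" using z by simp
  then show ?thesis using z by (simp add: nat_pow_pow z_def q_def)
qed

end

lemma hom_image_normal:
  assumes "group G" "group H" "p \<in> hom G H" "p ` carrier G = carrier H" "C \<lhd> G"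
  shows "p ` C \<lhd> H"
    and "rcosets\<^bsub>H\<^esub> (p ` C) = (\<lambda>Y. p ` Y) ` (rcosets\<^bsub>G\<^esub> C)"
proof -
  interpret h: group_hom G H p using assms by (simp add: group_hom_def group_hom_axioms_def)
  interpret C: normal C G by fact
  have Cc: "\<And>x. x \<in> C \<Longrightarrow> x \<in> carrier G" using C.subset by blast
  show "p ` C \<lhd> H" using C.surj_hom_normal_subgroup[OF h.group_hom_axioms assms(4)] .
  have 1: "p ` C #>\<^bsub>H\<^esub> p x = p ` (C #>\<^bsub>G\<^esub> x)" if "x \<in> carrier G" for x
    using that Cc by (force simp: r_coset_def image_iff)
  have "rcosets\<^bsub>H\<^esub> (p ` C) = (\<lambda>y. p ` C #>\<^bsub>H\<^esub> y) ` p ` carrier G"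
    unfolding assms(4) by (auto simp: RCOSETS_def)
  also have "\<dots> = (\<lambda>x. p ` (C #>\<^bsub>G\<^esub> x)) ` carrier G"
    unfolding image_image using 1 by (rule image_cong[OF refl])
  finally show "rcosets\<^bsub>H\<^esub> (p ` C) = (\<lambda>Y. p ` Y) ` (rcosets\<^bsub>G\<^esub> C)"
    by (auto simp: RCOSETS_def)
qed

text \<open>Factors from the image of \<open>C\<close> are lifted to \<open>C\<close> one argument
  at a time, so the constancy can be applied upstairs before projecting.\<close>

lemma word_const_image:
  assumes G: "group G" and D: "group D" and p: "p \<in> hom G D"
    and w: "fst ` set w \<subseteq> {..<k}" "g \<in> {..<k} \<rightarrow> carrier G"
    and C: "C \<subseteq> carrier G"
    and const: "\<And>g'. g' \<in> {..<k} \<rightarrow> carrier G \<Longrightarrow> (\<forall>i<k. \<exists>c\<in>C. g' i = c \<otimes>\<^bsub>G\<^esub> g i) \<Longrightarrow>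
      word_map G w g' = word_map G w g"
    and h: "\<forall>i<k. \<exists>b\<in>p ` C. h i = b \<otimes>\<^bsub>D\<^esub> p (g i)"
  shows "word_map D w h = word_map D w (\<lambda>i. p (g i))"
proof -
  interpret p: group_hom G D p using assms by (simp add: group_hom_def group_hom_axioms_def)
  have "\<forall>i\<in>{..<k}. \<exists>c. c \<in> C \<and> h i = p c \<otimes>\<^bsub>D\<^esub> p (g i)" using h by auto
  from bchoice[OF this] obtain c where
    c: "\<And>i. i < k \<Longrightarrow> c i \<in> C \<and> h i = p (c i) \<otimes>\<^bsub>D\<^esub> p (g i)"
    by auto
  have c': "c i \<in> carrier G" "g i \<in> carrier G" if "i < k" for i using c[OF that] that w(2) C by auto
  have "word_map D w h = word_map D w (\<lambda>i. p (c i \<otimes>\<^bsub>G\<^esub> g i))"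
    using c c' by (intro word_map_cong[OF w(1)]) simp
  also have "\<dots> = p (word_map G w (\<lambda>i. c i \<otimes>\<^bsub>G\<^esub> g i))"
    using c' by (intro word_map_hom[OF G D p w(1), symmetric]) auto
  also have "word_map G w (\<lambda>i. c i \<otimes>\<^bsub>G\<^esub> g i) = word_map G w g"
    using c c' by (intro const) auto
  also have "p (word_map G w g) = word_map D w (\<lambda>i. p (g i))"
    by (rule word_map_hom[OF G D p w])
  finally show ?thesis .
qed

lemma (in normal) r_coset_surj_hom:
  "group_hom G (G Mod H) (\<lambda>x. H #> x)" "(\<lambda>x. H #> x) ` carrier G = carrier (G Mod H)"
  using r_coset_hom_Mod factorgroup_is_group
  by (auto simp: group_hom_def group_hom_axioms_def group_axioms FactGroup_def RCOSETS_def)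

lemma (in group) quotient_by_derived_comm:
  assumes "C \<lhd> G" "x \<in> C" "y \<in> C"
  shows "(derived G C #> x) \<otimes>\<^bsub>G Mod derived G C\<^esub> (derived G C #> y) =
    (derived G C #> y) \<otimes>\<^bsub>G Mod derived G C\<^esub> (derived G C #> x)"
proof -
  interpret C: normal C G by fact
  interpret K: normal "derived G C" G by (rule derived_is_normal[OF assms(1)])
  interpret p: group_hom G "G Mod derived G C" "\<lambda>x. derived G C #> x" by (rule K.r_coset_surj_hom)
  have c: "x \<in> carrier G" "y \<in> carrier G" using assms by auto
  have "x \<otimes> y \<otimes> inv x \<otimes> inv y \<in> derived G C"
    unfolding derived_def using assms by (intro generate.incl) auto
  then have "derived G C #> (x \<otimes> y \<otimes> inv (y \<otimes> x)) = \<one>\<^bsub>G Mod derived G C\<^esub>"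
    using K.rcos_const c by (simp add: FactGroup_def m_assoc inv_mult_group)
  then have "derived G C #> (x \<otimes> y) = derived G C #> (y \<otimes> x)"
    using p.hom_mult[of "x \<otimes> y" "inv (y \<otimes> x)"] c
    by (metis inv_closed m_closed p.H.inv_equality p.H.inv_inv p.hom_closed p.hom_inv)
  then show ?thesis using c by simp
qed

context group begin

text \<open>In the quotient by \<open>derived G C\<close> the image of \<open>C\<close> is abelian
  and still of finite index, and constancy on its cosets is inherited. A power that becomes trivial
  there lies in the kernel \<open>derived G C\<close>.\<close>

lemma word_value_pow_in_derived:
  assumes C: "C \<lhd> G" and fin: "finite (rcosets C)"
    and w: "fst ` set w \<subseteq> {..<k}" "g \<in> {..<k} \<rightarrow> carrier G"
    and const: "\<And>g'. g' \<in> {..<k} \<rightarrow> carrier G \<Longrightarrow> (\<forall>i<k. \<exists>c\<in>C. g' i = c \<otimes> g i) \<Longrightarrow>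
      word_map G w g' = word_map G w g"
  shows "\<exists>q>0. word_map G w g [^] (q::nat) \<in> derived G C"
proof -
  define K where "K = derived G C"
  have KN: "K \<lhd> G" unfolding K_def by (rule derived_is_normal[OF C])
  interpret C: normal C G by fact
  interpret K: normal K G by fact
  define D p where "D = G Mod K" and "p = (\<lambda>x. K #> x)"
  interpret p: group_hom G D p unfolding D_def p_def by (rule K.r_coset_surj_hom)
  have surj: "p ` carrier G = carrier D" unfolding D_def p_def by (rule K.r_coset_surj_hom)
  have ker: "x \<in> K" if "x \<in> carrier G" "p x = \<one>\<^bsub>D\<^esub>" for x
    using that rcos_self[OF that(1) K.subgroup_axioms] by (auto simp: p_def D_def FactGroup_def)
  define B where "B = p ` C"
  note im = hom_image_normal[OF group_axioms p.H.group_axioms p.homh surj C, folded B_def]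
  have ab: "x \<otimes>\<^bsub>D\<^esub> y = y \<otimes>\<^bsub>D\<^esub> x" if "x \<in> B" "y \<in> B" for x y
    using that quotient_by_derived_comm[OF C] unfolding B_def p_def D_def K_def by auto
  have finB: "finite (rcosets\<^bsub>D\<^esub> B)" unfolding im(2) using fin by simp
  have "word_map D w (\<lambda>i. p (g i)) [^]\<^bsub>D\<^esub> (card (rcosets\<^bsub>D\<^esub> B) * card (rcosets\<^bsub>D\<^esub> B)) = \<one>\<^bsub>D\<^esub>"
  proof (rule p.H.abelian_by_finite_word_value[OF im(1) ab finB w(1)])
    show "(\<lambda>i. p (g i)) \<in> {..<k} \<rightarrow> carrier D" using w(2) p.hom_closed by (auto simp: Pi_iff)
    show "word_map D w h = word_map D w (\<lambda>i. p (g i))"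
      if "\<forall>i<k. \<exists>b\<in>B. h i = b \<otimes>\<^bsub>D\<^esub> p (g i)" for h
      using that unfolding B_def
      by (intro word_const_image[OF group_axioms p.H.group_axioms p.homh w C.subset const])
  qed
  moreover have "word_map D w (\<lambda>i. p (g i)) = p (word_map G w g)"
    by (rule word_map_hom[OF group_axioms p.H.group_axioms p.homh w, symmetric])
  moreover have z: "word_map G w g \<in> carrier G" by (rule word_map_closed[OF group_axioms w])
  ultimately have "word_map G w g [^] (card (rcosets\<^bsub>D\<^esub> B) * card (rcosets\<^bsub>D\<^esub> B)) \<in> K"
    using p.hom_nat_pow[OF z] by (intro ker) auto
  moreover have "rcosets\<^bsub>D\<^esub> B \<noteq> {}" using p.H.one_closed by (auto simp: RCOSETS_def)
  ultimately show ?thesis using finB unfolding K_def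
    by (intro exI[of _ "card (rcosets\<^bsub>D\<^esub> B) * card (rcosets\<^bsub>D\<^esub> B)"]) (auto simp: card_gt_0_iff)
qed

end

section \<open>Prime divisors of the orders of word values\<close>

context group begin

lemma group_action_restrict:
  assumes cl: "\<And>g x. g \<in> carrier G \<Longrightarrow> x \<in> E \<Longrightarrow> act g x \<in> E"
    and one: "\<And>x. x \<in> E \<Longrightarrow> act \<one> x = x"
    and mult: "\<And>g h x. g \<in> carrier G \<Longrightarrow> h \<in> carrier G \<Longrightarrow> x \<in> E \<Longrightarrow> act (g \<otimes> h) x = act g (act h x)"
  shows "group_action G E (\<lambda>g. \<lambda>x\<in>E. act g x)"
proof -
  have inv: "act g (act (inv g) x) = x" "act (inv g) (act g x) = x" if "g \<in> carrier G" "x \<in> E" for g x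
    using mult[of g "inv g" x] mult[of "inv g" g x] one[OF that(2)] that by auto
  have bij: "bij_betw (act g) E E" if "g \<in> carrier G" for g
    using that inv cl by (intro bij_betw_byWitness[where f' = "act (inv g)"]) auto
  have "(\<lambda>g. \<lambda>x\<in>E. act g x) \<in> hom G (BijGroup E)"
  proof (rule homI)
    show 1: "(\<lambda>x\<in>E. act g x) \<in> carrier (BijGroup E)" if "g \<in> carrier G" for g
      using bij[OF that] by (simp add: BijGroup_def Bij_def)
    show "(\<lambda>x\<in>E. act (g \<otimes> h) x) = (\<lambda>x\<in>E. act g x) \<otimes>\<^bsub>BijGroup E\<^esub> (\<lambda>x\<in>E. act h x)"
      if "g \<in> carrier G" "h \<in> carrier G" for g h
      using 1[OF that(1)] 1[OF that(2)] mult[OF that] cl[OF that(2)]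
      by (auto simp: BijGroup_def compose_def fun_eq_iff)
  qed
  then show ?thesis
    by (simp add: group_action_def group_hom_def group_hom_axioms_def group_axioms group_BijGroup)
qed

text \<open>Orbit sizes divide \<open>p ^ a\<close>, so every orbit other than a single fixed point
  contributes a multiple of \<open>p\<close> to \<open>card E\<close>.\<close>

lemma card_fixed_points_mod:
  assumes cl: "\<And>g x. g \<in> carrier G \<Longrightarrow> x \<in> E \<Longrightarrow> act g x \<in> E"
    and one: "\<And>x. x \<in> E \<Longrightarrow> act \<one> x = x"
    and mult: "\<And>g h x. g \<in> carrier G \<Longrightarrow> h \<in> carrier G \<Longrightarrow> x \<in> E \<Longrightarrow> act (g \<otimes> h) x = act g (act h x)"
    and p: "Factorial_Ring.prime (p::nat)" and ord: "Coset.order G = p ^ a" and finE: "finite E"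
  shows "card E mod p = card {x \<in> E. \<forall>g\<in>carrier G. act g x = x} mod p"
proof -
  define \<phi> where "\<phi> = (\<lambda>g. \<lambda>x\<in>E. act g x)"
  interpret A: group_action G E \<phi> unfolding \<phi>_def using cl one mult by (rule group_action_restrict)
  define Fx where "Fx = {x \<in> E. \<forall>g\<in>carrier G. act g x = x}"
  define Os where "Os = orbits G E \<phi>"
  have orb: "orbit G \<phi> x = (\<lambda>g. act g x) ` carrier G" if "x \<in> E" for x
    using that by (auto simp: orbit_def \<phi>_def)
  have finO: "finite Os" unfolding Os_def orbits_def using finE by simp
  have orb_E: "U \<subseteq> E" if "U \<in> Os" for U
    using that cl orb unfolding Os_def orbits_def by auto
  have sing: "{U \<in> Os. card U = 1} = (\<lambda>x. {x}) ` Fx"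
  proof (intro equalityI subsetI)
    fix U assume "U \<in> {U \<in> Os. card U = 1}"
    then obtain x where x: "x \<in> E" "U = orbit G \<phi> x" "card U = 1" unfolding Os_def orbits_def by auto
    have "act \<one> x \<in> U" unfolding x(2) orb[OF x(1)] by (rule imageI) simp
    then have "U = {x}" using one[OF x(1)] x(3) by (auto simp: card_1_singleton_iff)
    then have "x \<in> Fx" using x(1) unfolding Fx_def x(2) orb[OF x(1)] by auto
    then show "U \<in> (\<lambda>x. {x}) ` Fx" using \<open>U = {x}\<close> by blast
  next
    fix U assume "U \<in> (\<lambda>x. {x}) ` Fx"
    then obtain x where x: "x \<in> Fx" "U = {x}" by blast
    have E: "x \<in> E" using x unfolding Fx_def by auto
    have "orbit G \<phi> x = {x}" using x(1) unfolding orb[OF E] Fx_def by (force simp: image_iff)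
    then show "U \<in> {U \<in> Os. card U = 1}" using E x(2) unfolding Os_def orbits_def by auto
  qed
  have dvd: "p dvd card U" if U: "U \<in> Os" "card U \<noteq> 1" for U
  proof -
    obtain x where x: "x \<in> E" "U = orbit G \<phi> x" using U(1) unfolding Os_def orbits_def by auto
    have "card U dvd p ^ a" using A.orbit_stabilizer_theorem[OF x(1)] unfolding ord x(2) by (metis dvd_triv_left)
    then obtain i where "card U = p ^ i" using divides_primepow_nat[OF p] by blast
    then show ?thesis using U(2) by (cases i) auto
  qed
  have "card E = (\<Sum>x\<in>E. 1)" by simp
  also have "\<dots> = (\<Sum>U\<in>Os. \<Sum>x\<in>U. 1)" unfolding Os_def by (rule A.disjoint_sum[OF finE, symmetric])
  also have "\<dots> = (\<Sum>U\<in>Os. card U)" by simp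
  also have "\<dots> = (\<Sum>U\<in>{U \<in> Os. card U = 1}. card U) + (\<Sum>U\<in>{U \<in> Os. card U \<noteq> 1}. card U)"
    using finO by (subst sum.union_disjoint[symmetric]) (auto intro: sum.cong)
  also have "(\<Sum>U\<in>{U \<in> Os. card U = 1}. card U) = card Fx"
  proof -
    have "(\<Sum>U\<in>{U \<in> Os. card U = 1}. card U) = card {U \<in> Os. card U = 1}" by simp
    also have "\<dots> = card Fx" unfolding sing by (rule card_image) simp
    finally show ?thesis .
  qed
  finally have "card E = card Fx + (\<Sum>U\<in>{U \<in> Os. card U \<noteq> 1}. card U)" .
  moreover obtain c where "(\<Sum>U\<in>{U \<in> Os. card U \<noteq> 1}. card U) = p * c"
    using dvd_sum[of "{U \<in> Os. card U \<noteq> 1}" p card] dvd by auto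
  ultimately show ?thesis unfolding Fx_def[symmetric] by simp
qed

lemma card_fixed_cosets_mod:
  assumes fin: "finite (carrier G)" and H: "subgroup H G" and L: "subgroup L G"
    and p: "Factorial_Ring.prime (p::nat)" and card: "card L = p ^ a"
  shows "card (rcosets H) mod p = card {U \<in> rcosets H. \<forall>l\<in>L. U #> l = U} mod p"
proof -
  interpret L: group "G\<lparr>carrier := L\<rparr>" using L by (rule subgroup_imp_group)
  have Lc: "\<And>l. l \<in> L \<Longrightarrow> l \<in> carrier G" using L subgroup.subset by blast
  have Hc: "H \<subseteq> carrier G" using H subgroup.subset by blast
  have UC: "U \<subseteq> carrier G" if "U \<in> rcosets H" for U
    by (rule subgroup.rcosets_carrier[OF H group_axioms that])
  have linv: "inv l \<in> L" if "l \<in> L" for l using subgroup.m_inv_closed[OF L that] .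
  have cl: "U #> inv l \<in> rcosets H" if U: "U \<in> rcosets H" and l: "l \<in> L" for U l
  proof -
    obtain x where "x \<in> carrier G" "U = H #> x" using U by (auto simp: RCOSETS_def)
    then show ?thesis using Lc[OF l] Hc by (auto simp: coset_mult_assoc intro: rcosetsI)
  qed
  have finR: "finite (rcosets H)"
    using fin by (simp add: RCOSETS_def)
  \<comment> \<open>Multiplying by \<open>inv g\<close> on the right gives a left action. Its fixed
    cosets are those fixed by right multiplication itself, as \<open>L\<close> is closed under
    inverses.\<close>
  have "card (rcosets H) mod p = card {U \<in> rcosets H. \<forall>g\<in>carrier (G\<lparr>carrier := L\<rparr>). U #> inv g = U} mod p"
  proof (rule L.card_fixed_points_mod[OF _ _ _ p _ finR])
    show "U #> inv g \<in> rcosets H" if "g \<in> carrier (G\<lparr>carrier := L\<rparr>)" "U \<in> rcosets H" for g U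
      using that cl by auto
    show "U #> inv \<one>\<^bsub>G\<lparr>carrier := L\<rparr>\<^esub> = U" if "U \<in> rcosets H" for U
      using UC[OF that] by simp
    show "U #> inv (g \<otimes>\<^bsub>G\<lparr>carrier := L\<rparr>\<^esub> h) = U #> inv h #> inv g"
      if "g \<in> carrier (G\<lparr>carrier := L\<rparr>)" "h \<in> carrier (G\<lparr>carrier := L\<rparr>)" "U \<in> rcosets H" for g h U
      using that UC[OF that(3)] Lc by (simp add: inv_mult_group coset_mult_assoc)
    show "Coset.order (G\<lparr>carrier := L\<rparr>) = p ^ a" using card by (simp add: Coset.order_def)
  qed
  moreover have "(\<forall>g\<in>L. U #> inv g = U) \<longleftrightarrow> (\<forall>g\<in>L. U #> g = U)" for U
    using linv Lc by (metis inv_inv)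
  ultimately show ?thesis by simp
qed

lemma fixed_coset_iff:
  assumes H: "subgroup H G" and x: "x \<in> carrier G" and l: "l \<in> carrier G"
  shows "H #> x #> l = H #> x \<longleftrightarrow> x \<otimes> l \<otimes> inv x \<in> H"
proof -
  have Hc: "H \<subseteq> carrier G" using H subgroup.subset by blast
  have "H #> x #> l = H #> x \<longleftrightarrow> H #> (x \<otimes> l) = H #> x"
    using Hc x l by (simp add: coset_mult_assoc)
  also have "\<dots> \<longleftrightarrow> x \<otimes> l \<in> H #> x"
    using x l H by (metis m_closed rcos_self repr_independence)
  also have "\<dots> \<longleftrightarrow> x \<otimes> l \<otimes> inv x \<in> H"
    using x l subgroup.rcos_module[OF H group_axioms, of x "x \<otimes> l"] by simp
  finally show ?thesis .
qed

text \<open>The conjugacy part of Sylow's theorem. The number of cosets of \<open>H\<close> is prime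
  to \<open>p\<close>, so the \<open>p\<close>-group \<open>L\<close> fixes some coset
  \<open>H #> x\<close>, and this means that conjugation by \<open>x\<close> carries
  \<open>L\<close> into \<open>H\<close>.\<close>

lemma p_subgroup_conjugate_into:
  assumes fin: "finite (carrier G)" and H: "subgroup H G" and L: "subgroup L G"
    and p: "Factorial_Ring.prime (p::nat)" and card: "card L = p ^ a" and nd: "\<not> p dvd card (rcosets H)"
  shows "\<exists>x\<in>carrier G. \<forall>l\<in>L. x \<otimes> l \<otimes> inv x \<in> H"
proof -
  have "{U \<in> rcosets H. \<forall>l\<in>L. U #> l = U} \<noteq> {}"
  proof
    assume e: "{U \<in> rcosets H. \<forall>l\<in>L. U #> l = U} = {}"
    have "card (rcosets H) mod p = 0" using card_fixed_cosets_mod[OF fin H L p card] unfolding e by simp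
    then show False using nd by auto
  qed
  then obtain U where U: "U \<in> rcosets H" "\<forall>l\<in>L. U #> l = U" by blast
  then obtain x where x: "x \<in> carrier G" "U = H #> x" by (auto simp: RCOSETS_def)
  have "x \<otimes> l \<otimes> inv x \<in> H" if l: "l \<in> L" for l
  proof -
    have "H #> x #> l = H #> x" using U(2) l x(2) by simp
    then show ?thesis using fixed_coset_iff[OF H x(1) subgroup.mem_carrier[OF L l]] by simp
  qed
  then show ?thesis using x by blast
qed

text \<open>The condition asks only for containment. For inverses the finiteness of \<open>L\<close>
  helps: conjugation is an injective map of \<open>L\<close> to itself, hence onto.\<close>

lemma normalizing_elements_subgroup:
  assumes S: "subgroup S G" and L: "finite L" "L \<subseteq> carrier G"
  shows "subgroup {x \<in> S. \<forall>l\<in>L. x \<otimes> l \<otimes> inv x \<in> L} G"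
proof (rule subgroupI)
  have Sc: "\<And>x. x \<in> S \<Longrightarrow> x \<in> carrier G" using S subgroup.subset by blast
  have Lc: "\<And>x. x \<in> L \<Longrightarrow> x \<in> carrier G" using L by blast
  let ?N = "{x \<in> S. \<forall>l\<in>L. x \<otimes> l \<otimes> inv x \<in> L}"
  show "?N \<subseteq> carrier G" using Sc by auto
  have "\<one> \<in> ?N" using subgroup.one_closed[OF S] Lc by auto
  then show "?N \<noteq> {}" by blast
  show "x \<otimes> y \<in> ?N" if x: "x \<in> ?N" and y: "y \<in> ?N" for x y
  proof -
    have "x \<otimes> y \<otimes> l \<otimes> inv (x \<otimes> y) \<in> L" if l: "l \<in> L" for l
    proof -
      have "x \<otimes> (y \<otimes> l \<otimes> inv y) \<otimes> inv x \<in> L" using x y l by auto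
      moreover have "x \<otimes> y \<otimes> l \<otimes> inv (x \<otimes> y) = x \<otimes> (y \<otimes> l \<otimes> inv y) \<otimes> inv x"
        using x y l Sc Lc by (simp add: m_assoc inv_mult_group)
      ultimately show ?thesis by simp
    qed
    then show ?thesis using x y subgroup.m_closed[OF S] by auto
  qed
  show "inv x \<in> ?N" if x: "x \<in> ?N" for x
  proof -
    have xc: "x \<in> carrier G" using x Sc by auto
    have inj: "inj_on (\<lambda>l. x \<otimes> l \<otimes> inv x) L" using xc Lc by (intro inj_onI) simp
    have im: "(\<lambda>l. x \<otimes> l \<otimes> inv x) ` L = L" using x by (intro endo_inj_surj[OF L(1) _ inj]) auto
    have "inv x \<otimes> l \<otimes> inv (inv x) \<in> L" if l: "l \<in> L" for l
    proof -
      from l im have "l \<in> (\<lambda>l. x \<otimes> l \<otimes> inv x) ` L" by simp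
      then obtain l' where l': "l' \<in> L" "l = x \<otimes> l' \<otimes> inv x" by (rule imageE)
      show ?thesis using l'(1) Lc[OF l'(1)] xc unfolding l'(2) by (simp add: m_assoc)
    qed
    then show ?thesis using x subgroup.m_inv_closed[OF S] by auto
  qed
qed

text \<open>A maximal proper subgroup \<open>M\<close> of a \<open>p\<close>-group is normal,
  because it is properly contained in its normalizer. The quotient by \<open>M\<close> is abelian:
  for \<open>y\<close> outside \<open>M\<close>, the elements commuting with \<open>y\<close> modulo
  \<open>M\<close> form a subgroup that contains \<open>M\<close> and \<open>y\<close>, so it is
  everything. Hence all commutators lie in \<open>M\<close>.\<close>

lemma p_group_derived_neq:
  assumes fin: "finite (carrier G)" and p: "Factorial_Ring.prime (p::nat)"
    and ord: "Coset.order G = p ^ a" and ne: "carrier G \<noteq> {\<one>}"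
  shows "derived G (carrier G) \<noteq> carrier G"
proof -
  define A where "A = {M. subgroup M G \<and> M \<noteq> carrier G}"
  have "A \<subseteq> Pow (carrier G)" unfolding A_def using subgroup.subset by blast
  then have "finite A" using fin finite_subset by blast
  moreover have "{\<one>} \<in> A" unfolding A_def using triv_subgroup ne by auto
  ultimately obtain M where M: "subgroup M G" "M \<noteq> carrier G"
    and max: "\<And>M'. subgroup M' G \<Longrightarrow> M \<subseteq> M' \<Longrightarrow> M' \<noteq> M \<Longrightarrow> M' = carrier G"
    using finite_has_maximal[of A] unfolding A_def by blast
  have Mc: "\<And>x. x \<in> M \<Longrightarrow> x \<in> carrier G" using M subgroup.subset by blast
  have finM: "finite M" using fin Mc by (meson finite_subset subsetI)
  have lag: "card (rcosets M) * card M = p ^ a" using lagrange[OF M(1)] ord by simp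
  then obtain b where b: "card M = p ^ b" by (metis divides_primepow_nat[OF p] dvd_triv_right)
  obtain c where c: "card (rcosets M) = p ^ c" using lag by (metis divides_primepow_nat[OF p] dvd_triv_left)
  have "c \<noteq> 0"
  proof
    assume "c = 0"
    then have "card M = card (carrier G)" using lag c ord by (simp add: Coset.order_def)
    then have "M = carrier G" using fin Mc by (intro card_subset_eq) auto
    then show False using M(2) by simp
  qed
  then have pd: "p dvd card (rcosets M)" using c by simp
  define Fx where "Fx = {U \<in> rcosets M. \<forall>l\<in>M. U #> l = U}"
  \<comment> \<open>The number of cosets fixed by \<open>M\<close> is a multiple of
    \<open>p\<close>, and \<open>M\<close> itself is one of them, so there is another. A
    representative of it normalizes \<open>M\<close> without lying in \<open>M\<close>.\<close>
  have "card Fx mod p = 0" using card_fixed_cosets_mod[OF fin M(1) M(1) p b] pd unfolding Fx_def by simp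
  then have "card Fx \<noteq> 1" using prime_gt_1_nat[OF p] by auto
  moreover have MF: "M \<in> Fx"
    unfolding Fx_def using M(1) Mc subgroup.subgroup_in_rcosets[OF M(1) group_axioms] by (auto simp: coset_join2)
  ultimately have "Fx \<noteq> {M}" by auto
  with MF obtain U where U: "U \<in> Fx" "U \<noteq> M" by blast
  then obtain x where x: "x \<in> carrier G" "U = M #> x" unfolding Fx_def by (auto simp: RCOSETS_def)
  have xM: "x \<notin> M" using U(2) x M(1) by (auto simp: coset_join2)
  define Nz where "Nz = {x \<in> carrier G. \<forall>l\<in>M. x \<otimes> l \<otimes> inv x \<in> M}"
  have "subgroup Nz G" unfolding Nz_def using finM Mc by (intro normalizing_elements_subgroup subgroup_self) auto
  moreover have "M \<subseteq> Nz" unfolding Nz_def using Mc subgroup.m_closed[OF M(1)] subgroup.m_inv_closed[OF M(1)] by auto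
  moreover have "x \<in> Nz"
  proof -
    have "x \<otimes> l \<otimes> inv x \<in> M" if l: "l \<in> M" for l
    proof -
      have "M #> x #> l = M #> x" using U(1) l x(2) unfolding Fx_def by simp
      then show ?thesis using fixed_coset_iff[OF M(1) x(1) Mc[OF l]] by simp
    qed
    then show ?thesis unfolding Nz_def using x by auto
  qed
  ultimately have "Nz = carrier G" using max xM by blast
  then have MN: "M \<lhd> G" using M(1) unfolding Nz_def normal_inv_iff by blast
  interpret M: normal M G by (rule MN)
  define D q where "D = G Mod M" and "q = (\<lambda>x. M #> x)"
  interpret q: group_hom G D q unfolding D_def q_def by (rule M.r_coset_surj_hom)
  have q1: "q x = \<one>\<^bsub>D\<^esub> \<longleftrightarrow> x \<in> M" if "x \<in> carrier G" for x
    using that M.rcos_const rcos_self[OF that M.subgroup_axioms] unfolding q_def D_def FactGroup_def by auto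
  have comm: "q x \<otimes>\<^bsub>D\<^esub> q y = q y \<otimes>\<^bsub>D\<^esub> q x" if x: "x \<in> carrier G" and y: "y \<in> carrier G" for x y
  proof (cases "y \<in> M")
    case True
    then have "q y = \<one>\<^bsub>D\<^esub>" using q1[OF y] by simp
    then show ?thesis using x by simp
  next
    case False
    define Cy where "Cy = {x \<in> carrier G. q x \<otimes>\<^bsub>D\<^esub> q y = q y \<otimes>\<^bsub>D\<^esub> q x}"
    have "subgroup Cy G"
    proof (rule subgroupI)
      show "Cy \<subseteq> carrier G" "Cy \<noteq> {}" unfolding Cy_def using y by auto
      show "inv u \<in> Cy" if "u \<in> Cy" for u
      proof -
        have u: "u \<in> carrier G" "q u \<otimes>\<^bsub>D\<^esub> q y = q y \<otimes>\<^bsub>D\<^esub> q u" using that unfolding Cy_def by auto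
        have "inv\<^bsub>D\<^esub> q u \<otimes>\<^bsub>D\<^esub> (q y \<otimes>\<^bsub>D\<^esub> q u) \<otimes>\<^bsub>D\<^esub> inv\<^bsub>D\<^esub> q u = inv\<^bsub>D\<^esub> q u \<otimes>\<^bsub>D\<^esub> (q u \<otimes>\<^bsub>D\<^esub> q y) \<otimes>\<^bsub>D\<^esub> inv\<^bsub>D\<^esub> q u"
          using u(2) by simp
        then have "inv\<^bsub>D\<^esub> q u \<otimes>\<^bsub>D\<^esub> q y = q y \<otimes>\<^bsub>D\<^esub> inv\<^bsub>D\<^esub> q u"
          using u(1) y by (simp add: q.H.m_assoc)
        then show ?thesis using u(1) unfolding Cy_def by simp
      qed
      show "u \<otimes> v \<in> Cy" if "u \<in> Cy" "v \<in> Cy" for u v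
      proof -
        have u: "u \<in> carrier G" "q u \<otimes>\<^bsub>D\<^esub> q y = q y \<otimes>\<^bsub>D\<^esub> q u"
          and v: "v \<in> carrier G" "q v \<otimes>\<^bsub>D\<^esub> q y = q y \<otimes>\<^bsub>D\<^esub> q v" using that unfolding Cy_def by auto
        have "q u \<otimes>\<^bsub>D\<^esub> q v \<otimes>\<^bsub>D\<^esub> q y = q u \<otimes>\<^bsub>D\<^esub> (q y \<otimes>\<^bsub>D\<^esub> q v)"
          using u(1) v y by (simp add: q.H.m_assoc)
        also have "\<dots> = q y \<otimes>\<^bsub>D\<^esub> q u \<otimes>\<^bsub>D\<^esub> q v" using u(2)[symmetric] u(1) v(1) y by (simp add: q.H.m_assoc)
        finally show ?thesis using u v y unfolding Cy_def by (simp add: q.H.m_assoc)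
      qed
    qed
    moreover have "M \<subseteq> Cy"
    proof
      fix u assume "u \<in> M"
      then have "u \<in> carrier G" "q u = \<one>\<^bsub>D\<^esub>" using q1 Mc by auto
      then show "u \<in> Cy" unfolding Cy_def using y by simp
    qed
    moreover have "y \<in> Cy" unfolding Cy_def using y by auto
    ultimately have "Cy = carrier G" using max False by blast
    then show ?thesis using x unfolding Cy_def by blast
  qed
  have "x \<otimes> y \<otimes> inv x \<otimes> inv y \<in> M" if x: "x \<in> carrier G" and y: "y \<in> carrier G" for x y
  proof -
    have "q (x \<otimes> y \<otimes> inv x \<otimes> inv y) = q x \<otimes>\<^bsub>D\<^esub> q y \<otimes>\<^bsub>D\<^esub> inv\<^bsub>D\<^esub> q x \<otimes>\<^bsub>D\<^esub> inv\<^bsub>D\<^esub> q y" using x y by simp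
    also have "\<dots> = q y \<otimes>\<^bsub>D\<^esub> q x \<otimes>\<^bsub>D\<^esub> inv\<^bsub>D\<^esub> q x \<otimes>\<^bsub>D\<^esub> inv\<^bsub>D\<^esub> q y" unfolding comm[OF x y] ..
    also have "\<dots> = \<one>\<^bsub>D\<^esub>" using x y by (simp add: q.H.m_assoc)
    finally have "q (x \<otimes> y \<otimes> inv x \<otimes> inv y) = \<one>\<^bsub>D\<^esub>" .
    moreover have "x \<otimes> y \<otimes> inv x \<otimes> inv y \<in> carrier G" using x y by simp
    ultimately show ?thesis using q1 by blast
  qed
  then have "derived G (carrier G) \<subseteq> M" unfolding derived_def by (intro generate_subgroup_incl M(1)) auto
  then show ?thesis using M(2) subgroup.subset[OF M(1)] by auto
qed

end

section \<open>Supplements of normal subgroups in finite groups\<close>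

lemma exists_mult_Suc_cong_0:
  fixes s m :: nat
  assumes "coprime s m" "m > 0"
  shows "\<exists>j. m dvd j * s + 1"
proof -
  obtain x where "[s * x = Suc 0] (mod m)" using cong_solve_coprime_nat[OF assms(1)] by blast
  \<comment> \<open>Multiplication by \<open>m - 1\<close> plays the role of a change of sign modulo
    \<open>m\<close>.\<close>
  then have "[s * x * (m - 1) + 1 = Suc 0 * (m - 1) + 1] (mod m)"
    by (intro cong_add cong_mult cong_refl)
  from cong_dvd_iff[OF this] have "m dvd (x * (m - 1)) * s + 1" using assms(2) by (simp add: mult_ac)
  then show ?thesis by blast
qed

context group begin

text \<open>A weak form of the Schur-Zassenhaus theorem that only asks for a proper supplement.
  Modulo \<open>derived G L\<close> there is an endomorphism that kills the image of
  \<open>L\<close> and moves every element within its coset of that image. Its image therefore meets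
  all cosets, and it is proper because the endomorphism has a nontrivial kernel. The subgroup
  \<open>S\<close> is the preimage of this image.\<close>

lemma coprime_normal_supplement:
  assumes fin: "finite (carrier G)" and L: "L \<lhd> G" and cop: "coprime (card (rcosets L)) (card L)"
    and der: "derived G L \<noteq> L"
  shows "\<exists>S. subgroup S G \<and> S \<noteq> carrier G \<and> (\<forall>x\<in>carrier G. \<exists>l\<in>L. l \<otimes> x \<in> S)"
proof -
  define K where "K = derived G L"
  interpret L: normal L G by (rule L)
  interpret K: normal K G unfolding K_def by (rule derived_is_normal[OF L])
  have finL: "finite L" using fin L.subset finite_subset by blast
  have KL: "K \<subseteq> L" unfolding K_def using derived_incl[OF subset_refl L.subgroup_axioms] .
  define D p where "D = G Mod K" and "p = (\<lambda>x. K #> x)"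
  interpret p: group_hom G D p unfolding D_def p_def by (rule K.r_coset_surj_hom)
  have surj: "p ` carrier G = carrier D" unfolding D_def p_def by (rule K.r_coset_surj_hom)
  define B where "B = p ` L"
  note im = hom_image_normal[OF group_axioms p.H.group_axioms p.homh surj L, folded B_def]
  have ab: "x \<otimes>\<^bsub>D\<^esub> y = y \<otimes>\<^bsub>D\<^esub> x" if "x \<in> B" "y \<in> B" for x y
    using that quotient_by_derived_comm[OF L] unfolding B_def p_def D_def K_def by auto
  \<comment> \<open>A coset of \<open>L\<close> can be recovered from its image, since
    \<open>K\<close> lies in \<open>L\<close>. So the index of \<open>L\<close> does not change in
    the quotient.\<close>
  have "\<Union> (p ` U) = U" if U: "U \<in> rcosets L" for U
  proof -
    obtain x where x: "x \<in> carrier G" "U = L #> x" using U by (auto simp: RCOSETS_def)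
    have "p u \<subseteq> U" if "u \<in> U" for u
    proof
      fix y assume "y \<in> p u"
      then obtain c where c: "c \<in> K" "y = c \<otimes> u" unfolding p_def r_coset_def by auto
      obtain l where l: "l \<in> L" "u = l \<otimes> x" using \<open>u \<in> U\<close> x unfolding r_coset_def by auto
      have "y = (c \<otimes> l) \<otimes> x" "c \<otimes> l \<in> L" using c l x KL by (auto simp: m_assoc)
      then show "y \<in> U" unfolding x(2) r_coset_def by auto
    qed
    moreover have "u \<in> p u" if "u \<in> U" for u
      using rcos_self[OF subsetD[OF L.rcosets_carrier[OF group_axioms U] that] K.subgroup_axioms] by (simp add: p_def)
    ultimately show ?thesis by blast
  qed
  then have inj: "inj_on (\<lambda>U. p ` U) (rcosets L)" by (intro inj_on_inverseI[of _ Union]) auto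
  then have card: "card (rcosets\<^bsub>D\<^esub> B) = card (rcosets L)" unfolding im(2) by (rule card_image)
  have finB: "finite (rcosets\<^bsub>D\<^esub> B)" unfolding im(2) using fin by (simp add: RCOSETS_def)
  have "L \<noteq> {}" using L.one_closed by blast
  then have "card L > 0" using finL by (simp add: card_gt_0_iff)
  \<comment> \<open>With this \<open>j\<close> the power map that \<theta> induces on
    \<open>B\<close> has an exponent divisible by \<open>card L\<close>, and so it is
    trivial.\<close>
  then obtain j where j: "card L dvd j * card (rcosets\<^bsub>D\<^esub> B) + 1"
    using exists_mult_Suc_cong_0[OF cop] unfolding card by blast
  obtain \<theta> where \<theta>: "\<theta> \<in> hom D D" "\<forall>d\<in>carrier D. \<exists>b\<in>B. \<theta> d = b \<otimes>\<^bsub>D\<^esub> d"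
    "\<forall>b\<in>B. \<theta> b = b [^]\<^bsub>D\<^esub> (j * card (rcosets\<^bsub>D\<^esub> B) + 1)"
    using p.H.near_identity_endomorphism[OF im(1) ab finB, of j] by blast
  interpret t: group_hom D D \<theta> using \<theta>(1) by (simp add: group_hom_def group_hom_axioms_def p.H.group_axioms)
  have \<theta>B: "\<theta> b = \<one>\<^bsub>D\<^esub>" if b: "b \<in> B" for b
  proof -
    obtain l where l: "l \<in> L" "b = p l" using b unfolding B_def by blast
    have "l [^] card L = \<one>"
      using group.pow_order_eq_1[OF subgroup_imp_group[OF L.subgroup_axioms], of l] l(1)
      by (simp add: Coset.order_def nat_pow_consistent[symmetric])
    then have "b [^]\<^bsub>D\<^esub> card L = \<one>\<^bsub>D\<^esub>" using l p.hom_nat_pow[of l "card L"] by auto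
    moreover obtain c where "j * card (rcosets\<^bsub>D\<^esub> B) + 1 = card L * c" using j by blast
    moreover have "b \<in> carrier D" using l by auto
    ultimately have "b [^]\<^bsub>D\<^esub> (j * card (rcosets\<^bsub>D\<^esub> B) + 1) = \<one>\<^bsub>D\<^esub>"
      by (metis p.H.nat_pow_pow p.H.nat_pow_one)
    then show ?thesis using \<theta>(3) b by simp
  qed
  define S where "S = {x \<in> carrier G. p x \<in> \<theta> ` carrier D}"
  interpret Im: subgroup "\<theta> ` carrier D" D by (rule t.img_is_subgroup)
  have "subgroup S G"
  proof (rule subgroupI)
    have "\<one> \<in> S" unfolding S_def using Im.one_closed by simp
    then show "S \<noteq> {}" by blast
  qed (auto simp: S_def)
  moreover have "S \<noteq> carrier G"
  proof
    assume S: "S = carrier G"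
    have sub: "carrier D \<subseteq> \<theta> ` carrier D"
    proof
      fix d assume "d \<in> carrier D"
      then obtain x where "x \<in> carrier G" "d = p x" unfolding surj[symmetric] by blast
      then show "d \<in> \<theta> ` carrier D" using S unfolding S_def by blast
    qed
    have "finite (carrier D)" unfolding surj[symmetric] using fin by (rule finite_imageI)
    \<comment> \<open>An onto endomorphism of a finite group is injective, yet \<theta> kills the
      image of \<open>L\<close>; this would give \<open>L = K\<close>.\<close>
    then have inj: "inj_on \<theta> (carrier D)" using finite_surj_inj[OF _ sub] by simp
    have "l \<in> K" if l: "l \<in> L" for l
    proof -
      have "p l \<in> carrier D" "\<theta> (p l) = \<theta> \<one>\<^bsub>D\<^esub>" using l \<theta>B[of "p l"] unfolding B_def by auto
      then have "p l = \<one>\<^bsub>D\<^esub>" using inj p.H.one_closed by (meson inj_onD)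
      then show ?thesis using rcos_self[OF _ K.subgroup_axioms, of l] l unfolding p_def D_def FactGroup_def by auto
    qed
    then show False using KL der unfolding K_def by blast
  qed
  moreover have "\<exists>l\<in>L. l \<otimes> x \<in> S" if x: "x \<in> carrier G" for x
  proof -
    have "p x \<in> carrier D" using x by simp
    then obtain l where "l \<in> L" "\<theta> (p x) = p l \<otimes>\<^bsub>D\<^esub> p x" using \<theta>(2) unfolding B_def by blast
    then have "p (l \<otimes> x) = \<theta> (p x)" using x by simp
    then have "l \<otimes> x \<in> S" unfolding S_def using x \<open>l \<in> L\<close> by auto
    then show ?thesis using \<open>l \<in> L\<close> by blast
  qed
  ultimately show ?thesis by blast
qed

text \<open>
  A minimal supplement of \<open>N\<close> works: by the Frattini argument its Sylow \<open>p\<close>-subgroup is normal,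
  so a smaller supplement would exist if \<open>p\<close> divided its order.
\<close>

lemma supplement_of_coprime_order:
  assumes fin: "finite (carrier G)" and N: "N \<lhd> G"
    and p: "Factorial_Ring.prime (p::nat)" and nd: "\<not> p dvd card (rcosets N)"
  shows "\<exists>S. subgroup S G \<and> (\<forall>x\<in>carrier G. \<exists>n\<in>N. n \<otimes> x \<in> S) \<and> \<not> p dvd card S"
proof -
  interpret N: normal N G by (rule N)
  define A where "A = {S. subgroup S G \<and> (\<forall>x\<in>carrier G. \<exists>n\<in>N. n \<otimes> x \<in> S)}"
  have "A \<subseteq> Pow (carrier G)" unfolding A_def using subgroup.subset by blast
  then have "finite A" using fin finite_subset by blast
  moreover have "carrier G \<in> A"
  proof -
    have "\<exists>n\<in>N. n \<otimes> x \<in> carrier G" if "x \<in> carrier G" for x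
      by (rule bexI[OF _ N.one_closed]) (use that in simp)
    then show ?thesis unfolding A_def using subgroup_self by blast
  qed
  ultimately obtain S where SA: "S \<in> A" and min: "\<And>S'. S' \<in> A \<Longrightarrow> S' \<subseteq> S \<Longrightarrow> S' = S"
    using finite_has_minimal[of A] by blast
  have S: "subgroup S G" and supp: "\<And>x. x \<in> carrier G \<Longrightarrow> \<exists>n\<in>N. n \<otimes> x \<in> S"
    using SA unfolding A_def by auto
  interpret S: subgroup S G by (rule S)
  have "\<not> p dvd card S"
  proof
    assume pd: "p dvd card S"
    have finS: "finite S" using fin S.subset finite_subset by blast
    define GS where "GS = G\<lparr>carrier := S\<rparr>"
    interpret GS: group GS unfolding GS_def using S by (rule subgroup_imp_group)
    have "S \<noteq> {}" using S.one_closed by blast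
    then have cS: "card S \<noteq> 0" using finS by simp
    define a where "a = multiplicity p (card S)"
    obtain m where m: "card S = p ^ a * m" "\<not> p dvd m"
      using multiplicity_decompose'[of "card S" p] cS p unfolding a_def by (metis not_prime_unit)
    have a0: "a \<noteq> 0" using pd cS p unfolding a_def by (simp add: prime_elem_multiplicity_eq_zero_iff)
    obtain L where LGS: "subgroup L GS" and cL: "card L = p ^ a"
      using sylow_thm[OF p GS.group_axioms, of a m] m finS unfolding GS_def by (auto simp: Coset.order_def)
    have LS: "L \<subseteq> S" using subgroup.subset[OF LGS] unfolding GS_def by simp
    have L: "subgroup L G" using incl_subgroup[OF S] LGS unfolding GS_def by blast
    interpret L: subgroup L G by (rule L)
    have finL: "finite L" using LS finS finite_subset by blast
    \<comment> \<open>The order of \<open>G/N\<close> is prime to \<open>p\<close>, so elements of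
      \<open>p\<close>-power order become trivial there.\<close>
    have LN: "L \<subseteq> N"
    proof
      fix l assume l: "l \<in> L"
      have finN: "finite (rcosets N)" using fin by (simp add: RCOSETS_def)
      have 1: "l [^] card (rcosets N) \<in> N" using pow_card_rcosets[OF N finN] l by simp
      have 2: "l [^] (p ^ a) = \<one>"
        using group.pow_order_eq_1[OF subgroup_imp_group[OF L], of l] l cL
        by (simp add: Coset.order_def nat_pow_consistent[symmetric])
      have "coprime (card (rcosets N)) (p ^ a)"
        using prime_imp_coprime[OF p nd] by (simp add: coprime_commute)
      moreover have "card (rcosets N) \<noteq> 0" using nd by (metis dvd_0_right)
      ultimately obtain x y where xy: "card (rcosets N) * x = p ^ a * y + 1"
        using bezout_nat[of "card (rcosets N)" "p ^ a"] by (auto simp: coprime_iff_gcd_eq_1)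
      have "l [^] (card (rcosets N) * x) = l"
        unfolding xy using l 2 by (simp add: nat_pow_mult[symmetric] nat_pow_pow[symmetric])
      moreover have "l [^] (card (rcosets N) * x) \<in> N"
      proof -
        have "(l [^] card (rcosets N)) [^] n \<in> N" for n :: nat
          using 1 by (induction n) (auto intro: N.m_closed)
        then show ?thesis using l by (simp add: nat_pow_pow)
      qed
      ultimately show "l \<in> N" by simp
    qed
    define T where "T = S \<inter> N"
    have T: "subgroup T G" unfolding T_def by (rule subgroups_Inter_pair[OF S N.subgroup_axioms])
    define S' where "S' = {x \<in> S. \<forall>l\<in>L. x \<otimes> l \<otimes> inv x \<in> L}"
    have "subgroup S' G" unfolding S'_def using finL by (intro normalizing_elements_subgroup S) auto
    \<comment> \<open>The Frattini argument: \<open>L\<close> and its conjugate by \<open>s\<close>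
      are both Sylow in \<open>T\<close>, so some \<open>t\<close> in \<open>T\<close> carries the
      conjugate back to \<open>L\<close>. Then \<open>t \<otimes> s\<close> normalizes
      \<open>L\<close> and represents the same coset of \<open>N\<close> as
      \<open>g\<close>.\<close>
    moreover have "\<exists>n\<in>N. n \<otimes> g \<in> S'" if g: "g \<in> carrier G" for g
    proof -
      obtain n where n: "n \<in> N" "n \<otimes> g \<in> S" using supp[OF g] by blast
      define s where "s = n \<otimes> g"
      have s: "s \<in> S" "s \<in> carrier G" using n unfolding s_def by auto
      define L' where "L' = (\<lambda>l. s \<otimes> l \<otimes> inv s) ` L"
      interpret c: group_hom G G "\<lambda>l. s \<otimes> l \<otimes> inv s"
        using conj_hom[OF s(2)] by (simp add: group_hom_def group_hom_axioms_def group_axioms)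
      have L': "subgroup L' G" unfolding L'_def by (rule c.subgroup_img_is_subgroup[OF L])
      have L'T: "L' \<subseteq> T" unfolding L'_def T_def using s LS LN N.inv_op_closed2 by auto
      have LT: "L \<subseteq> T" using LS LN unfolding T_def by auto
      have "inj_on (\<lambda>l. s \<otimes> l \<otimes> inv s) L" using s by (intro inj_onI) simp
      then have cL': "card L' = p ^ a" unfolding L'_def using card_image cL by metis
      define GT where "GT = G\<lparr>carrier := T\<rparr>"
      interpret GT: group GT unfolding GT_def using T by (rule subgroup_imp_group)
      have LGT: "subgroup L GT" "subgroup L' GT"
        unfolding GT_def using subgroup_incl[OF L T LT] subgroup_incl[OF L' T L'T] by auto
      \<comment> \<open>\<open>L\<close> is Sylow in \<open>S\<close>, hence also in every
        intermediate subgroup such as \<open>T\<close>.\<close>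
      have ndT: "\<not> p dvd card (rcosets\<^bsub>GT\<^esub> L)"
      proof
        assume pd: "p dvd card (rcosets\<^bsub>GT\<^esub> L)"
        have "card T = card (rcosets\<^bsub>GT\<^esub> L) * p ^ a"
          using GT.lagrange[OF LGT(1)] cL unfolding GT_def by (simp add: Coset.order_def)
        then have "p * p ^ a dvd card T" using mult_dvd_mono[OF pd dvd_refl, of "p ^ a"] by (simp only:)
        moreover have "subgroup T GS" unfolding GS_def using subgroup_incl[OF T S] T_def by auto
        then have "card S = card (rcosets\<^bsub>GS\<^esub> T) * card T"
          using GS.lagrange[of T] unfolding GS_def by (simp add: Coset.order_def)
        then have "card T dvd card S" by (metis dvd_triv_right)
        ultimately have "p * p ^ a dvd card S" by (rule dvd_trans)
        then have "p ^ a * p dvd p ^ a * m" unfolding m(1) by (simp add: mult.commute)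
        then show False using m(2) prime_gt_0_nat[OF p] by simp
      qed
      have finT: "finite (carrier GT)"
        unfolding GT_def using finite_subset[OF subgroup.subset[OF T] fin] by simp
      obtain t where "t \<in> carrier GT" "\<forall>l\<in>L'. t \<otimes>\<^bsub>GT\<^esub> l \<otimes>\<^bsub>GT\<^esub> inv\<^bsub>GT\<^esub> t \<in> L"
        using GT.p_subgroup_conjugate_into[OF finT LGT p cL' ndT] by blast
      then have t: "t \<in> T" "\<forall>l\<in>L'. t \<otimes> l \<otimes> inv t \<in> L"
        unfolding GT_def using m_inv_consistent[OF T] by auto
      have tc: "t \<in> carrier G" "t \<in> S" "t \<in> N" using t unfolding T_def by auto
      have "(t \<otimes> s) \<otimes> l \<otimes> inv (t \<otimes> s) \<in> L" if l: "l \<in> L" for l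
      proof -
        have "t \<otimes> (s \<otimes> l \<otimes> inv s) \<otimes> inv t \<in> L" using t(2) l unfolding L'_def by auto
        then show ?thesis using tc s l by (simp add: m_assoc inv_mult_group)
      qed
      then have "t \<otimes> s \<in> S'" unfolding S'_def using tc s by auto
      moreover have "t \<otimes> s = (t \<otimes> n) \<otimes> g" unfolding s_def using tc n g by (simp add: m_assoc)
      moreover have "t \<otimes> n \<in> N" using tc n by simp
      ultimately show ?thesis by auto
    qed
    ultimately have "S' \<in> A" unfolding A_def by blast
    \<comment> \<open>Minimality makes the normalizer of \<open>L\<close> in \<open>S\<close> equal
      to \<open>S\<close>.\<close>
    then have S'S: "S' = S" by (rule min) (auto simp: S'_def)
    have LNGS: "L \<lhd> GS"
      using LGS S'S m_inv_consistent[OF S] unfolding GS.normal_inv_iff S'_def by (auto simp: GS_def)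
    have idx: "card (rcosets\<^bsub>GS\<^esub> L) = m"
      using GS.lagrange[OF LGS] m(1) cL p unfolding GS_def by (auto simp: Coset.order_def mult.commute prime_gt_0_nat)
    have der: "derived GS L \<noteq> L"
    proof -
      define GL where "GL = G\<lparr>carrier := L\<rparr>"
      interpret GL: group GL unfolding GL_def using L by (rule subgroup_imp_group)
      have "derived GL (carrier GL) \<noteq> carrier GL"
      proof (rule GL.p_group_derived_neq[OF _ p])
        show "finite (carrier GL)" using finL by (simp add: GL_def)
        show "Coset.order GL = p ^ a" using cL by (simp add: GL_def Coset.order_def)
        have "card L \<noteq> 1" using cL a0 prime_gt_1_nat[OF p] by auto
        then show "carrier GL \<noteq> {\<one>\<^bsub>GL\<^esub>}" unfolding GL_def by auto
      qed
      then show ?thesis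
        using derived_consistent[OF subset_refl L] derived_consistent[OF LS S] unfolding GL_def GS_def by simp
    qed
    have "coprime (card (rcosets\<^bsub>GS\<^esub> L)) (card L)"
      unfolding idx cL using prime_imp_coprime[OF p m(2)] by (simp add: coprime_commute)
    then obtain S1 where S1: "subgroup S1 GS" "S1 \<noteq> S" "\<forall>x\<in>S. \<exists>l\<in>L. l \<otimes> x \<in> S1"
      using GS.coprime_normal_supplement[OF _ LNGS _ der] finS unfolding GS_def by auto
    \<comment> \<open>A supplement of \<open>L\<close> in \<open>S\<close> still supplements
      \<open>N\<close> in \<open>G\<close>, because \<open>L\<close> is contained in
      \<open>N\<close>. This contradicts minimality again.\<close>
    have "S1 \<in> A"
    proof -
      have "\<exists>n\<in>N. n \<otimes> g \<in> S1" if g: "g \<in> carrier G" for g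
      proof -
        obtain n where n: "n \<in> N" "n \<otimes> g \<in> S" using supp[OF g] by blast
        obtain l where l: "l \<in> L" "l \<otimes> (n \<otimes> g) \<in> S1" using S1(3) n(2) by blast
        have "l \<otimes> (n \<otimes> g) = (l \<otimes> n) \<otimes> g" using l n g by (simp add: m_assoc)
        moreover have "l \<otimes> n \<in> N" using l n LN by auto
        ultimately show ?thesis using l(2) by auto
      qed
      then show ?thesis unfolding A_def using incl_subgroup[OF S] S1(1) unfolding GS_def by blast
    qed
    moreover have "S1 \<subseteq> S" using subgroup.subset[OF S1(1)] unfolding GS_def by simp
    ultimately show False using min S1(2) by blast
  qed
  then show ?thesis using S supp by blast
qed

text \<open>The arguments may be replaced by representatives of their cosets in a supplement of
  order prime to \<open>p\<close>. The value is unchanged and now lies in that supplement.\<close>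

lemma word_value_ord_coprime:
  assumes fin: "finite (carrier G)" and N: "N \<lhd> G"
    and p: "Factorial_Ring.prime (p::nat)" and nd: "\<not> p dvd card (rcosets N)"
    and w: "fst ` set w \<subseteq> {..<k}" "g \<in> {..<k} \<rightarrow> carrier G"
    and const: "\<And>g'. g' \<in> {..<k} \<rightarrow> carrier G \<Longrightarrow> (\<forall>i<k. \<exists>n\<in>N. g' i = n \<otimes> g i) \<Longrightarrow>
      word_map G w g' = word_map G w g"
  shows "\<exists>s. \<not> p dvd s \<and> word_map G w g [^] s = \<one>"
proof -
  obtain S where S: "subgroup S G" "\<forall>x\<in>carrier G. \<exists>n\<in>N. n \<otimes> x \<in> S" "\<not> p dvd card S"
    using supplement_of_coprime_order[OF fin N p nd] by blast
  have "\<forall>i\<in>{..<k}. \<exists>n. n \<in> N \<and> n \<otimes> g i \<in> S" using S(2) w(2) by (auto simp: Pi_iff)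
  from bchoice[OF this] obtain n where n: "\<And>i. i < k \<Longrightarrow> n i \<in> N \<and> n i \<otimes> g i \<in> S" by auto
  have gS: "(\<lambda>i. n i \<otimes> g i) \<in> {..<k} \<rightarrow> S" using n by auto
  have "word_map G w (\<lambda>i. n i \<otimes> g i) = word_map G w g"
    using gS n subgroup.subset[OF S(1)] by (intro const) (auto simp: Pi_iff)
  moreover have "word_map G w (\<lambda>i. n i \<otimes> g i) \<in> S" by (rule word_map_in_subgroup[OF S(1) w(1) gS])
  ultimately have "word_map G w g \<in> S" by simp
  then have "word_map G w g [^] card S = \<one>"
    using group.pow_order_eq_1[OF subgroup_imp_group[OF S(1)], of "word_map G w g"]
    by (simp add: Coset.order_def nat_pow_consistent[symmetric])
  then show ?thesis using S(3) by blast
qed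

end

context group begin

text \<open>The index of \<open>N\<close> can only drop in the quotient by \<open>M\<close>, so a
  prime above the index of \<open>N\<close> cannot divide the new index. The bound on
  \<open>p\<close> is therefore the same for every \<open>M\<close>.\<close>

lemma word_value_pow_coprime_mod:
  assumes N: "N \<lhd> G" and finN: "finite (rcosets N)" and M: "M \<lhd> G" and finM: "finite (rcosets M)"
    and p: "Factorial_Ring.prime (p::nat)" and large: "card (rcosets N) < p"
    and w: "fst ` set w \<subseteq> {..<k}" "g \<in> {..<k} \<rightarrow> carrier G"
    and const: "\<And>g'. g' \<in> {..<k} \<rightarrow> carrier G \<Longrightarrow> (\<forall>i<k. \<exists>n\<in>N. g' i = n \<otimes> g i) \<Longrightarrow>
      word_map G w g' = word_map G w g"
  shows "\<exists>s. \<not> p dvd s \<and> word_map G w g [^] s \<in> M"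
proof -
  interpret N: normal N G by (rule N)
  interpret M: normal M G by (rule M)
  define D q where "D = G Mod M" and "q = (\<lambda>x. M #> x)"
  interpret q: group_hom G D q unfolding D_def q_def by (rule M.r_coset_surj_hom)
  have surj: "q ` carrier G = carrier D" unfolding D_def q_def by (rule M.r_coset_surj_hom)
  note im = hom_image_normal[OF group_axioms q.H.group_axioms q.homh surj N]
  have "card (rcosets\<^bsub>D\<^esub> (q ` N)) \<le> card (rcosets N)" unfolding im(2) using finN by (rule card_image_le)
  moreover have "card (rcosets\<^bsub>D\<^esub> (q ` N)) \<noteq> 0"
    unfolding im(2) using finN by (auto simp: RCOSETS_def)
  ultimately have nd: "\<not> p dvd card (rcosets\<^bsub>D\<^esub> (q ` N))" using large by (auto dest: dvd_imp_le)
  have finD: "finite (carrier D)" using finM by (simp add: D_def FactGroup_def)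
  have gD: "(\<lambda>i. q (g i)) \<in> {..<k} \<rightarrow> carrier D" using w(2) q.hom_closed by (auto simp: Pi_iff)
  obtain s where s: "\<not> p dvd s" "word_map D w (\<lambda>i. q (g i)) [^]\<^bsub>D\<^esub> s = \<one>\<^bsub>D\<^esub>"
    using q.H.word_value_ord_coprime[OF finD im(1) p nd w(1) gD]
      word_const_image[OF group_axioms q.H.group_axioms q.homh w N.subset const] by blast
  have z: "word_map G w g \<in> carrier G" by (rule word_map_closed[OF group_axioms w])
  have "q (word_map G w g [^] s) = \<one>\<^bsub>D\<^esub>"
    using s(2) q.hom_nat_pow[OF z] word_map_hom[OF group_axioms q.H.group_axioms q.homh w] by simp
  then have "M #> (word_map G w g [^] s) = M" by (simp add: q_def D_def FactGroup_def)
  then have "word_map G w g [^] s \<in> M" using rcos_self[OF _ M.subgroup_axioms] z by (metis nat_pow_closed)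
  then show ?thesis using s(1) by blast
qed

section \<open>Dietzmann's lemma\<close>

lemma foldr_mult_closed: "set xs \<subseteq> carrier G \<Longrightarrow> foldr (\<otimes>) xs \<one> \<in> carrier G"
  by (induction xs) auto

lemma foldr_mult_append:
  "set xs \<subseteq> carrier G \<Longrightarrow> set ys \<subseteq> carrier G \<Longrightarrow>
    foldr (\<otimes>) (xs @ ys) \<one> = foldr (\<otimes>) xs \<one> \<otimes> foldr (\<otimes>) ys \<one>"
  using foldr_mult_closed[of ys] by (induction xs) (auto simp: m_assoc foldr_mult_closed)

text \<open>All copies of \<open>x\<close> are moved to the front. A letter that they pass is
  replaced by a conjugate, which stays in \<open>A\<close>, and the total length is
  preserved.\<close>

lemma collect_letter:
  assumes A: "A \<subseteq> carrier G" and conj: "\<And>x y. x \<in> A \<Longrightarrow> y \<in> A \<Longrightarrow> inv x \<otimes> y \<otimes> x \<in> A"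
    and x: "x \<in> A" and xs: "set xs \<subseteq> A"
  shows "\<exists>ys. set ys \<subseteq> A \<and> length ys + count_list xs x = length xs \<and>
    foldr (\<otimes>) xs \<one> = x [^] count_list xs x \<otimes> foldr (\<otimes>) ys \<one>"
  using xs
proof (induction xs)
  case (Cons a xs)
  then obtain ys where ys: "set ys \<subseteq> A" "length ys + count_list xs x = length xs"
    "foldr (\<otimes>) xs \<one> = x [^] count_list xs x \<otimes> foldr (\<otimes>) ys \<one>" by auto
  have xc: "x \<in> carrier G" and a: "a \<in> A" "a \<in> carrier G" using x Cons.prems A by auto
  have fc: "foldr (\<otimes>) ys \<one> \<in> carrier G" using ys(1) A by (intro foldr_mult_closed) auto
  show ?case
  proof (cases "a = x")
    case True
    have "foldr (\<otimes>) (a # xs) \<one> = x [^] Suc (count_list xs x) \<otimes> foldr (\<otimes>) ys \<one>"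
      using ys(3) True xc fc by (simp add: m_assoc[symmetric] nat_pow_comm[of x 1, simplified])
    then show ?thesis using ys True by (intro exI[of _ ys]) auto
  next
    case False
    define c where "c = count_list xs x"
    have conjn: "inv (x [^] n) \<otimes> a \<otimes> x [^] n \<in> A" for n :: nat
    proof (induction n)
      case (Suc n)
      have "inv x \<otimes> (inv (x [^] n) \<otimes> a \<otimes> x [^] n) \<otimes> x \<in> A" by (rule conj[OF x Suc])
      then show ?case using xc a by (simp add: m_assoc inv_mult_group)
    qed (use a in simp)
    define b where "b = inv (x [^] c) \<otimes> a \<otimes> x [^] c"
    have "a \<otimes> (x [^] c \<otimes> foldr (\<otimes>) ys \<one>) = x [^] c \<otimes> foldr (\<otimes>) (b # ys) \<one>"
      using xc a fc by (simp add: b_def m_assoc)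
    then show ?thesis using ys False conjn[of c] by (intro exI[of _ "b # ys"]) (auto simp: c_def b_def)
  qed
qed simp

text \<open>Dietzmann's lemma. In a product longer than the sum of the exponents some letter
  \<open>x\<close> occurs at least \<open>e x\<close> times. Collected in front, \<open>e x\<close>
  of these copies cancel. So products of bounded length already give all products.\<close>

lemma finite_generate_normal_torsion:
  assumes fin: "finite A" and A: "A \<subseteq> carrier G"
    and conj: "\<And>x y. x \<in> carrier G \<Longrightarrow> y \<in> A \<Longrightarrow> x \<otimes> y \<otimes> inv x \<in> A"
    and tors: "\<And>x. x \<in> A \<Longrightarrow> \<exists>n>0. x [^] (n::nat) = \<one>"
  shows "finite (generate G A)"
proof -
  obtain e where e: "\<And>x. x \<in> A \<Longrightarrow> e x > 0 \<and> x [^] (e x :: nat) = \<one>" using tors by metis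
  have conj': "inv x \<otimes> y \<otimes> x \<in> A" if "x \<in> A" "y \<in> A" for x y
    using conj[of "inv x" y] that A by (auto simp: subset_iff)
  let ?P = "\<lambda>xs. foldr (\<otimes>) xs \<one>"
  define b where "b = (\<Sum>x\<in>A. e x)"
  have short: "\<exists>ys. set ys \<subseteq> A \<and> length ys \<le> b \<and> ?P ys = ?P xs" if "set xs \<subseteq> A" for xs
    using that
  proof (induction "length xs" arbitrary: xs rule: less_induct)
    case less
    show ?case
    proof (cases "length xs \<le> b")
      case False
      have "\<exists>x\<in>A. e x \<le> count_list xs x"
      proof (rule ccontr)
        assume "\<not> ?thesis"
        then have "(\<Sum>x\<in>A. count_list xs x) \<le> b" unfolding b_def by (intro sum_mono) auto
        moreover have "(\<Sum>x\<in>A. count_list xs x) = (\<Sum>x\<in>set xs. count_list xs x)"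
          using less.prems fin by (intro sum.mono_neutral_right) (auto simp: count_notin)
        ultimately show False using False sum_count_set[OF subset_refl, of xs] by simp
      qed
      then obtain x where x: "x \<in> A" "e x \<le> count_list xs x" by blast
      obtain ys where ys: "set ys \<subseteq> A" "length ys + count_list xs x = length xs"
        "?P xs = x [^] count_list xs x \<otimes> ?P ys"
        using collect_letter[OF A conj' x(1) less.prems] by blast
      define zs where "zs = replicate (count_list xs x - e x) x @ ys"
      have rep: "?P (replicate n x) = x [^] n" for n
        using x(1) A by (induction n) (auto simp: nat_pow_comm[of x 1, simplified] subset_iff)
      have xc: "x \<in> carrier G" using x A by auto
      have "x [^] count_list xs x = x [^] (count_list xs x - e x) \<otimes> x [^] e x"
        by (subst nat_pow_mult[OF xc]) (use x(2) in simp)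
      also have "\<dots> = x [^] (count_list xs x - e x)" using e[OF x(1)] xc by simp
      finally have pw: "x [^] (count_list xs x - e x) = x [^] count_list xs x" ..
      have "?P zs = ?P (replicate (count_list xs x - e x) x) \<otimes> ?P ys"
        unfolding zs_def using ys(1) A x(1) by (intro foldr_mult_append) auto
      then have "?P zs = ?P xs" unfolding rep pw ys(3) .
      moreover have "length zs < length xs" "set zs \<subseteq> A"
        unfolding zs_def using ys x e[OF x(1)] by auto
      ultimately show ?thesis using less.hyps[of zs] by auto
    qed (use less.prems in blast)
  qed
  define F where "F = ?P ` {xs. set xs \<subseteq> A \<and> length xs \<le> b}"
  have finF: "finite F" unfolding F_def using finite_lists_length_le[OF fin] by simp
  have F: "?P xs \<in> F" if xs: "set xs \<subseteq> A" for xs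
  proof -
    obtain ys where ys: "set ys \<subseteq> A" "length ys \<le> b" "?P ys = ?P xs" using short[OF xs] by blast
    have "?P ys \<in> F" unfolding F_def using ys(1,2) by (intro imageI) simp
    then show ?thesis unfolding ys(3) .
  qed
  have "generate G A \<subseteq> F"
  proof
    fix y assume "y \<in> generate G A"
    then have "\<exists>xs. set xs \<subseteq> A \<and> ?P xs = y"
    proof induction
      case one
      then show ?case by (intro exI[of _ "[]"]) simp
    next
      case (incl y)
      then show ?case using A by (intro exI[of _ "[y]"]) auto
    next
      case (inv y)
      have yc: "y \<in> carrier G" using inv A by auto
      \<comment> \<open>Torsion turns an inverse into a positive power, so products without inverses
        suffice.\<close>
      have "y [^] Suc (e y - 1) = \<one>" using e[OF inv] by simp
      then have "y [^] (e y - 1) \<otimes> y = \<one>" unfolding nat_pow_Suc .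
      then have "inv y = y [^] (e y - 1)" using yc by (simp add: inv_equality)
      moreover have "?P (replicate n y) = y [^] n" for n
        using yc by (induction n) (auto simp: nat_pow_comm[of y 1, simplified])
      ultimately show ?case using inv by (intro exI[of _ "replicate (e y - 1) y"]) auto
    next
      case (eng u v)
      obtain xs where xs: "set xs \<subseteq> A" "?P xs = u" using eng.IH(1) by blast
      obtain ys where ys: "set ys \<subseteq> A" "?P ys = v" using eng.IH(2) by blast
      have "?P (xs @ ys) = u \<otimes> v" unfolding xs(2)[symmetric] ys(2)[symmetric]
        using xs(1) ys(1) A by (intro foldr_mult_append) auto
      then show ?case using xs(1) ys(1) by (intro exI[of _ "xs @ ys"]) simp
    qed
    then show "y \<in> F" using F by blast
  qed
  then show ?thesis using finF finite_subset by blast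
qed

end

section \<open>Eigenspaces and unipotent matrices\<close>

text \<open>The columns of \<open>B\<close> are independent eigenvectors, and \<open>L\<close> reads off coordinates in their span.\<close>

definition eigen_frame :: "'k::field mat \<Rightarrow> 'k \<Rightarrow> nat \<Rightarrow> nat \<Rightarrow> 'k mat \<Rightarrow> 'k mat \<Rightarrow> bool" where
  "eigen_frame A e n d B L \<longleftrightarrow>
     B \<in> carrier_mat n d \<and> L \<in> carrier_mat d n \<and> L * B = 1\<^sub>m d \<and> A * B = e \<cdot>\<^sub>m B"

text \<open>If \<open>n < d\<close>, padding with zeros gives square matrices with the same product.
  Then the left inverse is two-sided, although row \<open>n\<close> of the padded \<open>B\<close>
  is zero.\<close>

lemma left_inverse_dim_le:
  assumes "(B :: 'k::field mat) \<in> carrier_mat n d" "L \<in> carrier_mat d n" "L * B = 1\<^sub>m d"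
  shows "d \<le> n"
proof (rule ccontr)
  assume "\<not> d \<le> n"
  then have dn: "n < d" by simp
  define L' where "L' = mat d d (\<lambda>(i, j). if j < n then L $$ (i, j) else 0)"
  define B' where "B' = mat d d (\<lambda>(i, j). if i < n then B $$ (i, j) else 0)"
  have c: "L' \<in> carrier_mat d d" "B' \<in> carrier_mat d d" unfolding L'_def B'_def by auto
  have "L' * B' = 1\<^sub>m d"
  proof (rule eq_matI)
    fix i j assume ij: "i < dim_row (1\<^sub>m d :: 'k mat)" "j < dim_col (1\<^sub>m d :: 'k mat)"
    have "(L' * B') $$ (i, j) = (\<Sum>l<d. L' $$ (i, l) * B' $$ (l, j))"
      using ij c by (simp add: scalar_prod_def atLeast0LessThan)
    also have "\<dots> = (\<Sum>l<n. L' $$ (i, l) * B' $$ (l, j))"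
      using dn ij by (intro sum.mono_neutral_right) (auto simp: L'_def B'_def)
    also have "\<dots> = (\<Sum>l<n. L $$ (i, l) * B $$ (l, j))"
      using dn ij by (intro sum.cong) (auto simp: L'_def B'_def)
    also have "\<dots> = (L * B) $$ (i, j)"
      using ij assms(1,2) by (simp add: scalar_prod_def atLeast0LessThan)
    finally show "(L' * B') $$ (i, j) = 1\<^sub>m d $$ (i, j)" using assms(3) by simp
  qed (use c in auto)
  then have BL: "B' * L' = 1\<^sub>m d" using mat_mult_left_right_inverse[OF c] by simp
  have "(B' * L') $$ (n, n) = (\<Sum>l<d. B' $$ (n, l) * L' $$ (l, n))"
    using dn c by (simp add: scalar_prod_def atLeast0LessThan)
  also have "\<dots> = 0" using dn by (simp add: B'_def)
  finally show False using BL dn by simp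
qed

text \<open>The part of \<open>v\<close> inside the span is subtracted. What remains is an
  eigenvector \<open>u\<close> that \<open>L\<close> kills and that has a nonzero entry at some
  \<open>i\<close>.\<close>

lemma eigen_frame_extend:
  fixes A :: "'k::field mat"
  assumes A: "A \<in> carrier_mat n n" and fr: "eigen_frame A e n d B L"
    and v: "v \<in> carrier_vec n" "A *\<^sub>v v = e \<cdot>\<^sub>v v" and ne: "B *\<^sub>v (L *\<^sub>v v) \<noteq> v"
  shows "\<exists>B' L'. eigen_frame A e n (Suc d) B' L'"
proof -
  have B: "B \<in> carrier_mat n d" and L: "L \<in> carrier_mat d n" and LB: "L * B = 1\<^sub>m d"
    and AB: "A * B = e \<cdot>\<^sub>m B" using fr unfolding eigen_frame_def by auto
  define y where "y = B *\<^sub>v (L *\<^sub>v v)"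
  have Lv: "L *\<^sub>v v \<in> carrier_vec d" by (rule mult_mat_vec_carrier[OF L v(1)])
  have y: "y \<in> carrier_vec n" unfolding y_def by (rule mult_mat_vec_carrier[OF B Lv])
  define u where "u = v - y"
  have u: "u \<in> carrier_vec n" unfolding u_def using v y by simp
  have "\<exists>i<n. u $ i \<noteq> 0"
  proof (rule ccontr)
    assume "\<not> ?thesis"
    then have "v $ i = y $ i" if "i < n" for i using that v y unfolding u_def by auto
    then have "v = y" using v y by (intro eq_vecI) auto
    then show False using ne unfolding y_def by simp
  qed
  then obtain i where i: "i < n" "u $ i \<noteq> 0" by blast
  have "L *\<^sub>v y = L *\<^sub>v v"
    unfolding y_def using assoc_mult_mat_vec[OF L B Lv, symmetric] LB Lv by simp
  then have Lu: "L *\<^sub>v u = 0\<^sub>v d"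
    unfolding u_def using mult_minus_distrib_mat_vec[OF L v(1) y] Lv by simp
  have sm: "(e \<cdot>\<^sub>m B) *\<^sub>v (L *\<^sub>v v) = e \<cdot>\<^sub>v y"
    unfolding y_def using B Lv by (intro eq_vecI) (auto intro!: smult_scalar_prod_distrib[of _ d])
  have "A *\<^sub>v y = e \<cdot>\<^sub>v y"
    unfolding sm[symmetric] AB[symmetric] unfolding y_def by (rule assoc_mult_mat_vec[OF A B Lv, symmetric])
  then have Au: "A *\<^sub>v u = e \<cdot>\<^sub>v u"
    unfolding u_def using mult_minus_distrib_mat_vec[OF A v(1) y] v y
    by (intro eq_vecI) (auto simp: algebra_simps)
  \<comment> \<open>The new coordinate is the entry at \<open>i\<close> of \<open>x - B L x\<close>,
    scaled to be \<open>1\<close> at \<open>u\<close>. It vanishes on the old columns because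
    \<open>B L\<close> fixes them.\<close>
  define r where "r = (1 / u $ i) \<cdot>\<^sub>v (unit_vec n i - row (B * L) i)"
  have r: "r \<in> carrier_vec n" unfolding r_def using B L i by simp
  have rx: "r \<bullet> x = (x $ i - (B *\<^sub>v (L *\<^sub>v x)) $ i) / u $ i" if x: "x \<in> carrier_vec n" for x
  proof -
    have w: "row (B * L) i \<in> carrier_vec n" using B L i by auto
    have "r \<bullet> x = (1 / u $ i) * ((unit_vec n i - row (B * L) i) \<bullet> x)"
      unfolding r_def using w x by (intro smult_scalar_prod_distrib[of _ n]) auto
    also have "(unit_vec n i - row (B * L) i) \<bullet> x = unit_vec n i \<bullet> x - row (B * L) i \<bullet> x"
      using w x by (intro minus_scalar_prod_distrib[of _ n]) auto
    also have "unit_vec n i \<bullet> x = x $ i" using x i by simp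
    also have "row (B * L) i \<bullet> x = ((B * L) *\<^sub>v x) $ i"
      using B i by (intro index_mult_mat_vec[symmetric]) simp
    also have "(B * L) *\<^sub>v x = B *\<^sub>v (L *\<^sub>v x)" using B L x by simp
    finally show ?thesis by simp
  qed
  define B' where "B' = mat n (Suc d) (\<lambda>(a, b). if b < d then B $$ (a, b) else u $ a)"
  define L' where "L' = mat (Suc d) n (\<lambda>(a, b). if a < d then L $$ (a, b) else r $ b)"
  have B': "B' \<in> carrier_mat n (Suc d)" and L': "L' \<in> carrier_mat (Suc d) n"
    unfolding B'_def L'_def by auto
  have colB: "col B' b = (if b < d then col B b else u)" if "b < Suc d" for b
    using that B u unfolding B'_def by (intro eq_vecI) auto
  have rowL: "row L' a = (if a < d then row L a else r)" if "a < Suc d" for a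
    using that L r unfolding L'_def by (intro eq_vecI) auto
  have "L' * B' = 1\<^sub>m (Suc d)"
  proof (rule eq_matI)
    fix a b assume "a < dim_row (1\<^sub>m (Suc d) :: 'k mat)" "b < dim_col (1\<^sub>m (Suc d) :: 'k mat)"
    then have ab: "a < Suc d" "b < Suc d" by auto
    have e: "(L' * B') $$ (a, b) = row L' a \<bullet> col B' b" using ab B' L' by simp
    consider "a < d" "b < d" | "a < d" "b = d" | "a = d" "b < d" | "a = d" "b = d"
      using ab by linarith
    then show "(L' * B') $$ (a, b) = 1\<^sub>m (Suc d) $$ (a, b)"
    proof cases
      case 1
      have "row L a \<bullet> col B b = (L * B) $$ (a, b)" using 1 L B by simp
      then show ?thesis using 1 e colB rowL ab LB by simp
    next
      case 2
      have "row L a \<bullet> u = (L *\<^sub>v u) $ a" using 2 L by simp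
      then show ?thesis using 2 e colB rowL ab Lu by simp
    next
      case 3
      have cb: "col B b \<in> carrier_vec n" using B by auto
      have LBc: "L * B \<in> carrier_mat d d" using LB by simp
      have "B *\<^sub>v (L *\<^sub>v col B b) = col (B * (L * B)) b"
        unfolding col_mult2[OF B LBc 3(2)] col_mult2[OF L B 3(2)] ..
      also have "B * (L * B) = B" unfolding LB by (rule right_mult_one_mat[OF B])
      finally have "B *\<^sub>v (L *\<^sub>v col B b) = col B b" .
      then have "r \<bullet> col B b = 0" using rx[OF cb] by simp
      then show ?thesis using 3 e colB rowL ab by simp
    next
      case 4
      have "(B *\<^sub>v (L *\<^sub>v u)) $ i = 0" unfolding Lu using B i by simp
      then have "r \<bullet> u = 1" using rx[OF u] i by simp
      then show ?thesis using 4 e colB rowL ab by simp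
    qed
  qed (use B' L' in auto)
  moreover have "A * B' = e \<cdot>\<^sub>m B'"
  proof (rule mat_col_eqI)
    fix b assume "b < dim_col (e \<cdot>\<^sub>m B')"
    then have b: "b < Suc d" using B' by simp
    have "col (A * B') b = A *\<^sub>v col B' b" using A B' b by simp
    also have "\<dots> = e \<cdot>\<^sub>v col B' b"
    proof (cases "b < d")
      case True
      have "A *\<^sub>v col B b = col (A * B) b" using A B True by simp
      also have "\<dots> = e \<cdot>\<^sub>v col B b" unfolding AB using B True by (intro eq_vecI) auto
      finally show ?thesis using colB[OF b] True by simp
    qed (use colB[OF b] Au in simp)
    also have "\<dots> = col (e \<cdot>\<^sub>m B') b" using B' b by (intro eq_vecI) auto
    finally show "col (A * B') b = col (e \<cdot>\<^sub>m B') b" .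
  qed (use A B' in auto)
  ultimately show ?thesis
    unfolding eigen_frame_def using B' L' by (intro exI[of _ B'] exI[of _ L']) simp
qed

text \<open>A frame with the largest number of columns, which is at most \<open>n\<close>, spans the
  eigenspace: an eigenvector outside the span would allow an extension.\<close>

lemma eigenspace_frame:
  fixes A :: "'k::field mat"
  assumes A: "A \<in> carrier_mat n n" and e: "eigenvalue A e"
  shows "\<exists>d B L. 0 < d \<and> d \<le> n \<and> eigen_frame A e n d B L \<and>
    (\<forall>v\<in>carrier_vec n. A *\<^sub>v v = e \<cdot>\<^sub>v v \<longrightarrow> B *\<^sub>v (L *\<^sub>v v) = v)"
proof -
  define P where "P d \<longleftrightarrow> (\<exists>B L. eigen_frame A e n d B L)" for d
  have "eigen_frame A e n 0 (0\<^sub>m n 0) (0\<^sub>m 0 n)"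
    unfolding eigen_frame_def by (intro conjI eq_matI) (use A in auto)
  then have P0: "P 0" unfolding P_def by blast
  have bound: "d \<le> n" if P: "P d" for d
  proof -
    obtain B L where "eigen_frame A e n d B L" using P unfolding P_def by (elim exE)
    then show ?thesis unfolding eigen_frame_def by (elim conjE) (rule left_inverse_dim_le)
  qed
  then have "\<forall>d. P d \<longrightarrow> d < Suc n" by (simp add: less_Suc_eq_le)
  from ex_has_greatest_nat[where f = "\<lambda>d. d", OF P0 this]
  obtain d where d: "P d" "\<And>d'. P d' \<Longrightarrow> d' \<le> d" by blast
  obtain B L where fr: "eigen_frame A e n d B L" using d(1) unfolding P_def by blast
  have all: "B *\<^sub>v (L *\<^sub>v v) = v" if "v \<in> carrier_vec n" "A *\<^sub>v v = e \<cdot>\<^sub>v v" for v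
  proof (rule ccontr)
    assume "B *\<^sub>v (L *\<^sub>v v) \<noteq> v"
    from eigen_frame_extend[OF A fr that this] have "P (Suc d)" unfolding P_def .
    then show False using d(2) by fastforce
  qed
  obtain v where v: "v \<in> carrier_vec n" "v \<noteq> 0\<^sub>v n" "A *\<^sub>v v = e \<cdot>\<^sub>v v"
    using e A unfolding eigenvalue_def eigenvector_def by auto
  have "d \<noteq> 0"
  proof
    assume "d = 0"
    then have "B \<in> carrier_mat n 0" "L \<in> carrier_mat 0 n" using fr unfolding eigen_frame_def by auto
    then have "B *\<^sub>v (L *\<^sub>v v) = 0\<^sub>v n" by (intro eq_vecI) (auto simp: scalar_prod_def)
    then show False using all[OF v(1,3)] v(2) by simp
  qed
  then show ?thesis
    using fr all bound[OF d(1)] by (intro exI[of _ d] exI[of _ B] exI[of _ L]) simp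
qed

text \<open>\<open>C'\<close> commutes with \<open>A\<close>, so it maps the eigenspace into itself,
  and there \<open>B * L\<close> acts as the identity. Inserting \<open>B * L\<close> between
  \<open>C\<close> and \<open>C'\<close> splits the compressed product into two square
  factors.\<close>

lemma eigenspace_det_hom:
  fixes A :: "'k::field mat"
  assumes A: "A \<in> carrier_mat n n" and fr: "eigen_frame A e n d B L"
    and all: "\<And>v. v \<in> carrier_vec n \<Longrightarrow> A *\<^sub>v v = e \<cdot>\<^sub>v v \<Longrightarrow> B *\<^sub>v (L *\<^sub>v v) = v"
    and C: "C \<in> carrier_mat n n" and C': "C' \<in> carrier_mat n n" and comm: "A * C' = C' * A"
  shows "det (L * (C * C' * B)) = det (L * (C * B)) * det (L * (C' * B))"
proof -
  have B: "B \<in> carrier_mat n d" and L: "L \<in> carrier_mat d n" and AB: "A * B = e \<cdot>\<^sub>m B"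
    using fr unfolding eigen_frame_def by auto
  have C'B: "C' * B \<in> carrier_mat n d" using C' B by simp
  have "A * (C' * B) = C' * (A * B)"
    using assoc_mult_mat[OF A C' B] assoc_mult_mat[OF C' A B] comm by simp
  also have "\<dots> = e \<cdot>\<^sub>m (C' * B)" unfolding AB using mult_smult_distrib[OF C' B] .
  finally have AC: "A * (C' * B) = e \<cdot>\<^sub>m (C' * B)" .
  have BL: "B * (L * (C' * B)) = C' * B"
  proof (rule mat_col_eqI)
    fix b assume "b < dim_col (C' * B)"
    then have b: "b < d" using B by simp
    have v: "col (C' * B) b \<in> carrier_vec n" using C'B b by auto
    have "A *\<^sub>v col (C' * B) b = col (A * (C' * B)) b" using A C'B b by (metis carrier_matD(2) col_mult2)
    also have "\<dots> = e \<cdot>\<^sub>v col (C' * B) b" unfolding AC using C'B b by (intro eq_vecI) auto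
    finally have "B *\<^sub>v (L *\<^sub>v col (C' * B) b) = col (C' * B) b" using all[OF v] by simp
    moreover have "col (L * (C' * B)) b = L *\<^sub>v col (C' * B) b" by (rule col_mult2[OF L C'B b])
    moreover have "col (B * (L * (C' * B))) b = B *\<^sub>v col (L * (C' * B)) b"
      by (rule col_mult2[OF B _ b]) (use L C'B in simp)
    ultimately show "col (B * (L * (C' * B))) b = col (C' * B) b" by simp
  qed (use B C' L in auto)
  have "L * (C * C' * B) = L * (C * (B * (L * (C' * B))))"
    unfolding BL assoc_mult_mat[OF C C' B] ..
  also have "\<dots> = (L * (C * B)) * (L * (C' * B))"
    using L C B C'B by (simp add: assoc_mult_mat[OF C B, of "L * (C' * B)" d, symmetric]
        assoc_mult_mat[of L d n "C * B" d "L * (C' * B)" d, symmetric])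
  finally show ?thesis using L C B C' by (simp add: det_mult[of _ d])
qed

text \<open>On the eigenspace, which has dimension \<open>d\<close>, the power acts as the scalar
  \<open>e ^ q\<close>.\<close>

lemma eigen_frame_pow:
  fixes A :: "'k::field mat"
  assumes A: "A \<in> carrier_mat n n" and fr: "eigen_frame A e n d B L"
  shows "det (L * (A ^\<^sub>m q * B)) = e ^ (q * d)"
proof -
  have B: "B \<in> carrier_mat n d" and L: "L \<in> carrier_mat d n" and AB: "A * B = e \<cdot>\<^sub>m B"
    and LB: "L * B = 1\<^sub>m d" using fr unfolding eigen_frame_def by auto
  have "A ^\<^sub>m q * B = e ^ q \<cdot>\<^sub>m B"
  proof (induction q)
    case (Suc q)
    have Aq: "A ^\<^sub>m q \<in> carrier_mat n n" using A by (rule pow_carrier_mat)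
    have "A ^\<^sub>m Suc q * B = A ^\<^sub>m q * (A * B)" using assoc_mult_mat[OF Aq A B] by simp
    also have "\<dots> = e \<cdot>\<^sub>m (A ^\<^sub>m q * B)" unfolding AB by (rule mult_smult_distrib[OF Aq B])
    also have "\<dots> = e ^ Suc q \<cdot>\<^sub>m B" unfolding Suc by (rule eq_matI) auto
    finally show ?case .
  qed (use A B in \<open>auto intro!: eq_matI\<close>)
  then have "L * (A ^\<^sub>m q * B) = e ^ q \<cdot>\<^sub>m 1\<^sub>m d"
    using mult_smult_distrib[OF L B] LB by simp
  then show ?thesis by (simp add: power_mult)
qed

section \<open>Polynomials in a matrix, Cayley-Hamilton and unipotency\<close>

lemma index_mult_mat_sum:
  assumes "P \<in> carrier_mat m n" "Q \<in> carrier_mat n l" "i < m" "j < l"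
  shows "(P * Q) $$ (i, j) = (\<Sum>r<n. P $$ (i, r) * Q $$ (r, j))"
  using assms by (simp add: scalar_prod_def atLeast0LessThan)

definition poly_mat :: "'k::comm_ring_1 mat \<Rightarrow> 'k poly \<Rightarrow> 'k mat" where
  "poly_mat A p = fold_coeffs (\<lambda>c M. c \<cdot>\<^sub>m 1\<^sub>m (dim_row A) + A * M) p (0\<^sub>m (dim_row A) (dim_row A))"

context
  fixes A :: "'k::comm_ring_1 mat" and n :: nat
  assumes A: "A \<in> carrier_mat n n"
begin

lemma poly_mat_0 [simp]: "poly_mat A 0 = 0\<^sub>m n n"
  using A by (simp add: poly_mat_def)

lemma poly_mat_pCons [simp]: "poly_mat A (pCons c p) = c \<cdot>\<^sub>m 1\<^sub>m n + A * poly_mat A p"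
proof (cases "p = 0 \<and> c = 0")
  \<comment> \<open>The zero polynomial has no coefficients to fold over, so
    \<open>pCons 0 0\<close> is treated apart.\<close>
  case True
  then show ?thesis using A by (auto intro!: eq_matI)
next
  case False
  then show ?thesis using A by (cases "c = 0") (auto simp: poly_mat_def)
qed

lemma poly_mat_carrier [simp]: "poly_mat A p \<in> carrier_mat n n"
  using A by (induction p) auto

lemma poly_mat_add: "poly_mat A (p + q) = poly_mat A p + poly_mat A q"
proof (induction p q rule: poly_induct2)
  case (pCons a p b q)
  define U V where "U = A * poly_mat A p" and "V = A * poly_mat A q"
  have c: "U \<in> carrier_mat n n" "V \<in> carrier_mat n n" unfolding U_def V_def using A by auto
  have "A * poly_mat A (p + q) = U + V"
    unfolding pCons U_def V_def by (rule mult_add_distrib_mat[OF A poly_mat_carrier poly_mat_carrier])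
  then have "poly_mat A (pCons a p + pCons b q) = (a + b) \<cdot>\<^sub>m 1\<^sub>m n + (U + V)" by simp
  also have "\<dots> = (a \<cdot>\<^sub>m 1\<^sub>m n + U) + (b \<cdot>\<^sub>m 1\<^sub>m n + V)"
    using c by (intro eq_matI) (auto simp: algebra_simps)
  finally show ?case by (simp add: U_def V_def)
qed simp

lemma poly_mat_smult: "poly_mat A (smult c p) = c \<cdot>\<^sub>m poly_mat A p"
proof (induction p)
  case (pCons a p)
  define U where "U = A * poly_mat A p"
  have c: "U \<in> carrier_mat n n" unfolding U_def using A by auto
  have "A * poly_mat A (smult c p) = c \<cdot>\<^sub>m U"
    unfolding pCons U_def by (rule mult_smult_distrib[OF A poly_mat_carrier])
  then have "poly_mat A (smult c (pCons a p)) = (c * a) \<cdot>\<^sub>m 1\<^sub>m n + c \<cdot>\<^sub>m U" by simp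
  also have "\<dots> = c \<cdot>\<^sub>m (a \<cdot>\<^sub>m 1\<^sub>m n + U)"
    using c by (intro eq_matI) (auto simp: algebra_simps)
  finally show ?case by (simp add: U_def)
qed (auto intro!: eq_matI)

lemma poly_mat_mult: "poly_mat A (p * q) = poly_mat A p * poly_mat A q"
proof (induction p)
  case 0
  show ?case by (simp add: left_mult_zero_mat[OF poly_mat_carrier])
next
  case (pCons a p)
  have AP: "A * poly_mat A p \<in> carrier_mat n n" using A by auto
  have a1: "a \<cdot>\<^sub>m 1\<^sub>m n \<in> carrier_mat n n" by simp
  have "(a \<cdot>\<^sub>m 1\<^sub>m n + A * poly_mat A p) * poly_mat A q =
      a \<cdot>\<^sub>m 1\<^sub>m n * poly_mat A q + A * poly_mat A p * poly_mat A q"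
    by (rule add_mult_distrib_mat[OF a1 AP poly_mat_carrier])
  also have "a \<cdot>\<^sub>m 1\<^sub>m n * poly_mat A q = a \<cdot>\<^sub>m poly_mat A q"
    by (simp only: mult_smult_assoc_mat[OF one_carrier_mat poly_mat_carrier] left_mult_one_mat[OF poly_mat_carrier])
  also have "A * poly_mat A p * poly_mat A q = A * poly_mat A (p * q)"
    unfolding pCons by (rule assoc_mult_mat[OF A poly_mat_carrier poly_mat_carrier])
  also have "\<dots> = poly_mat A (pCons 0 (p * q))"
  proof -
    define U where "U = A * poly_mat A (p * q)"
    have "U \<in> carrier_mat n n" unfolding U_def using A by auto
    then have "U = 0 \<cdot>\<^sub>m 1\<^sub>m n + U" by (intro eq_matI) auto
    then show ?thesis unfolding U_def by simp
  qed
  finally show ?case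
    unfolding poly_mat_pCons[of a p] mult_pCons_left poly_mat_add poly_mat_smult by simp
qed

lemma poly_mat_1 [simp]: "poly_mat A 1 = 1\<^sub>m n"
  using A by (auto simp: one_pCons intro!: eq_matI)

lemma poly_mat_power: "poly_mat A (p ^ m) = poly_mat A p ^\<^sub>m m"
proof (induction m)
  case (Suc m)
  have "poly_mat A (p ^ Suc m) = poly_mat A (p ^ m) * poly_mat A p"
    by (simp only: power_Suc2 poly_mat_mult)
  then show ?case by (simp add: Suc)
qed (simp add: carrier_matD[OF poly_mat_carrier])

lemma poly_mat_X: "poly_mat A [:0, 1:] = A"
  using A by (auto intro!: eq_matI simp: right_mult_one_mat[of _ n n])

lemma poly_mat_index:
  assumes "i < n" "j < n" "degree p \<le> m"
  shows "poly_mat A p $$ (i, j) = (\<Sum>e\<le>m. coeff p e * (A ^\<^sub>m e) $$ (i, j))"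
  using assms
proof (induction p arbitrary: m i)
  case (pCons a p)
  show ?case
  proof (cases m)
    case 0
    then have "p = 0" using pCons.prems(3) pCons.hyps by (auto split: if_splits)
    then show ?thesis using 0 pCons.prems A by simp
  next
    case (Suc m')
    have d: "degree p \<le> m'" using pCons.prems(3) Suc by (cases "p = 0") auto
    have pw: "(A ^\<^sub>m Suc e) $$ (i, j) = (\<Sum>l<n. A $$ (i, l) * (A ^\<^sub>m e) $$ (l, j))" for e
    proof -
      have "A ^\<^sub>m Suc e = A * A ^\<^sub>m e"
        using A by (induction e) (simp_all add: assoc_mult_mat[of _ n n _ n _ n] left_mult_one_mat[of _ n n] right_mult_one_mat[of _ n n])
      then show ?thesis using pCons.prems A
        by (simp add: scalar_prod_def atLeast0LessThan carrier_matD[OF pow_carrier_mat] del: pow_mat.simps)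
    qed
    have "poly_mat A (pCons a p) $$ (i, j) = a * 1\<^sub>m n $$ (i, j) + (\<Sum>l<n. A $$ (i, l) * poly_mat A p $$ (l, j))"
      using pCons.prems A by (simp add: scalar_prod_def atLeast0LessThan carrier_matD[OF poly_mat_carrier])
    also have "(\<Sum>l<n. A $$ (i, l) * poly_mat A p $$ (l, j)) =
        (\<Sum>l<n. \<Sum>e\<le>m'. coeff p e * (A $$ (i, l) * (A ^\<^sub>m e) $$ (l, j)))"
      using pCons.IH[OF _ pCons.prems(2) d] by (simp add: sum_distrib_left mult_ac)
    also have "\<dots> = (\<Sum>e\<le>m'. coeff p e * (A ^\<^sub>m Suc e) $$ (i, j))"
      by (subst sum.swap) (simp add: pw sum_distrib_left del: pow_mat.simps(2))
    finally show ?thesis unfolding Suc using A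
      by (subst sum.atMost_Suc_shift) (simp del: pow_mat.simps(2) add: coeff_pCons)
  qed
qed (use A in simp)

text \<open>With \<open>X - A\<close> written as \<open>C\<close>, the identity
  \<open>C * N = char_poly A \<cdot>\<^sub>m 1\<^sub>m n\<close> for the adjugate \<open>N\<close>
  is compared coefficient by coefficient. Multiplying the equation for the coefficient of
  \<open>X^e\<close> by \<open>A ^\<^sub>m e\<close> and adding up gives a telescoping sum.\<close>

lemma cayley_hamilton: "poly_mat A (char_poly A) = 0\<^sub>m n n"
proof -
  define C N where "C = char_poly_matrix A" and "N = adj_mat (char_poly_matrix A)"
  have C: "C \<in> carrier_mat n n" unfolding C_def using A by simp
  have N: "N \<in> carrier_mat n n" and CN: "C * N = char_poly A \<cdot>\<^sub>m 1\<^sub>m n"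
    using adj_mat(1,2)[OF C] unfolding C_def N_def char_poly_def by auto
  define B where "B e = map_mat (\<lambda>p. coeff p e) N" for e
  have B: "B e \<in> carrier_mat n n" for e unfolding B_def using N by simp
  have CN_index: "(\<Sum>l<n. C $$ (i, l) * N $$ (l, j)) = char_poly A * 1\<^sub>m n $$ (i, j)" if "i < n" "j < n" for i j
  proof -
    have "(C * N) $$ (i, j) = (\<Sum>l<n. C $$ (i, l) * N $$ (l, j))"
      using that C N by (simp add: scalar_prod_def atLeast0LessThan)
    then show ?thesis unfolding CN using that by simp
  qed
  have C_index: "C $$ (i, l) * p = (if i = l then pCons 0 p else 0) - smult (A $$ (i, l)) p"
    if "i < n" "l < n" for i l p
    using that A unfolding C_def char_poly_matrix_def by (simp add: algebra_simps)
  have rec: "1\<^sub>m n $$ (i, j) * coeff (char_poly A) e =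
      (if e = 0 then 0 else B (e - 1) $$ (i, j)) - (A * B e) $$ (i, j)" if ij: "i < n" "j < n" for i j e
  proof -
    have "1\<^sub>m n $$ (i, j) * coeff (char_poly A) e = coeff (\<Sum>l<n. C $$ (i, l) * N $$ (l, j)) e"
      unfolding CN_index[OF ij] using ij by simp
    also have "\<dots> = (\<Sum>l<n. coeff (if i = l then pCons 0 (N $$ (l, j)) else 0) e - A $$ (i, l) * B e $$ (l, j))"
      using ij N by (simp add: coeff_sum C_index B_def)
    also have "\<dots> = coeff (pCons 0 (N $$ (i, j))) e - (\<Sum>l<n. A $$ (i, l) * B e $$ (l, j))"
      using ij by (simp add: sum_subtractf if_distrib[of "\<lambda>p. coeff p e"] sum.delta cong: if_cong)
    also have "(\<Sum>l<n. A $$ (i, l) * B e $$ (l, j)) = (A * B e) $$ (i, j)"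
      using ij A B[of e] by (simp add: scalar_prod_def atLeast0LessThan)
    also have "coeff (pCons 0 (N $$ (i, j))) e = (if e = 0 then 0 else B (e - 1) $$ (i, j))"
      using ij N by (cases e) (auto simp: B_def)
    finally show ?thesis .
  qed
  have tele: "(\<Sum>e\<le>m. coeff (char_poly A) e * (A ^\<^sub>m e) $$ (i, j)) = - (A ^\<^sub>m Suc m * B m) $$ (i, j)"
    if ij: "i < n" "j < n" for i j m
  proof -
    have Ae: "A ^\<^sub>m e \<in> carrier_mat n n" for e using A by (rule pow_carrier_mat)
    have step: "coeff (char_poly A) e * (A ^\<^sub>m e) $$ (i, j) =
        (if e = 0 then 0 else (A ^\<^sub>m e * B (e - 1)) $$ (i, j)) - (A ^\<^sub>m Suc e * B e) $$ (i, j)" for e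
    proof -
      have "coeff (char_poly A) e * (A ^\<^sub>m e) $$ (i, j) =
          (\<Sum>l<n. (A ^\<^sub>m e) $$ (i, l) * (1\<^sub>m n $$ (l, j) * coeff (char_poly A) e))"
        using ij by (simp add: if_distrib[of "\<lambda>x. _ * x"] if_distrib[of "\<lambda>x. x * _"] sum.delta mult.commute cong: if_cong)
      also have "\<dots> = (\<Sum>l<n. (A ^\<^sub>m e) $$ (i, l) * ((if e = 0 then 0 else B (e - 1) $$ (l, j)) - (A * B e) $$ (l, j)))"
        using rec ij by (intro sum.cong) auto
      also have "\<dots> = (if e = 0 then 0 else (\<Sum>l<n. (A ^\<^sub>m e) $$ (i, l) * B (e - 1) $$ (l, j))) -
          (\<Sum>l<n. (A ^\<^sub>m e) $$ (i, l) * (A * B e) $$ (l, j))"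
        by (simp add: right_diff_distrib sum_subtractf)
      also have "(\<Sum>l<n. (A ^\<^sub>m e) $$ (i, l) * (A * B e) $$ (l, j)) = (A ^\<^sub>m e * (A * B e)) $$ (i, j)"
        using A B by (intro index_mult_mat_sum[OF Ae _ ij, symmetric]) auto
      also have "A ^\<^sub>m e * (A * B e) = A ^\<^sub>m Suc e * B e"
        using assoc_mult_mat[OF Ae A B] by simp
      also have "(\<Sum>l<n. (A ^\<^sub>m e) $$ (i, l) * B (e - 1) $$ (l, j)) = (A ^\<^sub>m e * B (e - 1)) $$ (i, j)"
        by (rule index_mult_mat_sum[OF Ae B ij, symmetric])
      finally show ?thesis .
    qed
    show ?thesis by (induction m) (simp_all add: step del: pow_mat.simps)
  qed
  \<comment> \<open>Large enough for two purposes: the sum reaches all coefficients of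
    \<open>char_poly A\<close>, and the remaining term \<open>B m\<close> of the telescope lies
    beyond the degrees of all entries of \<open>N\<close>.\<close>
  define m where "m = Max (insert (degree (char_poly A)) ((\<lambda>(i, j). Suc (degree (N $$ (i, j)))) ` ({..<n} \<times> {..<n})))"
  have m1: "degree (char_poly A) \<le> m" unfolding m_def by (rule Max_ge) auto
  have m2: "degree (N $$ (i, j)) < m" if "i < n" "j < n" for i j
  proof -
    have "Suc (degree (N $$ (i, j))) \<le> m" unfolding m_def using that by (intro Max_ge) auto
    then show ?thesis by simp
  qed
  have "B m = 0\<^sub>m n n" using N m2 by (intro eq_matI) (auto simp: B_def coeff_eq_0)
  then have "(A ^\<^sub>m Suc m * B m) = 0\<^sub>m n n" using A by (simp add: right_mult_zero_mat[of _ n n] pow_carrier_mat del: pow_mat.simps)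
  then show ?thesis
    using tele[of _ _ m] poly_mat_index[of _ _ "char_poly A" m] m1
    by (intro eq_matI) (auto simp: carrier_matD[OF poly_mat_carrier] simp del: pow_mat.simps)
qed

end

text \<open>All roots of the characteristic polynomial are roots of \<open>X^m - 1\<close>. As it
  splits into \<open>n\<close> linear factors, it divides the \<open>n\<close>-th power of
  \<open>X^m - 1\<close>, and Cayley-Hamilton applies.\<close>

lemma unipotent_power:
  fixes A :: "'k::{alg_closed_field} mat"
  assumes A: "A \<in> carrier_mat n n" and ev: "\<And>e. eigenvalue A e \<Longrightarrow> e ^ m = 1"
  shows "(A ^\<^sub>m m - 1\<^sub>m n) ^\<^sub>m n = 0\<^sub>m n n"
proof -
  have deg: "degree (char_poly A) = n" "coeff (char_poly A) n = 1"
    using degree_monic_char_poly[OF A] by auto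
  then have "char_poly A \<noteq> 0" by auto
  from alg_closed_imp_factorization[OF this] obtain R where R: "size R = n"
    "char_poly A = (\<Prod>x\<in>#R. [:- x, 1:])" using deg by auto
  define f :: "'k poly" where "f = [:0, 1:] ^ m - 1"
  have "[:- x, 1:] dvd f" if "x \<in># R" for x
  proof -
    have "poly (char_poly A) x = 0" unfolding R(2) poly_prod_mset using that by (auto simp: image_iff)
    then have "x ^ m = 1" using ev eigenvalue_root_char_poly[OF A] by blast
    then show ?thesis by (simp add: f_def poly_eq_0_iff_dvd[symmetric])
  qed
  then have "\<forall>x\<in>#R. [:- x, 1:] dvd f" by blast
  then have "(\<Prod>x\<in>#R. [:- x, 1:]) dvd f ^ size R"
  proof (induction R)
    case (add x R)
    have "[:- x, 1:] * (\<Prod>x\<in>#R. [:- x, 1:]) dvd f * f ^ size R"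
      using add by (intro mult_dvd_mono) auto
    then show ?case by (simp only: image_mset_add_mset prod_mset.add_mset size_add_mset power_Suc)
  qed simp
  then obtain g where g: "f ^ n = char_poly A * g" unfolding R by (rule dvdE)
  have "poly_mat A f ^\<^sub>m n = 0\<^sub>m n n * poly_mat A g"
    unfolding poly_mat_power[OF A, symmetric] g poly_mat_mult[OF A] cayley_hamilton[OF A] ..
  also have "poly_mat A f = A ^\<^sub>m m - 1\<^sub>m n"
  proof -
    have "poly_mat A (f + 1) = A ^\<^sub>m m" unfolding f_def using poly_mat_power[OF A, of "[:0, 1:]" m] poly_mat_X[OF A] by simp
    then have "poly_mat A f + 1\<^sub>m n = A ^\<^sub>m m" by (simp only: poly_mat_add[OF A] poly_mat_1[OF A])
    then have e: "A ^\<^sub>m m = poly_mat A f + 1\<^sub>m n" by (rule sym)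
    show ?thesis unfolding e using poly_mat_carrier[OF A, of f] by (intro eq_matI) auto
  qed
  finally show ?thesis by (simp add: left_mult_zero_mat[of _ n n] poly_mat_carrier[OF A])
qed

lemma pow_mat_binomial:
  fixes V :: "'k::comm_ring_1 mat"
  assumes V: "V \<in> carrier_mat n n" and ij: "i < n" "j < n"
  shows "((1\<^sub>m n + V) ^\<^sub>m m) $$ (i, j) = (\<Sum>l\<le>m. of_nat (m choose l) * (V ^\<^sub>m l) $$ (i, j))"
  using ij(2)
proof (induction m arbitrary: j)
  case (Suc m)
  let ?U = "1\<^sub>m n + V"
  have Vp: "V ^\<^sub>m l \<in> carrier_mat n n" for l using V by (rule pow_carrier_mat)
  have U: "?U \<in> carrier_mat n n" using V by simp
  have Up: "?U ^\<^sub>m m \<in> carrier_mat n n" using U by (rule pow_carrier_mat)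
  have "?U ^\<^sub>m Suc m = ?U ^\<^sub>m m + ?U ^\<^sub>m m * V"
    using Up V by (simp add: mult_add_distrib_mat[OF Up _ V])
  then have "(?U ^\<^sub>m Suc m) $$ (i, j) = (?U ^\<^sub>m m) $$ (i, j) + (\<Sum>r<n. (?U ^\<^sub>m m) $$ (i, r) * V $$ (r, j))"
    using Up V ij(1) Suc.prems by (simp add: scalar_prod_def atLeast0LessThan)
  also have "(\<Sum>r<n. (?U ^\<^sub>m m) $$ (i, r) * V $$ (r, j)) =
      (\<Sum>r<n. \<Sum>l\<le>m. of_nat (m choose l) * ((V ^\<^sub>m l) $$ (i, r) * V $$ (r, j)))"
    using Suc.IH by (simp add: sum_distrib_right mult.assoc)
  also have "\<dots> = (\<Sum>l\<le>m. of_nat (m choose l) * (\<Sum>r<n. (V ^\<^sub>m l) $$ (i, r) * V $$ (r, j)))"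
    by (subst sum.swap) (simp add: sum_distrib_left)
  also have "\<dots> = (\<Sum>l\<le>m. of_nat (m choose l) * (V ^\<^sub>m Suc l) $$ (i, j))"
    using Vp V ij(1) Suc.prems by (simp add: scalar_prod_def atLeast0LessThan)
  also have "(?U ^\<^sub>m m) $$ (i, j) = (\<Sum>l\<le>m. of_nat (m choose l) * (V ^\<^sub>m l) $$ (i, j))"
    by (rule Suc.IH[OF Suc.prems])
  also have "(\<Sum>l\<le>m. of_nat (m choose l) * (V ^\<^sub>m l) $$ (i, j)) +
      (\<Sum>l\<le>m. of_nat (m choose l) * (V ^\<^sub>m Suc l) $$ (i, j)) =
      (\<Sum>l\<le>Suc m. of_nat (Suc m choose l) * (V ^\<^sub>m l) $$ (i, j))"
  proof -
    \<comment> \<open>The sum is extended by the term with \<open>m choose Suc m = 0\<close>, so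
      that after a shift Pascal's rule can be applied term by term.\<close>
    have "(\<Sum>l\<le>m. of_nat (m choose l) * (V ^\<^sub>m l) $$ (i, j)) =
        (\<Sum>l\<le>Suc m. of_nat (m choose l) * (V ^\<^sub>m l) $$ (i, j))"
      by (simp add: binomial_eq_0 del: pow_mat.simps(2))
    also have "\<dots> = (V ^\<^sub>m 0) $$ (i, j) + (\<Sum>l\<le>m. of_nat (m choose Suc l) * (V ^\<^sub>m Suc l) $$ (i, j))"
      by (subst sum.atMost_Suc_shift) (simp del: pow_mat.simps(2))
    finally have e1: "(\<Sum>l\<le>m. of_nat (m choose l) * (V ^\<^sub>m l) $$ (i, j)) =
        (V ^\<^sub>m 0) $$ (i, j) + (\<Sum>l\<le>m. of_nat (m choose Suc l) * (V ^\<^sub>m Suc l) $$ (i, j))" .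
    have e2: "(\<Sum>l\<le>Suc m. of_nat (Suc m choose l) * (V ^\<^sub>m l) $$ (i, j)) =
        (V ^\<^sub>m 0) $$ (i, j) + (\<Sum>l\<le>m. of_nat (Suc m choose Suc l) * (V ^\<^sub>m Suc l) $$ (i, j))"
      by (subst sum.atMost_Suc_shift) (simp del: pow_mat.simps(2) binomial_Suc_Suc)
    show ?thesis unfolding e1 e2 by (simp add: sum.distrib algebra_simps del: pow_mat.simps(2))
  qed
  finally show ?case .
qed (use V ij in auto)

section \<open>Finite quotients of finitely generated domains\<close>

text \<open>Zero, negatives and sums are obtained from differences.\<close>

inductive_set ring_gen :: "'k::comm_ring_1 set \<Rightarrow> 'k set" for U where
  incl: "u \<in> U \<Longrightarrow> u \<in> ring_gen U"
| one: "1 \<in> ring_gen U"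
| diff: "a \<in> ring_gen U \<Longrightarrow> b \<in> ring_gen U \<Longrightarrow> a - b \<in> ring_gen U"
| mult: "a \<in> ring_gen U \<Longrightarrow> b \<in> ring_gen U \<Longrightarrow> a * b \<in> ring_gen U"

text \<open>Subrings and ideals are subsets of one fixed ring, and quotients are expressed by
  congruences \<open>a - b \<in> I\<close>. Adjoining an element then never changes the type, which
  permits induction on the generators.\<close>

locale type_subring =
  fixes A :: "'k::comm_ring_1 set"
  assumes one: "1 \<in> A"
    and diff: "a \<in> A \<Longrightarrow> b \<in> A \<Longrightarrow> a - b \<in> A"
    and mult: "a \<in> A \<Longrightarrow> b \<in> A \<Longrightarrow> a * b \<in> A"

locale type_ideal = type_subring A for A :: "'k::comm_ring_1 set" +
  fixes I
  assumes sub: "I \<subseteq> A" and zero_I: "0 \<in> I"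
    and diff_I: "a \<in> I \<Longrightarrow> b \<in> I \<Longrightarrow> a - b \<in> I"
    and mult_I: "a \<in> A \<Longrightarrow> b \<in> I \<Longrightarrow> a * b \<in> I"

definition polys :: "'k::comm_ring_1 set \<Rightarrow> 'k poly set" where
  "polys J = {p. \<forall>i. coeff p i \<in> J}"

definition adjoin :: "'k::comm_ring_1 set \<Rightarrow> 'k \<Rightarrow> 'k set" where
  "adjoin A x = (\<lambda>p. poly p x) ` polys A"

context type_subring begin

lemma self_ideal: "type_ideal A A"
  using diff[OF one one] by unfold_locales (auto intro: diff mult)

end

context type_ideal begin

lemma uminus_I: "a \<in> I \<Longrightarrow> - a \<in> I"
  using diff_I[OF zero_I, of a] by simp

lemma add_I: "a \<in> I \<Longrightarrow> b \<in> I \<Longrightarrow> a + b \<in> I"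
  using diff_I[of a "- b"] uminus_I by simp

lemma sum_I: "(\<And>i. i \<in> S \<Longrightarrow> f i \<in> I) \<Longrightarrow> sum f S \<in> I"
  by (induction S rule: infinite_finite_induct) (auto intro: add_I zero_I)

lemma polys_0: "0 \<in> polys I"
  by (simp add: polys_def zero_I)

lemma polys_diff: "p \<in> polys I \<Longrightarrow> q \<in> polys I \<Longrightarrow> p - q \<in> polys I"
  by (simp add: polys_def diff_I)

lemma polys_add: "p \<in> polys I \<Longrightarrow> q \<in> polys I \<Longrightarrow> p + q \<in> polys I"
  by (simp add: polys_def add_I)

lemma polys_mult: "p \<in> polys A \<Longrightarrow> q \<in> polys I \<Longrightarrow> p * q \<in> polys I"
  by (auto simp: polys_def coeff_mult intro!: sum_I mult_I)

lemma polys_smult: "c \<in> A \<Longrightarrow> q \<in> polys I \<Longrightarrow> smult c q \<in> polys I"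
  by (simp add: polys_def mult_I)

lemma polys_monom: "c \<in> I \<Longrightarrow> monom c e \<in> polys I"
  by (simp add: polys_def zero_I)

lemma polys_pCons: "c \<in> I \<Longrightarrow> p \<in> polys I \<Longrightarrow> pCons c p \<in> polys I"
  by (auto simp: polys_def coeff_pCons split: nat.split)

lemma power_A: "c \<in> A \<Longrightarrow> c ^ m \<in> A"
  by (induction m) (auto intro: one mult)

lemma power_cong_1:
  assumes "a \<in> A" "a - 1 \<in> I"
  shows "a ^ m - 1 \<in> I"
proof (induction m)
  case (Suc m)
  have "a * (a ^ m - 1) + (a - 1) \<in> I" using Suc assms by (intro add_I mult_I)
  then show ?case by (simp add: algebra_simps)
qed (simp add: zero_I)

end

lemma type_subring_ring_gen: "type_subring (ring_gen U)"
  by unfold_locales (auto intro: ring_gen.intros)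

context type_subring begin

interpretation self: type_ideal A A by (rule self_ideal)

lemma type_subring_adjoin: "type_subring (adjoin A x)"
proof
  have "(1::'k poly) \<in> polys A"
    using self.polys_monom[OF one, of 0] by (simp add: monom_0 one_pCons)
  then show "1 \<in> adjoin A x" unfolding adjoin_def by (rule rev_image_eqI) simp
  show "a - b \<in> adjoin A x" if "a \<in> adjoin A x" "b \<in> adjoin A x" for a b
    using that self.polys_diff unfolding adjoin_def by (auto simp flip: poly_diff)
  show "a * b \<in> adjoin A x" if "a \<in> adjoin A x" "b \<in> adjoin A x" for a b
    using that self.polys_mult unfolding adjoin_def by (auto simp flip: poly_mult)
qed

lemma adjoin_incl: "a \<in> A \<Longrightarrow> a \<in> adjoin A x"
  unfolding adjoin_def using self.polys_monom[of a 0] by (intro rev_image_eqI[of "[:a:]"]) (auto simp: monom_0)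

lemma adjoin_self: "x \<in> adjoin A x"
  unfolding adjoin_def using self.polys_monom[OF one, of 1]
  by (intro rev_image_eqI[of "monom 1 1"]) (auto simp: poly_monom)

lemma poly_in_subring: "p \<in> polys A \<Longrightarrow> x \<in> A \<Longrightarrow> poly p x \<in> A"
  by (auto simp: poly_altdef polys_def intro!: self.sum_I mult self.power_A)

end

lemma ring_gen_insert: "ring_gen (insert x U) = adjoin (ring_gen U) x"
proof
  interpret A: type_subring "ring_gen U" by (rule type_subring_ring_gen)
  interpret A': type_subring "adjoin (ring_gen U) x" by (rule A.type_subring_adjoin)
  show "ring_gen (insert x U) \<subseteq> adjoin (ring_gen U) x"
  proof
    fix y assume "y \<in> ring_gen (insert x U)"
    then show "y \<in> adjoin (ring_gen U) x"
      by induction (auto intro: A.adjoin_self A.adjoin_incl ring_gen.incl A'.one A'.diff A'.mult)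
  qed
  interpret B: type_subring "ring_gen (insert x U)" by (rule type_subring_ring_gen)
  have "ring_gen U \<subseteq> ring_gen (insert x U)"
  proof
    fix y assume "y \<in> ring_gen U"
    then show "y \<in> ring_gen (insert x U)" by induction (auto intro: ring_gen.intros)
  qed
  then show "adjoin (ring_gen U) x \<subseteq> ring_gen (insert x U)"
    using B.poly_in_subring[OF _ ring_gen.incl[of x "insert x U"]] unfolding adjoin_def polys_def by auto
qed

section \<open>Extending an ideal to a ring with one more generator\<close>

context type_ideal begin

text \<open>Division without inverting the leading coefficient, at the cost of a power of it.
  Working with coefficients in an ideal shows that quotient and remainder keep them there;
  \<open>I = A\<close> gives the ordinary case. The induction measure places \<open>0\<close> below
  the nonzero constants.\<close>

lemma pseudo_division:
  assumes g: "g \<in> polys A" "g \<noteq> 0" and f: "f \<in> polys I"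
  shows "\<exists>m Q r. Q \<in> polys I \<and> r \<in> polys I \<and> smult (lead_coeff g ^ m) f = g * Q + r \<and>
    (r = 0 \<or> degree r < degree g)"
  using f
proof (induction "if f = 0 then 0 else Suc (degree f)" arbitrary: f rule: less_induct)
  case less
  show ?case
  proof (cases "f = 0 \<or> degree f < degree g")
    case True
    then show ?thesis using less.prems polys_0 by (intro exI[of _ 0] exI[of _ 0] exI[of _ f]) auto
  next
    case False
    define c h where "c = lead_coeff g" and "h = monom (lead_coeff f) (degree f - degree g)"
    have c: "c \<in> A" using g unfolding c_def polys_def by simp
    have h: "h \<in> polys I" unfolding h_def using less.prems by (intro polys_monom) (simp add: polys_def)
    define f' where "f' = smult c f - g * h"
    have f': "f' \<in> polys I" unfolding f'_def using c g h less.prems by (intro polys_diff polys_smult polys_mult)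
    have deg: "degree f' \<le> degree f"
      unfolding f'_def h_def using False
      by (intro degree_diff_le degree_smult_le order_trans[OF degree_mult_le]) (auto intro: order_trans[OF add_left_mono[OF degree_monom_le]])
    have "coeff (g * h) (degree f) = c * lead_coeff f"
      using False unfolding h_def c_def by (subst mult.commute) (simp add: coeff_monom_mult)
    then have top: "coeff f' (degree f) = 0" unfolding f'_def by simp
    have "f' = 0" if "degree f' = degree f"
      using top unfolding that[symmetric] by simp
    then have "f' = 0 \<or> degree f' < degree f" using deg le_neq_implies_less by blast
    then have "(if f' = 0 then 0 else Suc (degree f')) < (if f = 0 then 0 else Suc (degree f))"
      using False by auto
    from less.hyps[OF this f'] obtain m Q r where
      Qr: "Q \<in> polys I" "r \<in> polys I" "smult (c ^ m) f' = g * Q + r" "r = 0 \<or> degree r < degree g"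
      unfolding c_def by blast
    have "smult (c ^ Suc m) f = smult (c ^ m) f' + smult (c ^ m) (g * h)"
      unfolding f'_def by (simp add: smult_diff_right mult.commute)
    also have "\<dots> = g * (Q + smult (c ^ m) h) + r" unfolding Qr(3) by (simp add: algebra_simps)
    finally show ?thesis using Qr c h unfolding c_def
      by (intro exI[of _ "Suc m"] exI[of _ "Q + smult (lead_coeff g ^ m) h"] exI[of _ r])
        (auto intro!: polys_add polys_smult power_A)
  qed
qed

text \<open>The ideal of \<open>adjoin A x\<close> generated by \<open>I\<close> and the value
  \<open>poly g x\<close>.\<close>

definition extended :: "'k poly \<Rightarrow> 'k \<Rightarrow> 'k set" where
  "extended g x = {poly (g * a + r) x | a r. a \<in> polys A \<and> r \<in> polys I}"

lemma extended_ideal: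
  assumes g: "g \<in> polys A"
  shows "type_ideal (adjoin A x) (extended g x)"
proof -
  interpret S: type_ideal A A by (rule self_ideal)
  interpret B: type_subring "adjoin A x" by (rule type_subring_adjoin)
  have IA: "p \<in> polys A" if "p \<in> polys I" for p using that sub unfolding polys_def by auto
  show ?thesis
  proof unfold_locales
    show "extended g x \<subseteq> adjoin A x"
    proof
      fix u assume "u \<in> extended g x"
      then obtain a r where a: "u = poly (g * a + r) x" "a \<in> polys A" "r \<in> polys I" unfolding extended_def by blast
      have "g * a + r \<in> polys A" by (intro S.polys_add S.polys_mult g IA a)
      then show "u \<in> adjoin A x" unfolding a(1) adjoin_def by (rule imageI)
    qed
    show "0 \<in> extended g x" unfolding extended_def using polys_0 S.polys_0 by force
    show "u - v \<in> extended g x" if u: "u \<in> extended g x" and v: "v \<in> extended g x" for u v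
    proof -
      obtain a r where a: "u = poly (g * a + r) x" "a \<in> polys A" "r \<in> polys I" using u unfolding extended_def by blast
      obtain b s where b: "v = poly (g * b + s) x" "b \<in> polys A" "s \<in> polys I" using v unfolding extended_def by blast
      have "u - v = poly (g * (a - b) + (r - s)) x" unfolding a b by (simp add: algebra_simps)
      then show ?thesis unfolding extended_def using a b S.polys_diff polys_diff by blast
    qed
    show "u * v \<in> extended g x" if u: "u \<in> adjoin A x" and v: "v \<in> extended g x" for u v
    proof -
      obtain a where a: "u = poly a x" "a \<in> polys A" using u unfolding adjoin_def by blast
      obtain b s where b: "v = poly (g * b + s) x" "b \<in> polys A" "s \<in> polys I" using v unfolding extended_def by blast
      have "u * v = poly (g * (a * b) + a * s) x" unfolding a b by (simp add: algebra_simps)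
      then show ?thesis unfolding extended_def using a b S.polys_mult polys_mult by blast
    qed
  qed
qed

lemma extended_incl: "a \<in> I \<Longrightarrow> a \<in> extended g x"
  unfolding extended_def using polys_monom[of a 0] type_ideal.polys_0[OF self_ideal]
  by (intro CollectI exI[of _ 0] exI[of _ "[:a:]"]) (auto simp: monom_0)

lemma extended_root: "poly g x \<in> extended g x"
  unfolding extended_def using type_ideal.polys_monom[OF self_ideal one, of 0] polys_0
  by (intro CollectI exI[of _ 1] exI[of _ 0]) (auto simp: monom_0 one_pCons)

text \<open>Since the leading coefficient of \<open>g\<close> is invertible modulo \<open>I\<close>,
  each element is congruent to a polynomial in \<open>x\<close> of degree below
  \<open>degree g\<close>, whose coefficients can then be reduced to \<open>T\<close>.\<close>

lemma extended_finite_index: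
  assumes g: "g \<in> polys A" "g \<noteq> 0" and c': "c' \<in> A" "lead_coeff g * c' - 1 \<in> I"
    and T: "finite T" "\<And>a. a \<in> A \<Longrightarrow> \<exists>t\<in>T. a - t \<in> I"
  shows "\<exists>T'. finite T' \<and> (\<forall>a\<in>adjoin A x. \<exists>t\<in>T'. a - t \<in> extended g x)"
proof -
  interpret S: type_ideal A A by (rule self_ideal)
  interpret J: type_ideal "adjoin A x" "extended g x" by (rule extended_ideal[OF g(1)])
  define d where "d = degree g"
  define T' where "T' = (\<lambda>t. \<Sum>i<d. t i * x ^ i) ` ({..<d} \<rightarrow>\<^sub>E T)"
  have "finite T'" unfolding T'_def using T(1) by (intro finite_imageI finite_PiE) auto
  moreover have "\<exists>t\<in>T'. u - t \<in> extended g x" if u: "u \<in> adjoin A x" for u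
  proof -
    obtain f where f: "u = poly f x" "f \<in> polys A" using u unfolding adjoin_def by blast
    define c where "c = lead_coeff g"
    have c: "c \<in> A" unfolding c_def using g by (simp add: polys_def)
    obtain m Q r where Q: "Q \<in> polys A" "r \<in> polys A" "smult (c ^ m) f = g * Q + r" "r = 0 \<or> degree r < d"
      using S.pseudo_division[OF g f(2)] unfolding c_def d_def by blast
    \<comment> \<open>The factor \<open>c' ^ m\<close> undoes, modulo \<open>I\<close>, the power of
      the leading coefficient that pseudo-division introduced.\<close>
    define s where "s = smult (c' ^ m) r"
    have s: "s \<in> polys A" unfolding s_def using c' Q by (intro S.polys_smult S.power_A)
    have sd: "coeff s i = 0" if "d \<le> i" for i unfolding s_def using Q(4) that by (auto simp: coeff_eq_0)
    have sx: "poly s x = (\<Sum>i<d. coeff s i * x ^ i)"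
    proof -
      have "poly s x = (\<Sum>i\<le>degree s + d. coeff s i * x ^ i)"
        unfolding poly_altdef by (intro sum.mono_neutral_left) (auto simp: coeff_eq_0)
      also have "\<dots> = (\<Sum>i<d. coeff s i * x ^ i)"
        using sd by (intro sum.mono_neutral_right) auto
      finally show ?thesis .
    qed
    have "\<forall>i\<in>{..<d}. \<exists>t. t \<in> T \<and> coeff s i - t \<in> I" using T(2) s unfolding polys_def by blast
    from bchoice[OF this] obtain t where t: "\<And>i. i < d \<Longrightarrow> t i \<in> T \<and> coeff s i - t i \<in> I" by auto
    define v where "v = (\<Sum>i<d. t i * x ^ i)"
    have vT: "v \<in> T'" unfolding T'_def v_def
      by (rule rev_image_eqI[of "restrict t {..<d}"]) (use t in auto)
    have "poly s x - v = (\<Sum>i<d. x ^ i * (coeff s i - t i))"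
      unfolding sx v_def by (simp add: sum_subtractf algebra_simps)
    also have "\<dots> \<in> extended g x"
      using t extended_incl adjoin_self by (intro J.sum_I J.mult_I J.power_A) auto
    finally have 1: "poly s x - v \<in> extended g x" .
    have "(c * c') ^ m - 1 \<in> I"
      by (rule power_cong_1) (use c c' mult in \<open>auto simp: c_def\<close>)
    then have 2: "u * ((c * c') ^ m - 1) \<in> extended g x" using u extended_incl by (intro J.mult_I)
    have "c' ^ m * poly Q x \<in> adjoin A x" unfolding adjoin_def
      using S.polys_smult[OF power_A[OF c'(1)] Q(1), of m] by (intro rev_image_eqI[of "smult (c' ^ m) Q"]) auto
    then have 3: "c' ^ m * poly Q x * poly g x \<in> extended g x" using extended_root by (intro J.mult_I)
    have "c ^ m * u = poly g x * poly Q x + poly r x"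
      unfolding f(1) using arg_cong[OF Q(3), of "\<lambda>p. poly p x"] by simp
    then have "c' ^ m * (c ^ m * u) = c' ^ m * poly Q x * poly g x + poly s x"
      unfolding s_def by (simp add: algebra_simps)
    then have "u - v = - (u * ((c * c') ^ m - 1)) + (c' ^ m * poly Q x * poly g x) + (poly s x - v)"
      by (simp add: algebra_simps power_mult_distrib)
    also have "\<dots> \<in> extended g x" using 1 2 3 by (intro J.add_I J.uminus_I)
    finally show ?thesis using vT by blast
  qed
  ultimately show ?thesis by blast
qed

end

text \<open>The quotient of \<open>A\<close> by \<open>I\<close> is a nonzero finite ring in which
  \<open>b\<close> becomes a unit.\<close>

definition good_ideal :: "'k::comm_ring_1 set \<Rightarrow> 'k set \<Rightarrow> 'k \<Rightarrow> bool" where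
  "good_ideal A I b \<longleftrightarrow> type_ideal A I \<and> 1 \<notin> I \<and>
     (\<exists>T. finite T \<and> (\<forall>a\<in>A. \<exists>t\<in>T. a - t \<in> I)) \<and> (\<exists>y\<in>A. b * y - 1 \<in> I)"

context type_ideal begin

lemma one_if_invertible_multiple:
  assumes "c \<in> A" "c' \<in> A" "c * c' - 1 \<in> I" "a \<in> A" "c ^ m * a \<in> I"
  shows "a \<in> I"
proof -
  have "(c * c') ^ m - 1 \<in> I" using assms by (intro power_cong_1 mult)
  then have "a * ((c * c') ^ m - 1) \<in> I" by (rule mult_I[OF assms(4)])
  moreover have "c' ^ m * (c ^ m * a) \<in> I" by (rule mult_I[OF power_A[OF assms(2)] assms(5)])
  ultimately have "c' ^ m * (c ^ m * a) - a * ((c * c') ^ m - 1) \<in> I" by (intro diff_I)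
  moreover have "c' ^ m * (c ^ m * a) - a * ((c * c') ^ m - 1) = a"
    by (simp add: algebra_simps power_mult_distrib)
  ultimately show ?thesis by (simp only:)
qed

text \<open>Modulo \<open>I\<close> the polynomial \<open>g\<close> has positive degree and a unit
  as leading coefficient. Even when the quotient has zero divisors, the top coefficient of a product
  with such a \<open>g\<close> cannot vanish, so \<open>g\<close> is not a unit.\<close>

lemma no_unit_multiple_mod:
  assumes g: "g \<in> polys A" "degree g > 0" and c': "c' \<in> A" "lead_coeff g * c' - 1 \<in> I"
    and a: "a \<in> polys A" and r: "r \<in> polys I" and eq: "1 = g * a + r"
  shows "1 \<in> I"
proof (cases "a \<in> polys I")
  case True
  then have "1 \<in> polys I" unfolding eq using g r by (intro polys_add polys_mult)
  then have "coeff (1::'k poly) 0 \<in> I" unfolding polys_def by blast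
  then show ?thesis by simp
next
  case False
  \<comment> \<open>\<open>e\<close> is the degree of \<open>a\<close> modulo \<open>I\<close>,
    which may be smaller than \<open>degree a\<close>.\<close>
  define d e where "d = degree g" and "e = Max {e. coeff a e \<notin> I}"
  have "{e. coeff a e \<notin> I} \<subseteq> {..degree a}" using zero_I by (auto intro: le_degree)
  then have fin: "finite {e. coeff a e \<notin> I}" by (rule finite_subset) simp
  have "{e. coeff a e \<notin> I} \<noteq> {}" using False unfolding polys_def by auto
  then have e: "coeff a e \<notin> I" using Max_in[OF fin] unfolding e_def by blast
  have above: "coeff a i \<in> I" if "i > e" for i
    using that Max_ge[OF fin, of i] unfolding e_def by (meson leD mem_Collect_eq)
  have gA: "coeff g i \<in> A" for i using g unfolding polys_def by blast
  have "coeff (g * a) (e + d) = (\<Sum>i\<le>e + d. coeff g i * coeff a (e + d - i))" by (rule coeff_mult)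
  also have "\<dots> = coeff g d * coeff a e + (\<Sum>i\<in>{..e + d} - {d}. coeff g i * coeff a (e + d - i))"
    by (subst sum.remove[of _ d]) auto
  finally have s: "coeff g d * coeff a e =
      coeff (g * a) (e + d) - (\<Sum>i\<in>{..e + d} - {d}. coeff g i * coeff a (e + d - i))" by simp
  have "(\<Sum>i\<in>{..e + d} - {d}. coeff g i * coeff a (e + d - i)) \<in> I"
  proof (rule sum_I)
    fix i assume i: "i \<in> {..e + d} - {d}"
    show "coeff g i * coeff a (e + d - i) \<in> I"
    proof (cases "i < d")
      case True
      then show ?thesis using i by (intro mult_I gA above) auto
    next
      case False
      then have "coeff g i = 0" using i unfolding d_def by (intro coeff_eq_0) auto
      then show ?thesis using zero_I by simp
    qed
  qed
  moreover have "coeff (g * a) (e + d) \<in> I"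
  proof -
    \<comment> \<open>The index \<open>e + d\<close> is positive, so the constant \<open>1\<close>
      does not contribute there.\<close>
    have "g * a = 1 - r" unfolding eq by simp
    then have "coeff (g * a) (e + d) = - coeff r (e + d)" using g(2) unfolding d_def by simp
    then show ?thesis using r uminus_I unfolding polys_def by simp
  qed
  ultimately have "coeff g d * coeff a e \<in> I" unfolding s by (intro diff_I)
  then have "lead_coeff g ^ 1 * coeff a e \<in> I" unfolding d_def by simp
  moreover have "coeff a e \<in> A" using a unfolding polys_def by blast
  ultimately have "coeff a e \<in> I" using one_if_invertible_multiple[OF gA c'] by blast
  with e show ?thesis by contradiction
qed

end

text \<open>A fraction-free form of inversion in an algebraic extension: every nonzero element of
  \<open>A[x]\<close> divides a nonzero element of \<open>A\<close>. This is Euclid's algorithm with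
  pseudo-division, descending on the degree of \<open>p\<close>.\<close>

lemma minimal_polynomial_multiple:
  fixes A :: "'k::field set"
  assumes A: "type_subring A" and g: "g \<in> polys A" "g \<noteq> 0" "poly g x = 0"
    and min: "\<And>h. h \<in> polys A \<Longrightarrow> h \<noteq> 0 \<Longrightarrow> poly h x = 0 \<Longrightarrow> degree g \<le> degree h"
    and p: "p \<in> polys A" "poly p x \<noteq> 0"
  shows "\<exists>y\<in>polys A. \<exists>a\<in>A. a \<noteq> 0 \<and> poly p x * poly y x = a"
proof -
  interpret type_subring A by (rule A)
  interpret S: type_ideal A A by (rule self_ideal)
  have const: "[:c:] \<in> polys A" if "c \<in> A" for c using S.polys_monom[OF that, of 0] by (simp add: monom_0)
  have small: "\<exists>y\<in>polys A. \<exists>a\<in>A. a \<noteq> 0 \<and> poly p x * poly y x = a"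
    if "p \<in> polys A" "poly p x \<noteq> 0" "degree p < degree g" for p
    using that
  proof (induction "degree p" arbitrary: p rule: less_induct)
    case less
    have p0: "p \<noteq> 0" using less.prems by auto
    show ?case
    proof (cases "degree p = 0")
      case True
      then obtain a where a: "p = [:a:]" by (rule degree_eq_zeroE)
      have "a \<in> A" using less.prems(1) unfolding a polys_def by (auto dest: spec[of _ 0])
      then show ?thesis using less.prems(2) const[OF one] unfolding a by (intro bexI[of _ "[:1:]"]) auto
    next
      case False
      obtain m Q r where Q: "Q \<in> polys A" "r \<in> polys A" "smult (lead_coeff p ^ m) g = p * Q + r"
        "r = 0 \<or> degree r < degree p" using S.pseudo_division[OF less.prems(1) p0 g(1)] by blast
      have ev: "poly r x = - (poly p x * poly Q x)"
        using arg_cong[OF Q(3), of "\<lambda>p. poly p x"] g(3) by (simp add: eq_neg_iff_add_eq_0 add.commute)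
      \<comment> \<open>If \<open>r\<close> vanished at \<open>x\<close>, minimality of
        \<open>g\<close> would give \<open>r = 0\<close>. Then \<open>Q\<close> would be a nonzero
        polynomial with root \<open>x\<close> of degree below that of \<open>g\<close>.\<close>
      have rx: "poly r x \<noteq> 0"
      proof
        assume rx0: "poly r x = 0"
        have "r = 0"
        proof (rule ccontr)
          assume "r \<noteq> 0"
          then have "degree g \<le> degree r" using min Q(2) rx0 by blast
          then show False using Q(4) \<open>r \<noteq> 0\<close> less.prems(3) by simp
        qed
        then have pQ: "smult (lead_coeff p ^ m) g = p * Q" using Q(3) by simp
        have nz: "smult (lead_coeff p ^ m) g \<noteq> 0" using g(2) p0 by simp
        then have "Q \<noteq> 0" unfolding pQ by auto
        moreover have "poly Q x = 0" using ev rx0 less.prems(2) by simp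
        ultimately have "degree g \<le> degree Q" using min Q(1) by blast
        moreover have "degree g = degree p + degree Q"
          using arg_cong[OF pQ, of degree] p0 \<open>Q \<noteq> 0\<close> by (simp add: degree_mult_eq)
        ultimately show False using False by simp
      qed
      then have "r \<noteq> 0" by auto
      then have "degree r < degree p" using Q(4) by simp
      from less.hyps[OF this Q(2) rx] less.prems(3) this obtain y a where
        y: "y \<in> polys A" "a \<in> A" "a \<noteq> 0" "poly r x * poly y x = a" by auto
      have "poly p x * poly (0 - Q * y) x = a" using y(4) unfolding ev by (simp add: mult.assoc)
      moreover have "0 - Q * y \<in> polys A" using Q y by (intro S.polys_diff S.polys_mult S.polys_0)
      ultimately show ?thesis using y(2,3) by blast
    qed
  qed
  \<comment> \<open>A general \<open>p\<close> is first reduced modulo \<open>g\<close>; at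
    \<open>x\<close> this only multiplies its value by a nonzero power of the leading
    coefficient.\<close>
  obtain m Q r where Q: "Q \<in> polys A" "r \<in> polys A" "smult (lead_coeff g ^ m) p = g * Q + r"
    "r = 0 \<or> degree r < degree g" using S.pseudo_division[OF g(1,2) p(1)] by blast
  have ev: "poly r x = lead_coeff g ^ m * poly p x"
    using arg_cong[OF Q(3), of "\<lambda>p. poly p x"] g(3) by simp
  then have rx: "poly r x \<noteq> 0" using g(2) p(2) by simp
  then have "degree r < degree g" using Q(4) by auto
  from small[OF Q(2) rx this] obtain y a where
    y: "y \<in> polys A" "a \<in> A" "a \<noteq> 0" "poly r x * poly y x = a" by blast
  have "lead_coeff g \<in> A" using g(1) unfolding polys_def by blast
  then have "smult (lead_coeff g ^ m) y \<in> polys A" using y(1) by (intro S.polys_smult S.power_A)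
  moreover have "poly p x * poly (smult (lead_coeff g ^ m) y) x = a" using y(4) unfolding ev by (simp add: algebra_simps)
  ultimately show ?thesis using y(2,3) by blast
qed

text \<open>If \<open>x\<close> is transcendental over \<open>A\<close>, a relation that makes
  \<open>b\<close> invertible can be imposed freely. If \<open>x\<close> is algebraic,
  \<open>b\<close> divides some \<open>a\<close> in \<open>A\<close>, and it suffices to make
  \<open>a\<close> and the leading coefficient of a minimal relation invertible.\<close>

lemma good_ideal_adjoin:
  fixes A :: "'k::field set"
  assumes A: "type_subring A"
    and IH: "\<And>b. b \<in> A \<Longrightarrow> b \<noteq> 0 \<Longrightarrow> \<exists>I. good_ideal A I b"
    and b: "b \<in> adjoin A x" "b \<noteq> 0"
  shows "\<exists>I. good_ideal (adjoin A x) I b"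
proof -
  interpret type_subring A by (rule A)
  interpret S: type_ideal A A by (rule self_ideal)
  obtain p where p: "b = poly p x" "p \<in> polys A" using b(1) unfolding adjoin_def by blast
  have const: "[:c:] \<in> polys A" if "c \<in> A" for c using S.polys_monom[OF that, of 0] by (simp add: monom_0)
  have inA: "coeff h i \<in> A" if "h \<in> polys A" for h i using that unfolding polys_def by blast
  show ?thesis
  proof (cases "\<exists>h\<in>polys A. h \<noteq> 0 \<and> poly h x = 0")
    case False
    \<comment> \<open>The relation \<open>1 + x p(x) = 0\<close> makes \<open>- x\<close> an inverse
      of \<open>b\<close>, and \<open>g\<close> has the same leading coefficient as
      \<open>p\<close>.\<close>
    define g where "g = pCons 1 p"
    have p0: "p \<noteq> 0" using p(1) b(2) by auto
    have g: "g \<in> polys A" "g \<noteq> 0" "degree g > 0" "lead_coeff g = lead_coeff p"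
      unfolding g_def using p p0 one by (auto intro: S.polys_pCons)
    obtain I where I: "good_ideal A I (lead_coeff p)" using IH inA[OF p(2)] p0 by (meson leading_coeff_0_iff)
    interpret I: type_ideal A I using I unfolding good_ideal_def by blast
    obtain T c' where T: "finite T" "\<And>a. a \<in> A \<Longrightarrow> \<exists>t\<in>T. a - t \<in> I"
      and c': "c' \<in> A" "lead_coeff g * c' - 1 \<in> I" and one_I: "1 \<notin> I"
      using I unfolding good_ideal_def g(4) by blast
    interpret J: type_ideal "adjoin A x" "I.extended g x" by (rule I.extended_ideal[OF g(1)])
    have "1 \<notin> I.extended g x"
    proof
      assume "1 \<in> I.extended g x"
      then obtain a r where a: "1 = poly (g * a + r) x" "a \<in> polys A" "r \<in> polys I" unfolding I.extended_def by blast
      have "r \<in> polys A" using a(3) I.sub unfolding polys_def by blast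
      then have "g * a + r - [:1:] \<in> polys A" using g a one by (intro S.polys_diff S.polys_add S.polys_mult const)
      moreover have "poly (g * a + r - [:1:]) x = 0" using a(1) by simp
      ultimately have "g * a + r - [:1:] = 0" using False by blast
      then have "1 = g * a + r" by (simp add: one_pCons)
      from I.no_unit_multiple_mod[OF g(1,3) c' a(2,3) this] show False using one_I by contradiction
    qed
    moreover have "b * (0 - x) - 1 \<in> I.extended g x"
    proof -
      have "b * (0 - x) - 1 = - poly g x" unfolding g_def p(1) by simp
      then show ?thesis using J.uminus_I[OF I.extended_root] by simp
    qed
    moreover have "0 - x \<in> adjoin A x" by (rule J.diff[OF adjoin_incl[OF S.zero_I] adjoin_self])
    moreover note I.extended_finite_index[OF g(1,2) c' T, of x] J.type_ideal_axioms
    ultimately have "good_ideal (adjoin A x) (I.extended g x) b"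
      unfolding good_ideal_def by (intro conjI bexI)
    then show ?thesis by (rule exI)
  next
    case True
    then obtain h where "h \<in> polys A \<and> h \<noteq> 0 \<and> poly h x = 0" by auto
    from ex_has_least_nat[of "\<lambda>h. h \<in> polys A \<and> h \<noteq> 0 \<and> poly h x = 0", OF this, of degree]
    obtain g where "g \<in> polys A \<and> g \<noteq> 0 \<and> poly g x = 0"
      "\<forall>h. h \<in> polys A \<and> h \<noteq> 0 \<and> poly h x = 0 \<longrightarrow> degree g \<le> degree h" by auto
    then have g: "g \<in> polys A" "g \<noteq> 0" "poly g x = 0"
      and min: "\<And>h. h \<in> polys A \<Longrightarrow> h \<noteq> 0 \<Longrightarrow> poly h x = 0 \<Longrightarrow> degree g \<le> degree h" by simp_all
    have dg: "degree g > 0"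
    proof (rule ccontr)
      assume "\<not> degree g > 0"
      then obtain a where "g = [:a:]" by (auto elim: degree_eq_zeroE)
      then show False using g by simp
    qed
    define c where "c = lead_coeff g"
    have c: "c \<in> A" "c \<noteq> 0" unfolding c_def using g inA by auto
    obtain y a where y: "y \<in> polys A" "a \<in> A" "a \<noteq> 0" "b * poly y x = a"
      using minimal_polynomial_multiple[OF A g min p(2)] b(2) unfolding p(1) by blast
    obtain I where I: "good_ideal A I (c * a)" using IH[of "c * a"] c y mult by auto
    interpret I: type_ideal A I using I unfolding good_ideal_def by blast
    obtain T z where T: "finite T" "\<And>a. a \<in> A \<Longrightarrow> \<exists>t\<in>T. a - t \<in> I"
      and z: "z \<in> A" "c * a * z - 1 \<in> I" and one_I: "1 \<notin> I"
      using I unfolding good_ideal_def by blast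
    have c': "a * z \<in> A" "lead_coeff g * (a * z) - 1 \<in> I"
      using z y mult unfolding c_def by (auto simp: mult.assoc)
    interpret J: type_ideal "adjoin A x" "I.extended g x" by (rule I.extended_ideal[OF g(1)])
    have "1 \<notin> I.extended g x"
    proof
      assume "1 \<in> I.extended g x"
      then obtain q r where r: "1 = poly (g * q + r) x" "r \<in> polys I" unfolding I.extended_def by blast
      \<comment> \<open>Since \<open>g\<close> vanishes at \<open>x\<close>, the value of
        \<open>r\<close> there is \<open>1\<close>. By minimality of \<open>g\<close> its
        pseudo-remainder \<open>s\<close> must be the constant \<open>c ^ m\<close>. As the
        coefficients of \<open>s\<close> lie in \<open>I\<close>, this would put a unit modulo
        \<open>I\<close> into \<open>I\<close>.\<close>
      obtain m Q s where Q: "Q \<in> polys I" "s \<in> polys I" "smult (lead_coeff g ^ m) r = g * Q + s"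
        "s = 0 \<or> degree s < degree g" using I.pseudo_division[OF g(1,2) r(2)] by blast
      have sx: "poly s x = c ^ m" using arg_cong[OF Q(3), of "\<lambda>p. poly p x"] r(1) g(3) unfolding c_def by simp
      define h where "h = s - [:c ^ m:]"
      have "s \<in> polys A" using Q(2) I.sub unfolding polys_def by blast
      then have h: "h \<in> polys A" "poly h x = 0" unfolding h_def using sx c by (auto intro!: S.polys_diff const S.power_A)
      have "degree h < degree g"
        unfolding h_def using Q(4) dg by (intro degree_diff_less) auto
      then have "h = 0" using min[OF h(1) _ h(2)] by fastforce
      then have "s = [:c ^ m:]" unfolding h_def by simp
      then have "c ^ m * 1 \<in> I" using Q(2) unfolding polys_def by (auto dest: spec[of _ 0])
      moreover have "c * (a * z) - 1 \<in> I" using c'(2) unfolding c_def .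
      ultimately have "1 \<in> I" by (intro I.one_if_invertible_multiple[OF c(1) c'(1) _ one])
      then show False using one_I by contradiction
    qed
    moreover have "b * (poly y x * (c * z)) - 1 \<in> I.extended g x"
    proof -
      have "b * (poly y x * (c * z)) - 1 = c * a * z - 1" unfolding y(4)[symmetric] by (simp add: algebra_simps)
      then show ?thesis using I.extended_incl[OF z(2)] by (simp only:)
    qed
    moreover have "poly y x * (c * z) \<in> adjoin A x"
    proof (rule J.mult)
      show "poly y x \<in> adjoin A x" using y(1) unfolding adjoin_def by (rule imageI)
      show "c * z \<in> adjoin A x" by (intro adjoin_incl mult c(1) z(1))
    qed
    moreover note I.extended_finite_index[OF g(1,2) c' T, of x] J.type_ideal_axioms
    ultimately have "good_ideal (adjoin A x) (I.extended g x) b"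
      unfolding good_ideal_def by (intro conjI bexI)
    then show ?thesis by (rule exI)
  qed
qed

lemma ring_gen_empty: "(ring_gen {} :: 'k::comm_ring_1 set) = range of_int"
proof
  show "ring_gen {} \<subseteq> (range of_int :: 'k set)"
  proof
    fix y :: 'k assume "y \<in> ring_gen {}"
    then show "y \<in> range of_int"
    proof induction
      case one
      show ?case by (rule range_eqI[of _ _ 1]) simp
    next
      case (diff a b)
      then obtain i j where "a = of_int i" "b = of_int j" by blast
      then show ?case by (intro range_eqI[of _ _ "i - j"]) simp
    next
      case (mult a b)
      then obtain i j where "a = of_int i" "b = of_int j" by blast
      then show ?case by (intro range_eqI[of _ _ "i * j"]) simp
    qed simp
  qed
  interpret type_subring "ring_gen {} :: 'k set" by (rule type_subring_ring_gen)
  interpret S: type_ideal "ring_gen {} :: 'k set" "ring_gen {}" by (rule self_ideal)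
  have nat: "of_nat m \<in> (ring_gen {} :: 'k set)" for m
    by (induction m) (auto intro: S.zero_I S.add_I one)
  show "(range of_int :: 'k set) \<subseteq> ring_gen {}"
  proof
    fix y :: 'k assume "y \<in> range of_int"
    then obtain i where i: "y = of_int i" by blast
    show "y \<in> ring_gen {}"
    proof (cases i)
      case (nonneg m)
      then show ?thesis using nat[of m] i by simp
    next
      case (neg m)
      then have "y = - of_nat (Suc m)" using i by (simp only: of_int_minus of_int_of_nat_eq)
      then show ?thesis using S.uminus_I[OF nat[of "Suc m"]] by (simp only:)
    qed
  qed
qed

text \<open>Characteristic \<open>0\<close> makes this ring a copy of the integers, where a prime
  exceeding the absolute value of a nonzero \<open>m\<close> does not divide it.\<close>

lemma good_ideal_ring_gen_empty:
  fixes b :: "'k::comm_ring_1"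
  assumes char: "CHAR('k) = 0" and b: "b \<in> ring_gen {}" "b \<noteq> 0"
  shows "\<exists>I. good_ideal (ring_gen {}) I b"
proof -
  have inj: "(of_int i :: 'k) = of_int j \<longleftrightarrow> i = j" for i j
  proof -
    have "(of_int i :: 'k) = of_int j \<longleftrightarrow> (of_int (i - j) :: 'k) = 0" by simp
    also have "\<dots> \<longleftrightarrow> i = j" using of_int_eq_0_iff_char_dvd[where ?'a = 'k, of "i - j"] char by simp
    finally show ?thesis .
  qed
  obtain m where m: "b = of_int m" using b(1) unfolding ring_gen_empty by blast
  have m0: "m \<noteq> 0" using m b(2) by auto
  obtain p :: nat where p: "Factorial_Ring.prime p" "nat \<bar>m\<bar> < p" using bigger_prime by blast
  define I :: "'k set" where "I = (\<lambda>j. of_int (int p * j)) ` UNIV"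
  have in_I: "of_int i \<in> I \<longleftrightarrow> int p dvd i" for i unfolding I_def image_iff inj dvd_def by simp
  have "type_ideal (ring_gen {}) I"
  proof -
    interpret type_subring "ring_gen {} :: 'k set" by (rule type_subring_ring_gen)
    show ?thesis
    proof unfold_locales
      show "I \<subseteq> ring_gen {}" unfolding ring_gen_empty I_def by blast
      show "0 \<in> I" using in_I[of 0] by simp
      show "a - b \<in> I" if ab: "a \<in> I" "b \<in> I" for a b
      proof -
        obtain i j where "a = of_int (int p * i)" "b = of_int (int p * j)" using ab unfolding I_def by blast
        then show ?thesis using in_I[of "int p * i - int p * j"] by simp
      qed
      show "a * b \<in> I" if ab: "a \<in> ring_gen {}" "b \<in> I" for a b
      proof -
        obtain i j where "a = of_int i" "b = of_int (int p * j)" using ab unfolding I_def ring_gen_empty by blast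
        then show ?thesis using in_I[of "i * (int p * j)"] by simp
      qed
    qed
  qed
  moreover have "1 \<notin> I" using in_I[of 1] prime_gt_1_nat[OF p(1)] by simp
  moreover have "\<exists>T. finite T \<and> (\<forall>a\<in>ring_gen {}. \<exists>t\<in>T. a - t \<in> I)"
  proof (intro exI conjI ballI)
    show "finite (of_int ` {0..<int p} :: 'k set)" by simp
    fix a :: 'k assume "a \<in> ring_gen {}"
    then obtain i where i: "a = of_int i" unfolding ring_gen_empty by blast
    have "a - of_int (i mod int p) \<in> I"
      using in_I[of "i - i mod int p"] unfolding i by (simp add: dvd_minus_mod)
    moreover have "i mod int p \<in> {0..<int p}" using prime_gt_0_nat[OF p(1)] by simp
    ultimately show "\<exists>t\<in>of_int ` {0..<int p}. a - t \<in> I" by blast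
  qed
  moreover have "\<exists>y\<in>ring_gen {}. b * y - 1 \<in> I"
  proof -
    have "\<not> int p dvd m"
    proof
      assume "int p dvd m"
      then have "\<bar>int p\<bar> \<le> \<bar>m\<bar>" using m0 by (rule dvd_imp_le_int[rotated])
      then show False using p(2) by linarith
    qed
    moreover have "Factorial_Ring.prime (int p)" using p(1) by simp
    ultimately have "coprime m (int p)" using prime_imp_coprime[of "int p" m] by (simp add: coprime_commute)
    then obtain y where "[m * y = 1] (mod int p)" using cong_solve_coprime_int by blast
    then have "int p dvd m * y - 1" by (simp add: cong_iff_dvd_diff)
    then have "b * of_int y - 1 \<in> I" using in_I[of "m * y - 1"] unfolding m by simp
    then show ?thesis unfolding ring_gen_empty by blast
  qed
  ultimately show ?thesis unfolding good_ideal_def by blast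
qed

lemma exists_good_ideal:
  fixes b :: "'k::field"
  assumes "finite U" and char: "CHAR('k) = 0" and b: "b \<in> ring_gen U" "b \<noteq> 0"
  shows "\<exists>I. good_ideal (ring_gen U) I b"
  using assms(1) b
proof (induction U arbitrary: b rule: finite_induct)
  case empty
  then show ?case using good_ideal_ring_gen_empty[OF char] by blast
next
  case (insert x U)
  show ?case
    unfolding ring_gen_insert
    by (rule good_ideal_adjoin[OF type_subring_ring_gen insert.IH]) (use insert.prems in \<open>auto simp: ring_gen_insert\<close>)
qed

section \<open>Word values in linear groups\<close>

lemma pow_mat_add:
  fixes A :: "'k::semiring_1 mat"
  assumes A: "A \<in> carrier_mat n n"
  shows "A ^\<^sub>m (a + b) = A ^\<^sub>m a * A ^\<^sub>m b"
proof (induction b)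
  case (Suc b)
  have "A ^\<^sub>m (a + Suc b) = A ^\<^sub>m a * A ^\<^sub>m b * A" by (simp add: Suc)
  also have "\<dots> = A ^\<^sub>m a * (A ^\<^sub>m b * A)"
    by (rule assoc_mult_mat[OF pow_carrier_mat[OF A] pow_carrier_mat[OF A] A])
  finally show ?case by simp
next
  case 0
  have "A ^\<^sub>m a * 1\<^sub>m n = A ^\<^sub>m a" by (rule right_mult_one_mat[OF pow_carrier_mat[OF A]])
  then show ?case using A by simp
qed

lemma pow_mat_pow:
  fixes A :: "'k::semiring_1 mat"
  assumes A: "A \<in> carrier_mat n n"
  shows "(A ^\<^sub>m a) ^\<^sub>m b = A ^\<^sub>m (a * b)"
proof (induction b)
  case (Suc b)
  have "A ^\<^sub>m (a * Suc b) = A ^\<^sub>m (a * b + a)" by (simp add: add.commute)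
  also have "\<dots> = A ^\<^sub>m (a * b) * A ^\<^sub>m a" by (rule pow_mat_add[OF A])
  finally show ?case by (simp add: Suc)
qed (use A in simp)

lemma finite_image_factor:
  assumes "finite (f ` S)" "\<And>x y. x \<in> S \<Longrightarrow> y \<in> S \<Longrightarrow> f x = f y \<Longrightarrow> g x = g y"
  shows "finite (g ` S)"
proof -
  define k where "k y = g (SOME x. x \<in> S \<and> f x = y)" for y
  have "g x = k (f x)" if "x \<in> S" for x
  proof -
    have "(SOME u. u \<in> S \<and> f u = f x) \<in> S \<and> f (SOME u. u \<in> S \<and> f u = f x) = f x"
      by (rule someI[of _ x]) (use that in auto)
    then show ?thesis unfolding k_def using assms(2) that by metis
  qed
  then have "g ` S \<subseteq> k ` f ` S" by auto
  then show ?thesis using assms(1) by (meson finite_imageI finite_subset)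
qed

lemma (in group) finite_rcosets_if_determined:
  assumes C: "subgroup C G" and fin: "finite (f ` carrier G)"
    and det: "\<And>x y. x \<in> carrier G \<Longrightarrow> y \<in> carrier G \<Longrightarrow> f x = f y \<Longrightarrow> x \<otimes> inv y \<in> C"
  shows "finite (rcosets C)"
proof -
  have "finite ((\<lambda>x. C #> x) ` carrier G)"
  proof (rule finite_image_factor[OF fin])
    fix x y assume xy: "x \<in> carrier G" "y \<in> carrier G" "f x = f y"
    have "x \<in> C #> y"
      using det[OF xy] subgroup.rcos_module[OF C group_axioms xy(2,1)] by simp
    then show "C #> x = C #> y" using repr_independence[OF _ xy(2) C] by simp
  qed
  moreover have "rcosets C = (\<lambda>x. C #> x) ` carrier G" by (auto simp: RCOSETS_def)
  ultimately show ?thesis by simp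
qed

lemma (in group) rcos_eq_imp_diff:
  assumes C: "subgroup C G" and x: "x \<in> carrier G" and y: "y \<in> carrier G" and eq: "C #> x = C #> y"
  shows "x \<otimes> inv y \<in> C"
proof -
  have "x \<in> C #> y" using rcos_self[OF x C] eq by simp
  then show ?thesis using subgroup.rcos_module[OF C group_axioms y x] by simp
qed

text \<open>A coset of \<open>C\<close> is determined by the coset of \<open>N\<close> together with
  the permutation induced on \<open>V\<close> by conjugation, and there are finitely many such
  pairs.\<close>

lemma (in group) finite_index_inter_centralizer:
  assumes N: "N \<lhd> G" and finN: "finite (rcosets N)" and V: "finite V" "V \<subseteq> carrier G"
    and conj: "\<And>x v. x \<in> carrier G \<Longrightarrow> v \<in> V \<Longrightarrow> x \<otimes> v \<otimes> inv x \<in> V"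
  defines "C \<equiv> {c \<in> N. \<forall>v\<in>V. c \<otimes> v = v \<otimes> c}"
  shows "C \<lhd> G" and "finite (rcosets C)"
proof -
  interpret N: normal N G by (rule N)
  have Vc: "\<And>v. v \<in> V \<Longrightarrow> v \<in> carrier G" using V by blast
  have Nc: "\<And>c. c \<in> N \<Longrightarrow> c \<in> carrier G" using N.subset by blast
  have conj': "inv x \<otimes> v \<otimes> x \<in> V" if "x \<in> carrier G" "v \<in> V" for x v
    using conj[of "inv x" v] that by simp
  have inv_comm: "inv c \<otimes> v = v \<otimes> inv c" if "c \<in> carrier G" "v \<in> carrier G" "c \<otimes> v = v \<otimes> c" for c v
  proof -
    have "inv c \<otimes> v = inv c \<otimes> (v \<otimes> c) \<otimes> inv c" using that(1,2) by (simp add: m_assoc)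
    also have "\<dots> = v \<otimes> inv c" unfolding that(3)[symmetric] using that(1,2) by simp
    finally show ?thesis .
  qed
  have sub: "subgroup C G"
  proof (rule subgroupI)
    show "C \<subseteq> carrier G" unfolding C_def using Nc by auto
    have "\<one> \<in> C" unfolding C_def using Vc by auto
    then show "C \<noteq> {}" by blast
    show "inv c \<in> C" if "c \<in> C" for c
      using that inv_comm Nc Vc unfolding C_def by auto
    show "c \<otimes> d \<in> C" if cd: "c \<in> C" "d \<in> C" for c d
    proof -
      have "c \<otimes> d \<otimes> v = v \<otimes> (c \<otimes> d)" if v: "v \<in> V" for v
      proof -
        have car: "c \<in> carrier G" "d \<in> carrier G" "v \<in> carrier G" using cd v Nc Vc unfolding C_def by auto
        have e: "c \<otimes> v = v \<otimes> c" "d \<otimes> v = v \<otimes> d" using cd v unfolding C_def by auto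
        have "c \<otimes> d \<otimes> v = c \<otimes> v \<otimes> d" using car e(2) by (simp add: m_assoc)
        also have "\<dots> = v \<otimes> (c \<otimes> d)" unfolding e(1) using car by (simp add: m_assoc)
        finally show ?thesis .
      qed
      then show ?thesis using cd unfolding C_def by auto
    qed
  qed
  show "C \<lhd> G"
  proof (subst normal_inv_iff, intro conjI ballI sub)
    fix x c assume x: "x \<in> carrier G" and c: "c \<in> C"
    have cc: "c \<in> N" "c \<in> carrier G" using c Nc unfolding C_def by auto
    have "x \<otimes> c \<otimes> inv x \<otimes> v = v \<otimes> (x \<otimes> c \<otimes> inv x)" if v: "v \<in> V" for v
    proof -
      have "c \<otimes> (inv x \<otimes> v \<otimes> x) = (inv x \<otimes> v \<otimes> x) \<otimes> c" using c conj'[OF x v] unfolding C_def by auto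
      then have "x \<otimes> (c \<otimes> (inv x \<otimes> v \<otimes> x)) \<otimes> inv x = x \<otimes> ((inv x \<otimes> v \<otimes> x) \<otimes> c) \<otimes> inv x" by simp
      then show ?thesis using x cc Vc[OF v] by (simp add: m_assoc)
    qed
    then show "x \<otimes> c \<otimes> inv x \<in> C" using N.inv_op_closed2[OF x cc(1)] unfolding C_def by auto
  qed
  define f where "f x = (N #> x, restrict (\<lambda>v. inv x \<otimes> v \<otimes> x) V)" for x
  have "f ` carrier G \<subseteq> (rcosets N) \<times> (V \<rightarrow>\<^sub>E V)"
    unfolding f_def using conj' by (auto simp: RCOSETS_def)
  then have "finite (f ` carrier G)" using finN V by (meson finite_PiE finite_SigmaI finite_subset)
  then show "finite (rcosets C)"
  proof (rule finite_rcosets_if_determined[OF sub])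
    fix x y assume x: "x \<in> carrier G" and y: "y \<in> carrier G" and eq: "f x = f y"
    have "N #> x = N #> y" using eq unfolding f_def by simp
    then have 1: "x \<otimes> inv y \<in> N" by (rule rcos_eq_imp_diff[OF N.subgroup_axioms x y])
    have "x \<otimes> inv y \<otimes> v = v \<otimes> (x \<otimes> inv y)" if v: "v \<in> V" for v
    proof -
      have "restrict (\<lambda>v. inv x \<otimes> v \<otimes> x) V v = restrict (\<lambda>v. inv y \<otimes> v \<otimes> y) V v"
        using eq unfolding f_def by simp
      then have "inv x \<otimes> v \<otimes> x = inv y \<otimes> v \<otimes> y" using v by simp
      then have "x \<otimes> (inv x \<otimes> v \<otimes> x) \<otimes> inv y = x \<otimes> (inv y \<otimes> v \<otimes> y) \<otimes> inv y" by simp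
      then show ?thesis using x y Vc[OF v] by (simp add: m_assoc)
    qed
    then show "x \<otimes> inv y \<in> C" unfolding C_def using 1 by auto
  qed
qed

text \<open>A faithful representation by matrices; their invertibility follows from multiplicativity
  and \<open>h_one\<close>.\<close>

locale matrix_group = group G for G :: "('a, 'c) monoid_scheme" (structure) +
  fixes h :: "'a \<Rightarrow> 'k::field mat" and n :: nat
  assumes h_carrier [simp]: "x \<in> carrier G \<Longrightarrow> h x \<in> carrier_mat n n"
    and h_mult: "x \<in> carrier G \<Longrightarrow> y \<in> carrier G \<Longrightarrow> h (x \<otimes> y) = h x * h y"
    and h_one: "h \<one> = 1\<^sub>m n"
    and h_inj: "inj_on h (carrier G)"
begin

lemma h_pow: "x \<in> carrier G \<Longrightarrow> h (x [^] (m::nat)) = h x ^\<^sub>m m"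
proof (induction m)
  case 0
  then have "dim_row (h x) = n" using h_carrier by blast
  then show ?case by (simp add: h_one)
qed (simp add: h_mult)

lemma eq_one_if_h_one: "x \<in> carrier G \<Longrightarrow> h x = 1\<^sub>m n \<Longrightarrow> x = \<one>"
  using h_inj h_one by (metis inj_onD one_closed)

text \<open>The determinant of the action on the eigenspace is a character of \<open>C\<close> with
  values in a field, hence trivial on \<open>derived G C\<close>. At \<open>z [^] q\<close> it
  equals \<open>e ^ (q * d)\<close> with \<open>d\<close> the dimension, and \<open>fact n\<close>
  is a multiple of every possible \<open>d\<close>.\<close>

lemma eigenvalue_of_central_commutator:
  assumes C: "subgroup C G" and z: "z \<in> carrier G" and comm: "\<And>c. c \<in> C \<Longrightarrow> c \<otimes> z = z \<otimes> c"
    and der: "z [^] (q::nat) \<in> derived G C" and e: "eigenvalue (h z) e"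
  shows "e ^ (q * fact n) = 1"
proof -
  have Cc: "\<And>c. c \<in> C \<Longrightarrow> c \<in> carrier G" using C subgroup.subset by blast
  have dC: "derived G C \<subseteq> C" by (rule derived_incl[OF subset_refl C])
  obtain d B L where d: "0 < d" "d \<le> n" and fr: "eigen_frame (h z) e n d B L"
    and all: "\<And>v. v \<in> carrier_vec n \<Longrightarrow> h z *\<^sub>v v = e \<cdot>\<^sub>v v \<Longrightarrow> B *\<^sub>v (L *\<^sub>v v) = v"
    using eigenspace_frame[OF h_carrier[OF z] e] by blast
  have B: "B \<in> carrier_mat n d" and LB: "L * B = 1\<^sub>m d" using fr unfolding eigen_frame_def by auto
  define \<chi> where "\<chi> c = det (L * (h c * B))" for c
  have \<chi>_mult: "\<chi> (a \<otimes> b) = \<chi> a * \<chi> b" if a: "a \<in> C" and b: "b \<in> C" for a b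
  proof -
    have c: "h z * h b = h b * h z" using comm[OF b] h_mult[OF z Cc[OF b]] h_mult[OF Cc[OF b] z] by simp
    show ?thesis unfolding \<chi>_def h_mult[OF Cc[OF a] Cc[OF b]]
      by (rule eigenspace_det_hom[OF h_carrier[OF z] fr all h_carrier[OF Cc[OF a]] h_carrier[OF Cc[OF b]] c])
  qed
  have \<chi>_one: "\<chi> \<one> = 1" unfolding \<chi>_def h_one left_mult_one_mat[OF B] LB by simp
  have \<chi>_inv: "\<chi> a * \<chi> (inv a) = 1" if "a \<in> C" for a
    using \<chi>_mult[OF that subgroup.m_inv_closed[OF C that]] Cc[OF that] \<chi>_one by simp
  have "\<chi> y = 1" if "y \<in> derived G C" for y
    using that unfolding derived_def
  proof induction
    case one
    then show ?case by (rule \<chi>_one)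
  next
    case comm: (incl y)
    then obtain a b where ab: "a \<in> C" "b \<in> C" "y = a \<otimes> b \<otimes> inv a \<otimes> inv b" by blast
    have i: "inv a \<in> C" "inv b \<in> C" using ab subgroup.m_inv_closed[OF C] by auto
    have "\<chi> y = (\<chi> a * \<chi> (inv a)) * (\<chi> b * \<chi> (inv b))"
      unfolding ab(3) using ab i by (simp add: \<chi>_mult subgroup.m_closed[OF C] mult_ac)
    then show ?case using \<chi>_inv ab by simp
  next
    case (inv y)
    then obtain a b where ab: "a \<in> C" "b \<in> C" "y = a \<otimes> b \<otimes> inv a \<otimes> inv b" by blast
    have i: "inv a \<in> C" "inv b \<in> C" using ab subgroup.m_inv_closed[OF C] by auto
    have "inv y = b \<otimes> a \<otimes> inv b \<otimes> inv a" unfolding ab(3) using ab Cc by (simp add: inv_mult_group m_assoc)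
    then have "\<chi> (inv y) = (\<chi> a * \<chi> (inv a)) * (\<chi> b * \<chi> (inv b))"
      using ab i by (simp add: \<chi>_mult subgroup.m_closed[OF C] mult_ac)
    then show ?case using \<chi>_inv ab by simp
  next
    case (eng u v)
    then have "u \<in> C" "v \<in> C" using dC unfolding derived_def by auto
    then show ?case using eng.IH \<chi>_mult by simp
  qed
  then have "\<chi> (z [^] q) = 1" using der by blast
  then have ed: "e ^ (q * d) = 1"
    unfolding \<chi>_def h_pow[OF z] eigen_frame_pow[OF h_carrier[OF z] fr] .
  have "d dvd fact n" using d by (intro dvd_fact) auto
  then obtain r where "fact n = d * r" by blast
  then have "e ^ (q * fact n) = (e ^ (q * d)) ^ r" by (simp add: power_mult[symmetric] mult.assoc)
  then show ?thesis using ed by simp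
qed

end

text \<open>In characteristic \<open>p\<close> the Frobenius identity gives
  \<open>(1 + V)^(p^j) = 1 + V^(p^j)\<close>. As \<open>n \<le> p ^ n\<close>, the nilpotent part
  disappears for \<open>j = n\<close>.\<close>

lemma (in matrix_group) unipotent_torsion_positive_char:
  assumes p: "CHAR('k) > 0" and z: "z \<in> carrier G" and m: "m > 0"
    and nil: "(h z ^\<^sub>m m - 1\<^sub>m n) ^\<^sub>m n = 0\<^sub>m n n"
  shows "\<exists>e>0. z [^] (e::nat) = \<one>"
proof -
  define p where "p = CHAR('k)"
  have pp: "Factorial_Ring.prime p" unfolding p_def using CHAR_prime assms(1) prime_CHAR_semidom by blast
  define V where "V = h z ^\<^sub>m m - 1\<^sub>m n"
  have hz: "h z ^\<^sub>m m \<in> carrier_mat n n" using z by simp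
  have V: "V \<in> carrier_mat n n" unfolding V_def using hz by (intro minus_carrier_mat) auto
  have hzV: "h z ^\<^sub>m m = 1\<^sub>m n + V" unfolding V_def using hz by (intro eq_matI) auto
  have frob: "(1\<^sub>m n + W) ^\<^sub>m p = 1\<^sub>m n + W ^\<^sub>m p" if W: "W \<in> carrier_mat n n" for W :: "'k mat"
  proof (rule eq_matI)
    have car: "(1\<^sub>m n + W) ^\<^sub>m p \<in> carrier_mat n n" "W ^\<^sub>m p \<in> carrier_mat n n" using W by auto
    fix i j assume "i < dim_row (1\<^sub>m n + W ^\<^sub>m p)" "j < dim_col (1\<^sub>m n + W ^\<^sub>m p)"
    then have ij: "i < n" "j < n" using car by auto
    have z: "of_nat (p choose l) * (W ^\<^sub>m l) $$ (i, j) = 0" if "l \<in> {..p} - {0, p}" for l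
    proof -
      have "p dvd (p choose l)" using that using pp by (intro dvd_choose_prime) auto
      then have "(of_nat (p choose l) :: 'k) = 0" unfolding p_def by (simp add: of_nat_eq_0_iff_char_dvd)
      then show ?thesis by simp
    qed
    have "((1\<^sub>m n + W) ^\<^sub>m p) $$ (i, j) = (\<Sum>l\<le>p. of_nat (p choose l) * (W ^\<^sub>m l) $$ (i, j))"
      by (rule pow_mat_binomial[OF W ij])
    also have "\<dots> = (\<Sum>l\<in>{0, p}. of_nat (p choose l) * (W ^\<^sub>m l) $$ (i, j))"
      using z by (intro sum.mono_neutral_right) auto
    also have "\<dots> = (1\<^sub>m n + W ^\<^sub>m p) $$ (i, j)"
      using prime_gt_0_nat[OF pp] ij W car by simp
    finally show "((1\<^sub>m n + W) ^\<^sub>m p) $$ (i, j) = (1\<^sub>m n + W ^\<^sub>m p) $$ (i, j)" .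
  qed (use W in auto)
  have frobj: "(1\<^sub>m n + V) ^\<^sub>m (p ^ j) = 1\<^sub>m n + V ^\<^sub>m (p ^ j)" for j
  proof (induction j)
    case (Suc j)
    have U: "1\<^sub>m n + V \<in> carrier_mat n n" using V by simp
    have "(1\<^sub>m n + V) ^\<^sub>m (p ^ Suc j) = ((1\<^sub>m n + V) ^\<^sub>m (p ^ j)) ^\<^sub>m p"
      unfolding pow_mat_pow[OF U] by (simp add: mult.commute)
    also have "\<dots> = 1\<^sub>m n + (V ^\<^sub>m (p ^ j)) ^\<^sub>m p" unfolding Suc using V by (intro frob) simp
    also have "\<dots> = 1\<^sub>m n + V ^\<^sub>m (p ^ Suc j)" unfolding pow_mat_pow[OF V] by (simp add: mult.commute)
    finally show ?case .
  qed (use V in simp)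
  have "n \<le> p ^ n" using prime_gt_1_nat[OF pp] by (simp add: less_imp_le less_exp)
  then obtain r where r: "p ^ n = n + r" using le_Suc_ex by blast
  have "V ^\<^sub>m (p ^ n) = 0\<^sub>m n n"
    unfolding r pow_mat_add[OF V] using nil unfolding V_def[symmetric]
    using V by (simp add: left_mult_zero_mat[OF pow_carrier_mat])
  then have "(h z ^\<^sub>m m) ^\<^sub>m (p ^ n) = 1\<^sub>m n" unfolding hzV frobj by simp
  then have "h (z [^] (m * p ^ n)) = 1\<^sub>m n"
    unfolding h_pow[OF z] pow_mat_pow[OF h_carrier[OF z]] .
  then have "z [^] (m * p ^ n) = \<one>" using z by (intro eq_one_if_h_one) auto
  moreover have "m * p ^ n > 0" using m prime_gt_0_nat[OF pp] by simp
  ultimately show ?thesis by blast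
qed

lemma (in type_ideal) of_nat_mult_I: "a \<in> I \<Longrightarrow> of_nat m * a \<in> I"
  by (induction m) (auto simp: algebra_simps zero_I add_I)

lemma (in type_subring) of_nat_in: "of_nat m \<in> A"
  using type_ideal.of_nat_mult_I[OF self_ideal one, of m] by simp

text \<open>Here \<open>m\<close> is the characteristic of the finite quotient ring. A prime up to
  \<open>Q\<close> is a unit there, so it could be cancelled from \<open>m\<close>, contradicting
  minimality.\<close>

lemma good_ideal_additive_order:
  assumes I: "good_ideal A I (a * of_nat (fact Q))" and a: "a \<in> A"
  shows "\<exists>m>0. of_nat m \<in> I \<and> (\<forall>p. Factorial_Ring.prime (p::nat) \<longrightarrow> p dvd m \<longrightarrow> Q < p)"
proof -
  interpret type_ideal A I using I unfolding good_ideal_def by blast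
  obtain T y where T: "finite T" "\<And>a. a \<in> A \<Longrightarrow> \<exists>t\<in>T. a - t \<in> I"
    and y: "y \<in> A" "a * of_nat (fact Q) * y - 1 \<in> I" and one_I: "1 \<notin> I"
    using I unfolding good_ideal_def by blast
  have "\<forall>m. \<exists>t. t \<in> T \<and> of_nat m - t \<in> I" using T(2) of_nat_in by blast
  from choice[OF this] obtain t where t: "\<And>m. t m \<in> T \<and> of_nat m - t m \<in> I" by blast
  \<comment> \<open>Two different natural numbers share a representative in the finite set
    \<open>T\<close>, and so their difference lies in \<open>I\<close>.\<close>
  have "\<not> inj_on t UNIV"
    using t T(1) by (meson finite_subset image_subsetI infinite_UNIV_nat finite_imageD)
  then obtain i j where ij: "t i = t j" "i < j" unfolding inj_on_def by (metis nat_neq_iff)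
  have "(of_nat j - t j) - (of_nat i - t i) \<in> I" by (rule diff_I) (use t in auto)
  then have "of_nat (j - i) \<in> I" using ij by (simp add: of_nat_diff)
  then have ex: "\<exists>m. m > 0 \<and> of_nat m \<in> I" using ij(2) by (intro exI[of _ "j - i"]) auto
  define m where "m = (LEAST m. m > 0 \<and> of_nat m \<in> I)"
  have m: "m > 0" "of_nat m \<in> I" using LeastI_ex[OF ex] unfolding m_def by auto
  have least: "m \<le> m'" if "m' > 0" "of_nat m' \<in> I" for m' unfolding m_def using that by (intro Least_le) auto
  have "Q < p" if p: "Factorial_Ring.prime p" "p dvd m" for p
  proof (rule ccontr)
    assume "\<not> Q < p"
    then have "p dvd fact Q" using prime_gt_0_nat[OF p(1)] by (intro dvd_fact) auto
    then obtain s where s: "fact Q = p * s" by blast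
    obtain r where r: "m = p * r" using p(2) by blast
    have r0: "r > 0" "r < m" using m(1) prime_gt_1_nat[OF p(1)] unfolding r by auto
    \<comment> \<open>With \<open>m = p * r\<close> and \<open>fact Q = p * s\<close>, the product
      \<open>r * fact Q\<close> equals \<open>s * m\<close>, which is zero modulo
      \<open>I\<close>.\<close>
    have "of_nat r * (a * of_nat (fact Q) * y) = of_nat s * (a * (y * of_nat m))"
      unfolding s r by (simp add: algebra_simps)
    also have "\<dots> \<in> I" using a y m by (intro of_nat_mult_I mult_I)
    finally have "of_nat r * (a * of_nat (fact Q) * y) - of_nat r * (a * of_nat (fact Q) * y - 1) \<in> I"
      by (rule diff_I[OF _ of_nat_mult_I[OF y(2)]])
    then have "of_nat r \<in> I" by (simp add: algebra_simps)
    then show False using least[OF r0(1)] r0(2) by simp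
  qed
  then show ?thesis using m by blast
qed

lemma coprime_if_prime_factors_large:
  fixes m l :: nat
  assumes "\<And>p. Factorial_Ring.prime p \<Longrightarrow> p dvd m \<Longrightarrow> Q < p" "0 < l" "l \<le> Q"
  shows "coprime m l"
proof (rule ccontr)
  assume "\<not> coprime m l"
  then have "gcd m l \<noteq> 1" by (simp add: coprime_iff_gcd_eq_1)
  then obtain p where p: "Factorial_Ring.prime p" "p dvd gcd m l" using prime_factor_nat by blast
  then have "Q < p" using assms(1) by simp
  moreover have "p \<le> l" using p(2) assms(2) by (intro dvd_imp_le) auto
  ultimately show False using assms(3) by simp
qed

section \<open>Congruence subgroups and characteristic 0\<close>

context matrix_group begin

lemma h_inv: "x \<in> carrier G \<Longrightarrow> h x * h (inv x) = 1\<^sub>m n" "x \<in> carrier G \<Longrightarrow> h (inv x) * h x = 1\<^sub>m n"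
  using h_mult[of x "inv x"] h_mult[of "inv x" x] by (auto simp: h_one)

definition entries :: "'a set \<Rightarrow> 'k set" where
  "entries S = {h x $$ (i, j) | x i j. x \<in> S \<and> i < n \<and> j < n}"

text \<open>The entries of inverse generators are included among the ring generators because the
  ring need not contain inverses of determinants.\<close>

lemma generate_entries:
  assumes S: "S \<subseteq> carrier G" and x: "x \<in> generate G S" and ij: "i < n" "j < n"
  shows "h x $$ (i, j) \<in> ring_gen (entries (S \<union> (\<lambda>s. inv s) ` S))"
proof -
  define R where "R = ring_gen (entries (S \<union> (\<lambda>s. inv s) ` S))"
  interpret R: type_subring R unfolding R_def by (rule type_subring_ring_gen)
  interpret RI: type_ideal R R by (rule R.self_ideal)
  have "\<forall>i<n. \<forall>j<n. h x $$ (i, j) \<in> R"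
    using x
  proof induction
    case one
    then show ?case using R.one RI.zero_I by (auto simp: h_one)
  next
    case (incl s)
    then show ?case unfolding R_def entries_def by (auto intro!: ring_gen.incl)
  next
    case (inv s)
    then show ?case unfolding R_def entries_def by (auto intro!: ring_gen.incl)
  next
    case (eng u v)
    have c: "u \<in> carrier G" "v \<in> carrier G" using eng generate_in_carrier[OF S] by auto
    show ?case
    proof (intro allI impI)
      fix i j assume ij: "i < n" "j < n"
      have "h (u \<otimes> v) $$ (i, j) = (\<Sum>r<n. h u $$ (i, r) * h v $$ (r, j))"
        unfolding h_mult[OF c] by (rule index_mult_mat_sum[OF h_carrier[OF c(1)] h_carrier[OF c(2)] ij])
      also have "\<dots> \<in> R" using eng.IH ij by (intro RI.sum_I R.mult) auto
      finally show "h (u \<otimes> v) $$ (i, j) \<in> R" .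
    qed
  qed
  then show ?thesis using ij unfolding R_def by blast
qed

definition congruence_subgroup :: "'a set \<Rightarrow> 'k set \<Rightarrow> 'a set" where
  "congruence_subgroup S I = {x \<in> S. \<forall>i<n. \<forall>j<n. (h x - 1\<^sub>m n) $$ (i, j) \<in> I}"

text \<open>Entrywise congruence modulo \<open>I\<close> survives multiplication on either side by
  elements of \<open>S\<close>, whose entries lie in \<open>R\<close>. The index is finite because
  there are finitely many matrices of residues.\<close>

lemma congruence_subgroup_normal:
  assumes S: "subgroup S G" and R: "type_ideal R I"
    and ent: "\<And>x i j. x \<in> S \<Longrightarrow> i < n \<Longrightarrow> j < n \<Longrightarrow> h x $$ (i, j) \<in> R"
    and T: "finite T" "\<And>a. a \<in> R \<Longrightarrow> \<exists>t\<in>T. a - t \<in> I"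
  shows "congruence_subgroup S I \<lhd> (G\<lparr>carrier := S\<rparr>)"
    and "finite (rcosets\<^bsub>G\<lparr>carrier := S\<rparr>\<^esub> (congruence_subgroup S I))"
proof -
  interpret type_ideal R I by (rule R)
  interpret S: subgroup S G by (rule S)
  define K where "K = congruence_subgroup S I"
  define GS where "GS = G\<lparr>carrier := S\<rparr>"
  interpret GS: group GS unfolding GS_def using S by (rule subgroup_imp_group)
  have cong: "x \<otimes> inv y \<in> K" if x: "x \<in> S" and y: "y \<in> S"
    and xy: "\<And>i j. i < n \<Longrightarrow> j < n \<Longrightarrow> h x $$ (i, j) - h y $$ (i, j) \<in> I" for x y
  proof -
    have c: "x \<in> carrier G" "inv y \<in> carrier G" "y \<in> carrier G" using x y by auto
    have "(h (x \<otimes> inv y) - 1\<^sub>m n) $$ (i, j) \<in> I" if ij: "i < n" "j < n" for i j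
    proof -
      have "(h (x \<otimes> inv y) - 1\<^sub>m n) $$ (i, j) = (h x * h (inv y)) $$ (i, j) - (h y * h (inv y)) $$ (i, j)"
        unfolding h_inv(1)[OF c(3)] using h_mult[OF c(1,2)] ij by simp
      also have "\<dots> = (\<Sum>r<n. h (inv y) $$ (r, j) * (h x $$ (i, r) - h y $$ (i, r)))"
        unfolding index_mult_mat_sum[OF h_carrier[OF c(1)] h_carrier[OF c(2)] ij]
          index_mult_mat_sum[OF h_carrier[OF c(3)] h_carrier[OF c(2)] ij]
        by (simp add: sum_subtractf algebra_simps)
      also have "\<dots> \<in> I" using ij y xy ent by (intro sum_I mult_I) auto
      finally show ?thesis .
    qed
    then show ?thesis unfolding K_def congruence_subgroup_def using x y by auto
  qed
  have K_iff: "x \<in> K \<longleftrightarrow> (\<forall>i<n. \<forall>j<n. h x $$ (i, j) - h \<one> $$ (i, j) \<in> I)" if "x \<in> S" for x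
    using that h_carrier[of x] unfolding K_def congruence_subgroup_def h_one by auto
  have diff: "h (a \<otimes> x \<otimes> b) $$ (i, j) - h (a \<otimes> y \<otimes> b) $$ (i, j) \<in> I"
    if "a \<in> S" "b \<in> S" "x \<in> S" "y \<in> S" "i < n" "j < n"
      and xy: "\<And>i j. i < n \<Longrightarrow> j < n \<Longrightarrow> h x $$ (i, j) - h y $$ (i, j) \<in> I" for a b x y i j
  proof -
    have e: "h (a \<otimes> x \<otimes> b) $$ (i, j) = (\<Sum>r<n. (\<Sum>l<n. h a $$ (i, l) * h x $$ (l, r)) * h b $$ (r, j))"
      if "x \<in> S" for x
    proof -
      have c: "a \<in> carrier G" "b \<in> carrier G" "x \<in> carrier G" using \<open>a \<in> S\<close> \<open>b \<in> S\<close> that by auto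
      have "h (a \<otimes> x \<otimes> b) $$ (i, j) = (\<Sum>r<n. h (a \<otimes> x) $$ (i, r) * h b $$ (r, j))"
        unfolding h_mult[OF m_closed[OF c(1,3)] c(2)]
        by (rule index_mult_mat_sum[OF h_carrier[OF m_closed[OF c(1,3)]] h_carrier[OF c(2)] \<open>i < n\<close> \<open>j < n\<close>])
      also have "\<dots> = (\<Sum>r<n. (\<Sum>l<n. h a $$ (i, l) * h x $$ (l, r)) * h b $$ (r, j))"
        unfolding h_mult[OF c(1,3)]
        by (intro sum.cong refl arg_cong2[where f = "(*)"] index_mult_mat_sum[OF h_carrier[OF c(1)] h_carrier[OF c(3)] \<open>i < n\<close>]) simp
      finally show ?thesis .
    qed
    have "h (a \<otimes> x \<otimes> b) $$ (i, j) - h (a \<otimes> y \<otimes> b) $$ (i, j) =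
        (\<Sum>r<n. h b $$ (r, j) * (\<Sum>l<n. h a $$ (i, l) * (h x $$ (l, r) - h y $$ (l, r))))"
      unfolding e[OF \<open>x \<in> S\<close>] e[OF \<open>y \<in> S\<close>]
      by (simp add: sum_subtractf algebra_simps)
    also have "\<dots> \<in> I" using that ent by (intro sum_I mult_I) auto
    finally show ?thesis .
  qed
  have sub: "subgroup K G"
  proof (rule subgroupI)
    show "K \<subseteq> carrier G" unfolding K_def congruence_subgroup_def by auto
    have "\<one> \<in> K" using K_iff[of \<one>] zero_I by auto
    then show "K \<noteq> {}" by blast
    have KS: "K \<subseteq> S" unfolding K_def congruence_subgroup_def by auto
    show inv: "inv x \<in> K" if x: "x \<in> K" for x
    proof -
      have "\<one> \<otimes> inv x \<in> K"
      proof (rule cong)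
        show "h \<one> $$ (i, j) - h x $$ (i, j) \<in> I" if "i < n" "j < n" for i j
          using uminus_I[of "h x $$ (i, j) - h \<one> $$ (i, j)"] K_iff[of x] x KS that by auto
      qed (use x KS in auto)
      then show ?thesis using x KS by auto
    qed
    show "x \<otimes> y \<in> K" if x: "x \<in> K" and y: "y \<in> K" for x y
    proof -
      have c: "x \<in> S" "y \<in> S" "inv y \<in> S" using x y KS by auto
      have "x \<otimes> inv (inv y) \<in> K"
      proof (rule cong)
        fix i j assume ij: "i < n" "j < n"
        have "(h x $$ (i, j) - h \<one> $$ (i, j)) - (h (inv y) $$ (i, j) - h \<one> $$ (i, j)) \<in> I"
          by (rule diff_I) (use K_iff[of x] K_iff[of "inv y"] x inv[OF y] c ij in auto)
        then show "h x $$ (i, j) - h (inv y) $$ (i, j) \<in> I" by simp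
      qed (use c in auto)
      then show ?thesis using c by simp
    qed
  qed
  have KS: "K \<subseteq> S" unfolding K_def congruence_subgroup_def by auto
  have "K \<lhd> GS"
  proof (subst GS.normal_inv_iff, intro conjI ballI)
    show "subgroup K GS" unfolding GS_def by (rule subgroup_incl[OF sub S KS])
    fix x k assume "x \<in> carrier GS" and k: "k \<in> K"
    then have x: "x \<in> S" unfolding GS_def by simp
    have "h (x \<otimes> k \<otimes> inv x) $$ (i, j) - h (x \<otimes> \<one> \<otimes> inv x) $$ (i, j) \<in> I" if "i < n" "j < n" for i j
      using x k KS K_iff[of k] that by (intro diff) auto
    then have "x \<otimes> k \<otimes> inv x \<in> K" using x k KS by (subst K_iff) auto
    then show "x \<otimes>\<^bsub>GS\<^esub> k \<otimes>\<^bsub>GS\<^esub> inv\<^bsub>GS\<^esub> x \<in> K" unfolding GS_def using m_inv_consistent[OF S x] by simp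
  qed
  then show "congruence_subgroup S I \<lhd> (G\<lparr>carrier := S\<rparr>)" unfolding GS_def K_def .
  have "\<forall>a\<in>R. \<exists>t. t \<in> T \<and> a - t \<in> I" using T(2) by blast
  from bchoice[OF this] obtain t where t: "\<And>a. a \<in> R \<Longrightarrow> t a \<in> T \<and> a - t a \<in> I" by auto
  define f where "f x = (\<lambda>i\<in>{..<n}. \<lambda>j\<in>{..<n}. t (h x $$ (i, j)))" for x
  have "f ` carrier GS \<subseteq> {..<n} \<rightarrow>\<^sub>E ({..<n} \<rightarrow>\<^sub>E T)"
  proof (rule image_subsetI)
    fix x assume "x \<in> carrier GS"
    then show "f x \<in> {..<n} \<rightarrow>\<^sub>E ({..<n} \<rightarrow>\<^sub>E T)"
      unfolding f_def GS_def using t ent by (intro restrict_PiE_iff[THEN iffD2] ballI) auto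
  qed
  then have fin: "finite (f ` carrier GS)" by (rule finite_subset) (intro finite_PiE T(1) finite_lessThan)
  have "subgroup K GS" unfolding GS_def by (rule subgroup_incl[OF sub S KS])
  then have "finite (rcosets\<^bsub>GS\<^esub> K)" using fin
  proof (rule GS.finite_rcosets_if_determined)
    fix x y assume "x \<in> carrier GS" "y \<in> carrier GS" and f: "f x = f y"
    then have xy: "x \<in> S" "y \<in> S" unfolding GS_def by auto
    have "h x $$ (i, j) - h y $$ (i, j) \<in> I" if ij: "i < n" "j < n" for i j
    proof -
      have e: "t (h x $$ (i, j)) = t (h y $$ (i, j))" using fun_cong[OF fun_cong[OF f, of i], of j] ij unfolding f_def by simp
      have "(h x $$ (i, j) - t (h x $$ (i, j))) - (h y $$ (i, j) - t (h y $$ (i, j))) \<in> I"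
        by (rule diff_I) (use t ent xy ij in auto)
      then show ?thesis unfolding e by simp
    qed
    from cong[OF xy this] show "x \<otimes>\<^bsub>GS\<^esub> inv\<^bsub>GS\<^esub> y \<in> K"
      unfolding GS_def using m_inv_consistent[OF S xy(2)] by simp
  qed
  then show "finite (rcosets\<^bsub>G\<lparr>carrier := S\<rparr>\<^esub> (congruence_subgroup S I))" unfolding GS_def K_def .
qed

text \<open>
  Suppose that the unipotent power \<open>u\<close> of the word value \<open>z\<close> is not \<open>1\<close>. Choose a finite quotient
  of the ring of entries in which a nonzero entry of \<open>u - 1\<close> and all primes up to the dimension
  and the index of \<open>N\<close> are invertible, and let \<open>m\<close> be its characteristic. The binomial formula
  shows that \<open>u\<^sup>m = 1\<close> in the congruence quotient, although the order of \<open>z\<close> there is prime to \<open>m\<close>.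
\<close>

lemma word_value_torsion_char_0:
  assumes char: "CHAR('k) = 0" and N: "N \<lhd> G" and finN: "finite (rcosets N)"
    and w: "fst ` set w \<subseteq> {..<k}" and g: "g \<in> {..<k} \<rightarrow> carrier G"
    and const: "\<And>g'. g' \<in> {..<k} \<rightarrow> carrier G \<Longrightarrow> (\<forall>i<k. \<exists>c\<in>N. g' i = c \<otimes> g i) \<Longrightarrow>
      word_map G w g' = word_map G w g"
    and nil: "(h (word_map G w g) ^\<^sub>m M - 1\<^sub>m n) ^\<^sub>m n = 0\<^sub>m n n"
  shows "word_map G w g [^] M = \<one>"
proof (rule ccontr)
  define z u where "z = word_map G w g" and "u = z [^] M"
  assume "word_map G w g [^] M \<noteq> \<one>"
  then have u1: "u \<noteq> \<one>" unfolding u_def z_def .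
  interpret N: normal N G by (rule N)
  \<comment> \<open>Passing to the subgroup generated by the arguments makes the ring of entries
    finitely generated.\<close>
  define S0 S where "S0 = g ` {..<k}" and "S = generate G S0"
  have S0: "S0 \<subseteq> carrier G" unfolding S0_def using g by auto
  have S: "subgroup S G" unfolding S_def by (rule generate_is_subgroup[OF S0])
  interpret S: subgroup S G by (rule S)
  define H where "H = G\<lparr>carrier := S\<rparr>"
  interpret H: group H unfolding H_def using S by (rule subgroup_imp_group)
  have gS: "g \<in> {..<k} \<rightarrow> S" unfolding S_def S0_def by (auto intro: generate.incl)
  have z: "z \<in> S" unfolding z_def by (rule word_map_in_subgroup[OF S w gS])
  have u: "u \<in> S" unfolding u_def using z by (induction M) auto
  have zc: "z \<in> carrier G" and uc: "u \<in> carrier G" using z u by auto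
  define V where "V = h u - 1\<^sub>m n"
  have V: "V \<in> carrier_mat n n" unfolding V_def using uc by (intro minus_carrier_mat) auto
  have Vn: "V ^\<^sub>m n = 0\<^sub>m n n" using nil unfolding V_def u_def z_def[symmetric] h_pow[OF zc] .
  have huV: "h u = 1\<^sub>m n + V" unfolding V_def using h_carrier[OF uc] by (intro eq_matI) auto
  have "\<exists>i<n. \<exists>j<n. V $$ (i, j) \<noteq> 0"
  proof (rule ccontr)
    assume "\<not> ?thesis"
    then have "h u = 1\<^sub>m n" unfolding huV using V by (intro eq_matI) auto
    then show False using u1 eq_one_if_h_one[OF uc] by simp
  qed
  then obtain i0 j0 where ij0: "i0 < n" "j0 < n" "V $$ (i0, j0) \<noteq> 0" by blast
  define U where "U = entries (S0 \<union> (\<lambda>s. inv s) ` S0)"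
  have "U = (\<lambda>(x, i, j). h x $$ (i, j)) ` ((S0 \<union> (\<lambda>s. inv s) ` S0) \<times> {..<n} \<times> {..<n})"
    unfolding U_def entries_def by force
  then have finU: "finite U" unfolding S0_def by simp
  interpret R: type_subring "ring_gen U" by (rule type_subring_ring_gen)
  interpret RI: type_ideal "ring_gen U" "ring_gen U" by (rule R.self_ideal)
  have ent: "h x $$ (i, j) \<in> ring_gen U" if "x \<in> S" "i < n" "j < n" for x i j
    using generate_entries[OF S0 _ that(2,3)] that(1) unfolding U_def S_def by blast
  have V_ent: "V $$ (i, j) \<in> ring_gen U" if "i < n" "j < n" for i j
    unfolding V_def using that ent[OF u that] uc RI.zero_I R.one by (auto intro!: R.diff)
  define N0 where "N0 = N \<inter> S"
  have N0: "N0 \<lhd> H"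
  proof (subst H.normal_inv_iff, intro conjI ballI)
    show "subgroup N0 H"
      unfolding H_def N0_def by (rule subgroup_incl[OF subgroups_Inter_pair[OF N.subgroup_axioms S] S]) auto
    fix x c assume "x \<in> carrier H" "c \<in> N0"
    then show "x \<otimes>\<^bsub>H\<^esub> c \<otimes>\<^bsub>H\<^esub> inv\<^bsub>H\<^esub> x \<in> N0"
      unfolding H_def N0_def using m_inv_consistent[OF S] N.inv_op_closed2 by auto
  qed
  have finN0: "finite (rcosets\<^bsub>H\<^esub> N0)"
  proof (rule H.finite_rcosets_if_determined[where f = "\<lambda>x. N #> x"])
    show "subgroup N0 H" using N0 normal_imp_subgroup by blast
    show "finite ((\<lambda>x. N #> x) ` carrier H)"
      using finN by (rule rev_finite_subset) (simp add: H_def RCOSETS_def, use S.subset in blast)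
    fix x y assume xy: "x \<in> carrier H" "y \<in> carrier H" "N #> x = N #> y"
    then show "x \<otimes>\<^bsub>H\<^esub> inv\<^bsub>H\<^esub> y \<in> N0"
      using rcos_eq_imp_diff[OF N.subgroup_axioms, of x y] m_inv_consistent[OF S, of y]
      unfolding H_def N0_def by auto
  qed
  \<comment> \<open>Primes above \<open>Q\<close> exceed both the index of \<open>N0\<close>, as
    needed to exclude them from the order of \<open>z\<close>, and the size \<open>n\<close>, as
    needed for the binomial coefficients.\<close>
  define Q where "Q = max (card (rcosets\<^bsub>H\<^esub> N0)) n"
  define a where "a = V $$ (i0, j0)"
  have a: "a \<in> ring_gen U" "a \<noteq> 0" unfolding a_def using V_ent ij0 by auto
  have "of_nat (fact Q) \<noteq> (0 :: 'k)" using char by (simp add: of_nat_eq_0_iff_char_dvd)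
  then have "a * of_nat (fact Q) \<noteq> 0" using a by simp
  then obtain I where I: "good_ideal (ring_gen U) I (a * of_nat (fact Q))"
    using exists_good_ideal[OF finU char R.mult[OF a(1) R.of_nat_in]] by blast
  interpret I: type_ideal "ring_gen U" I using I unfolding good_ideal_def by blast
  obtain T y where T: "finite T" "\<And>a. a \<in> ring_gen U \<Longrightarrow> \<exists>t\<in>T. a - t \<in> I"
    and y: "y \<in> ring_gen U" "a * of_nat (fact Q) * y - 1 \<in> I" and one_I: "1 \<notin> I"
    using I unfolding good_ideal_def by blast
  obtain m where m: "m > 0" "of_nat m \<in> I" "\<And>p. Factorial_Ring.prime (p::nat) \<Longrightarrow> p dvd m \<Longrightarrow> Q < p"
    using good_ideal_additive_order[OF I a(1)] by blast
  define K where "K = congruence_subgroup S I"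
  have K: "K \<lhd> H" "finite (rcosets\<^bsub>H\<^esub> K)"
    unfolding K_def H_def using congruence_subgroup_normal[OF S I.type_ideal_axioms ent T] by auto
  interpret K: normal K H by (rule K(1))
  have umK: "u [^] m \<in> K"
  proof -
    have "(h (u [^] m) - 1\<^sub>m n) $$ (i, j) \<in> I" if ij: "i < n" "j < n" for i j
    proof -
      have V_pow: "(V ^\<^sub>m l) $$ (i, j) \<in> ring_gen U" if "j < n" for l j
        using that
      proof (induction l arbitrary: j)
        case 0
        then show ?case using V ij RI.zero_I R.one by auto
      next
        case (Suc l)
        have "(V ^\<^sub>m Suc l) $$ (i, j) = (\<Sum>r<n. (V ^\<^sub>m l) $$ (i, r) * V $$ (r, j))"
          using index_mult_mat_sum[OF pow_carrier_mat[OF V] V ij(1) Suc.prems] by simp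
        also have "\<dots> \<in> ring_gen U" by (rule RI.sum_I, rule R.mult) (use Suc V_ent in auto)
        finally show ?case .
      qed
      have "(h (u [^] m) - 1\<^sub>m n) $$ (i, j) = ((1\<^sub>m n + V) ^\<^sub>m m) $$ (i, j) - 1\<^sub>m n $$ (i, j)"
        unfolding h_pow[OF uc] huV using ij by simp
      also have "((1\<^sub>m n + V) ^\<^sub>m m) $$ (i, j) = (\<Sum>l\<le>m. of_nat (m choose l) * (V ^\<^sub>m l) $$ (i, j))"
        by (rule pow_mat_binomial[OF V ij])
      also have "\<dots> = 1\<^sub>m n $$ (i, j) + (\<Sum>l\<in>{..m} - {0}. of_nat (m choose l) * (V ^\<^sub>m l) $$ (i, j))"
        using V by (subst sum.remove[of _ 0]) auto
      finally have "(h (u [^] m) - 1\<^sub>m n) $$ (i, j) = (\<Sum>l\<in>{..m} - {0}. of_nat (m choose l) * (V ^\<^sub>m l) $$ (i, j))"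
        by simp
      also have "\<dots> \<in> I"
      proof (rule I.sum_I)
        fix l assume l: "l \<in> {..m} - {0}"
        show "of_nat (m choose l) * (V ^\<^sub>m l) $$ (i, j) \<in> I"
        \<comment> \<open>For \<open>n \<le> l\<close> nilpotency gives zero. For
          \<open>0 < l < n\<close> all prime factors of \<open>m\<close> exceed \<open>l\<close>, so
          \<open>m\<close> divides \<open>m choose l\<close> because it divides \<open>l\<close>
          times that.\<close>
        proof (cases "n \<le> l")
          case True
          then obtain r where r: "l = n + r" using le_Suc_ex by blast
          have "V ^\<^sub>m l = 0\<^sub>m n n"
            unfolding r pow_mat_add[OF V] Vn by (rule left_mult_zero_mat[OF pow_carrier_mat[OF V]])
          then show ?thesis using ij I.zero_I by simp
        next
          case False
          then have "coprime m l" using l m(3) by (intro coprime_if_prime_factors_large[of m Q]) (auto simp: Q_def)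
          moreover have "m dvd l * (m choose l)"
          proof -
            obtain l' m' where "l = Suc l'" "m = Suc m'" using l m(1) by (cases l; cases m) auto
            then show ?thesis using Suc_times_binomial_eq[of m' l'] by (metis dvd_triv_left mult.commute)
          qed
          ultimately have "m dvd (m choose l)" by (simp add: coprime_dvd_mult_right_iff)
          then obtain r where "m choose l = m * r" by blast
          then have "of_nat (m choose l) * (V ^\<^sub>m l) $$ (i, j) = of_nat r * ((V ^\<^sub>m l) $$ (i, j) * of_nat m)"
            by (simp add: mult_ac)
          also have "\<dots> \<in> I" by (rule I.of_nat_mult_I[OF I.mult_I[OF V_pow[OF ij(2)] m(2)]])
          finally show ?thesis .
        qed
      qed
      finally show ?thesis .
    qed
    moreover have "u [^] m \<in> S" using u by (induction m) auto
    ultimately show ?thesis unfolding K_def congruence_subgroup_def by blast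
  qed
  define D q where "D = H Mod K" and "q = (\<lambda>x. K #>\<^bsub>H\<^esub> x)"
  interpret q: group_hom H D q unfolding D_def q_def by (rule K.r_coset_surj_hom)
  have ker: "q x = \<one>\<^bsub>D\<^esub> \<longleftrightarrow> x \<in> K" if "x \<in> S" for x
    using that K.rcos_const H.rcos_self[OF _ K.subgroup_axioms, of x]
    unfolding q_def D_def FactGroup_def H_def by auto
  have zH: "z \<in> carrier H" using z unfolding H_def by simp
  have powS: "z [^] e \<in> S" for e :: nat using z by (induction e) auto
  have qpow: "q z [^]\<^bsub>D\<^esub> e = \<one>\<^bsub>D\<^esub> \<longleftrightarrow> z [^] e \<in> K" for e :: nat
  proof -
    have "q (z [^] e) = q z [^]\<^bsub>D\<^esub> e"
      using q.hom_nat_pow[OF zH, of e] unfolding H_def by (simp add: nat_pow_consistent[symmetric])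
    then show ?thesis using ker[OF powS, of e] by simp
  qed
  define oz where "oz = q.H.ord (q z)"
  have o_iff: "oz dvd e \<longleftrightarrow> z [^] e \<in> K" for e
    using q.H.pow_eq_id[of "q z" e] q.hom_closed[OF zH] qpow unfolding oz_def by simp
  have oMm: "oz dvd M * m" using umK zc unfolding o_iff u_def by (simp add: nat_pow_pow)
  \<comment> \<open>A common prime of \<open>oz\<close> and \<open>m\<close> would be larger than
    the index of \<open>N0\<close>. For such a prime some power of \<open>z\<close> with exponent
    prime to it lies in \<open>K\<close>.\<close>
  have "coprime oz m"
  proof (rule ccontr)
    assume "\<not> coprime oz m"
    then have "gcd oz m \<noteq> 1" by (simp add: coprime_iff_gcd_eq_1)
    then obtain p where p: "Factorial_Ring.prime p" "p dvd gcd oz m" using prime_factor_nat by blast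
    then have "Q < p" using m(3) by simp
    then have "card (rcosets\<^bsub>H\<^esub> N0) < p" unfolding Q_def by simp
    moreover have wm: "word_map H w g' = word_map G w g'" if "g' \<in> {..<k} \<rightarrow> S" for g'
      unfolding H_def by (rule word_map_subgroup_structure[OF group_axioms S w that])
    moreover have "word_map H w g' = word_map H w g"
      if "g' \<in> {..<k} \<rightarrow> carrier H" "\<forall>i<k. \<exists>n\<in>N0. g' i = n \<otimes>\<^bsub>H\<^esub> g i" for g'
    proof -
      have "g' \<in> {..<k} \<rightarrow> S" using that(1) unfolding H_def by simp
      moreover have "word_map G w g' = word_map G w g"
        by (rule const) (use that S.mem_carrier in \<open>auto simp: H_def N0_def Pi_iff\<close>)
      ultimately show ?thesis using wm gS by simp
    qed
    moreover have "g \<in> {..<k} \<rightarrow> carrier H" using gS unfolding H_def by simp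
    ultimately obtain s where s: "\<not> p dvd s" "word_map H w g [^]\<^bsub>H\<^esub> s \<in> K"
      using H.word_value_pow_coprime_mod[OF N0 finN0 K p(1) _ w] by metis
    have "z [^]\<^bsub>H\<^esub> s \<in> K" using s(2) unfolding wm[OF gS] z_def[symmetric] .
    then have "z [^] s \<in> K" unfolding H_def by (simp add: nat_pow_consistent[symmetric])
    then have "oz dvd s" using o_iff by simp
    then have "p dvd s" using p(2) by (meson dvd_trans gcd_dvd1)
    then show False using s(1) by simp
  qed
  \<comment> \<open>Since \<open>oz\<close> divides \<open>M * m\<close>, the power \<open>u\<close>
    of \<open>z\<close> is already trivial modulo \<open>K\<close>. Then \<open>a\<close> lies in
    \<open>I\<close>, although it is a unit modulo \<open>I\<close>.\<close>
  then have "oz dvd M" using oMm by (simp add: coprime_dvd_mult_left_iff)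
  then have "u \<in> K" unfolding u_def using o_iff by simp
  then have "a \<in> I" unfolding a_def V_def K_def congruence_subgroup_def using ij0 by blast
  then have "(of_nat (fact Q) * y) * a \<in> I" using y R.of_nat_in by (intro I.mult_I R.mult)
  then have "(of_nat (fact Q) * y) * a - (a * of_nat (fact Q) * y - 1) \<in> I" using y(2) by (rule I.diff_I)
  then show False using one_I by (simp add: algebra_simps)
qed

end

text \<open>The centralizer \<open>C\<close> of all values inside \<open>N\<close> serves two
  purposes. It commutes with each value and so preserves its eigenspaces, and being contained in
  \<open>N\<close> it inherits the constancy of the word on cosets.\<close>

lemma finite_generate_word_values:
  fixes h :: "'a \<Rightarrow> 'k::alg_closed_field mat"
  assumes "matrix_group G h n" and N: "N \<lhd> G" and finN: "finite (rcosets\<^bsub>G\<^esub> N)"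
    and w: "fst ` set w \<subseteq> {..<k}"
    and const: "\<And>g g'. g \<in> {..<k} \<rightarrow> carrier G \<Longrightarrow> g' \<in> {..<k} \<rightarrow> carrier G \<Longrightarrow>
      (\<forall>i<k. \<exists>c\<in>N. g' i = c \<otimes>\<^bsub>G\<^esub> g i) \<Longrightarrow> word_map G w g' = word_map G w g"
    and fin: "finite (word_values G k w)"
  shows "finite (generate G (word_values G k w))"
proof -
  interpret matrix_group G h n by fact
  interpret N: normal N G by (rule N)
  define V where "V = word_values G k w"
  have V_iff: "v \<in> V \<longleftrightarrow> (\<exists>g \<in> {..<k} \<rightarrow> carrier G. v = word_map G w g)" for v
  proof
    assume "v \<in> V"
    then show "\<exists>g \<in> {..<k} \<rightarrow> carrier G. v = word_map G w g"
      unfolding V_def word_values_def by (auto simp: PiE_def)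
  next
    assume "\<exists>g \<in> {..<k} \<rightarrow> carrier G. v = word_map G w g"
    then obtain g where g: "g \<in> {..<k} \<rightarrow> carrier G" "v = word_map G w g" by blast
    have "v = word_map G w (restrict g {..<k})" unfolding g(2) by (rule word_map_cong[OF w]) simp
    moreover have "restrict g {..<k} \<in> {..<k} \<rightarrow>\<^sub>E carrier G" using g by auto
    ultimately show "v \<in> V" unfolding V_def word_values_def by blast
  qed
  have Vc: "V \<subseteq> carrier G" using V_iff word_map_closed[OF group_axioms w] by auto
  have conj: "x \<otimes>\<^bsub>G\<^esub> v \<otimes>\<^bsub>G\<^esub> inv\<^bsub>G\<^esub> x \<in> V" if x: "x \<in> carrier G" and v: "v \<in> V" for x v
  proof -
    obtain g where g: "g \<in> {..<k} \<rightarrow> carrier G" "v = word_map G w g" using v V_iff by blast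
    have "(\<lambda>i. x \<otimes>\<^bsub>G\<^esub> g i \<otimes>\<^bsub>G\<^esub> inv\<^bsub>G\<^esub> x) \<in> {..<k} \<rightarrow> carrier G" using g x by auto
    then show ?thesis unfolding V_iff g(2) word_map_conj[OF w g(1) x] by blast
  qed
  have "\<exists>e>0. v [^]\<^bsub>G\<^esub> (e::nat) = \<one>\<^bsub>G\<^esub>" if v: "v \<in> V" for v
  proof -
    obtain g where g: "g \<in> {..<k} \<rightarrow> carrier G" "v = word_map G w g" using v V_iff by blast
    have vc: "v \<in> carrier G" using v Vc by blast
    define C where "C = {c \<in> N. \<forall>v\<in>V. c \<otimes>\<^bsub>G\<^esub> v = v \<otimes>\<^bsub>G\<^esub> c}"
    have C: "C \<lhd> G" "finite (rcosets\<^bsub>G\<^esub> C)"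
      unfolding C_def using finite_index_inter_centralizer[OF N finN _ Vc conj] fin unfolding V_def by auto
    have "\<exists>q>0. word_map G w g [^]\<^bsub>G\<^esub> (q::nat) \<in> derived G C"
    proof (rule word_value_pow_in_derived[OF C w g(1)])
      fix g' assume g': "g' \<in> {..<k} \<rightarrow> carrier G" "\<forall>i<k. \<exists>c\<in>C. g' i = c \<otimes>\<^bsub>G\<^esub> g i"
      show "word_map G w g' = word_map G w g"
        by (rule const[OF g(1) g'(1)]) (use g'(2) in \<open>auto simp: C_def\<close>)
    qed
    then obtain q :: nat where q: "q > 0" "v [^]\<^bsub>G\<^esub> q \<in> derived G C" unfolding g(2) by blast
    have subC: "subgroup C G" using C(1) normal_imp_subgroup by blast
    have ev: "e ^ (q * fact n) = 1" if "eigenvalue (h v) e" for e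
      by (rule eigenvalue_of_central_commutator[OF subC vc _ q(2) that]) (use v in \<open>auto simp: C_def\<close>)
    define M where "M = q * fact n"
    have M: "M > 0" unfolding M_def using q by simp
    have nil: "(h v ^\<^sub>m M - 1\<^sub>m n) ^\<^sub>m n = 0\<^sub>m n n"
      unfolding M_def by (rule unipotent_power[OF h_carrier[OF vc] ev])
    show ?thesis
    proof (cases "CHAR('k) = 0")
      case True
      have "v [^]\<^bsub>G\<^esub> M = \<one>\<^bsub>G\<^esub>" using nil unfolding g(2)
        by (rule word_value_torsion_char_0[OF True N finN w g(1) const[OF g(1)], rotated 2])
      then show ?thesis using M by blast
    next
      case False
      then show ?thesis using unipotent_torsion_positive_char[OF _ vc M nil] by simp
    qed
  qed
  then show ?thesis
    using finite_generate_normal_torsion[OF _ Vc conj] fin unfolding V_def by blast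
qed

section \<open>Stability of polynomial conditions\<close>

text \<open>Spanning functions are kept in a list so that induction on the dimension becomes
  induction on the list.\<close>

fun lin_span :: "('a \<Rightarrow> 'k::comm_ring_1) list \<Rightarrow> ('a \<Rightarrow> 'k) set" where
  "lin_span [] = {\<lambda>x. 0}"
| "lin_span (e # es) = {\<lambda>x. c * e x + f x | c f. f \<in> lin_span es}"

lemma lin_span_zero: "(\<lambda>x. 0) \<in> lin_span es"
proof (induction es)
  case (Cons e es)
  then show ?case by (auto intro!: exI[of _ 0] exI[of _ "\<lambda>x. 0"])
qed simp

lemma lin_span_ConsI: "f \<in> lin_span es \<Longrightarrow> f \<in> lin_span (e # es)"
  by (auto intro!: exI[of _ 0] exI[of _ f])

lemma lin_span_add:
  "f \<in> lin_span es \<Longrightarrow> g \<in> lin_span es \<Longrightarrow> (\<lambda>x. f x + g x) \<in> lin_span es"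
proof (induction es arbitrary: f g)
  case (Cons e es)
  obtain c f' where f: "f = (\<lambda>x. c * e x + f' x)" "f' \<in> lin_span es" using Cons.prems(1) by auto
  obtain d g' where g: "g = (\<lambda>x. d * e x + g' x)" "g' \<in> lin_span es" using Cons.prems(2) by auto
  have "(\<lambda>x. f x + g x) = (\<lambda>x. (c + d) * e x + (f' x + g' x))"
    unfolding f g by (simp add: algebra_simps)
  then show ?case using Cons.IH[OF f(2) g(2)] by auto
qed simp

lemma lin_span_smult: "f \<in> lin_span es \<Longrightarrow> (\<lambda>x. c * f x) \<in> lin_span es"
proof (induction es arbitrary: f)
  case (Cons e es)
  obtain d f' where f: "f = (\<lambda>x. d * e x + f' x)" "f' \<in> lin_span es" using Cons.prems(1) by auto
  have "(\<lambda>x. c * f x) = (\<lambda>x. (c * d) * e x + c * f' x)"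
    unfolding f by (simp add: algebra_simps)
  then show ?case using Cons.IH[OF f(2)] by auto
qed simp

lemma lin_span_diff:
  "f \<in> lin_span es \<Longrightarrow> g \<in> lin_span es \<Longrightarrow> (\<lambda>x. f x - g x) \<in> lin_span es"
  using lin_span_add[OF _ lin_span_smult[of g es "- 1"], of f] by simp

lemma lin_span_sum:
  "(\<And>i. i \<in> S \<Longrightarrow> f i \<in> lin_span es) \<Longrightarrow> (\<lambda>x. \<Sum>i\<in>S. f i x) \<in> lin_span es"
  by (induction S rule: infinite_finite_induct) (auto intro: lin_span_zero lin_span_add)

lemma lin_span_base: "e \<in> set es \<Longrightarrow> e \<in> lin_span es"
proof (induction es)
  case (Cons a es)
  show ?case
  proof (cases "e = a")
    case True
    show ?thesis unfolding lin_span.simps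
      by (intro CollectI exI[of _ 1] exI[of _ "\<lambda>x. 0"]) (use True lin_span_zero in auto)
  next
    case False
    then show ?thesis using Cons by (intro lin_span_ConsI) auto
  qed
qed simp

lemma lin_span_mult_right:
  assumes "\<And>e. e \<in> set es \<Longrightarrow> (\<lambda>x. e x * g x) \<in> lin_span es'" "f \<in> lin_span es"
  shows "(\<lambda>x. f x * g x) \<in> lin_span es'"
  using assms
proof (induction es arbitrary: f)
  case Nil
  then show ?case using lin_span_zero by simp
next
  case (Cons e es)
  obtain c f' where f: "f = (\<lambda>x. c * e x + f' x)" "f' \<in> lin_span es" using Cons.prems(2) by auto
  have "(\<lambda>x. f' x * g x) \<in> lin_span es'" using Cons.IH[OF _ f(2)] Cons.prems(1) by auto
  moreover have "(\<lambda>x. e x * g x) \<in> lin_span es'" using Cons.prems(1) by simp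
  ultimately have "(\<lambda>x. c * (e x * g x) + f' x * g x) \<in> lin_span es'" by (intro lin_span_add lin_span_smult)
  then show ?case unfolding f(1) by (simp add: algebra_simps)
qed

lemma lin_span_mult:
  assumes f: "f \<in> lin_span es" and g: "g \<in> lin_span es'"
  shows "(\<lambda>x. f x * g x) \<in> lin_span [\<lambda>x. e x * e' x. e \<leftarrow> es, e' \<leftarrow> es']" (is "_ \<in> lin_span ?ps")
proof (rule lin_span_mult_right[OF _ f])
  fix e assume e: "e \<in> set es"
  have "(\<lambda>x. g x * e x) \<in> lin_span ?ps"
  proof (rule lin_span_mult_right[OF _ g])
    fix e' assume e': "e' \<in> set es'"
    have "(\<lambda>x. e x * e' x) \<in> lin_span ?ps" by (rule lin_span_base) (use e e' in auto)
    then show "(\<lambda>x. e' x * e x) \<in> lin_span ?ps" by (simp add: mult.commute)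
  qed
  then show "(\<lambda>x. e x * g x) \<in> lin_span ?ps" by (simp add: mult.commute)
qed

text \<open>
  A finite-dimensional substitute for the Noetherian property of the Zariski topology. In the
  induction step, if some \<open>N \<subseteq> N\<^sub>0\<close> supports a linear relation involving the new function, then
  on \<open>N\<close> the new function is redundant, and \<open>N\<close> inherits the property from \<open>N\<^sub>0\<close>.
\<close>

lemma exists_member_vanishing_stable:
  fixes es :: "('a \<Rightarrow> 'k::field) list"
  assumes ne: "\<N> \<noteq> {}"
  shows "\<exists>N0\<in>\<N>. \<forall>N\<in>\<N>. N \<subseteq> N0 \<longrightarrow> (\<forall>f\<in>lin_span es. (\<forall>x\<in>N. f x = 0) \<longrightarrow> (\<forall>x\<in>N0. f x = 0))"
proof (induction es)
  case Nil
  then show ?case using ne by auto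
next
  case (Cons e es)
  then obtain N0 where N0: "N0 \<in> \<N>" and
    stable': "\<forall>N\<in>\<N>. N \<subseteq> N0 \<longrightarrow> (\<forall>f\<in>lin_span es. (\<forall>x\<in>N. f x = 0) \<longrightarrow> (\<forall>x\<in>N0. f x = 0))"
    by (elim bexE)
  have stable: "f x = 0" if "N \<in> \<N>" "N \<subseteq> N0" "f \<in> lin_span es" "\<forall>x\<in>N. f x = 0" "x \<in> N0" for N f x
    using stable' that by metis
  show ?case
  proof (cases "\<exists>N\<in>\<N>. N \<subseteq> N0 \<and> (\<exists>g\<in>lin_span es. \<forall>x\<in>N. e x = g x)")
    case True
    then obtain N1 g where N1: "N1 \<in> \<N>" "N1 \<subseteq> N0" and g: "g \<in> lin_span es" "\<forall>x\<in>N1. e x = g x" by (elim bexE conjE)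
    have "f x = 0" if N: "N \<in> \<N>" "N \<subseteq> N1" and f: "f \<in> lin_span (e # es)" "\<forall>x\<in>N. f x = 0" and x: "x \<in> N1" for N f x
    proof -
      obtain c f' where f': "f = (\<lambda>x. c * e x + f' x)" "f' \<in> lin_span es" using f(1) by auto
      define k where "k = (\<lambda>x. c * g x + f' x)"
      have k: "k \<in> lin_span es" unfolding k_def using g(1) f'(2) by (intro lin_span_add lin_span_smult)
      have fk: "f x = k x" if "x \<in> N1" for x unfolding f' k_def using g(2) that by simp
      have "k x = 0" if "x \<in> N" for x
        using fk[OF subsetD[OF N(2) that]] f(2) that by simp
      then have "\<forall>x\<in>N. k x = 0" by blast
      then have "k x = 0" by (rule stable[OF N(1) order_trans[OF N(2) N1(2)] k _ subsetD[OF N1(2) x]])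
      then show ?thesis using fk[OF x] by simp
    qed
    then show ?thesis by (intro bexI[OF _ N1(1)] ballI impI)
  next
    case False
    have "f x = 0" if N: "N \<in> \<N>" "N \<subseteq> N0" and f: "f \<in> lin_span (e # es)" "\<forall>x\<in>N. f x = 0" and x: "x \<in> N0" for N f x
    proof -
      obtain c f' where f': "f = (\<lambda>x. c * e x + f' x)" "f' \<in> lin_span es" using f(1) by auto
      \<comment> \<open>Otherwise vanishing on \<open>N\<close> would express the new function
        through the old ones there, which this case excludes.\<close>
      have "c = 0"
      proof (rule ccontr)
        assume c: "c \<noteq> 0"
        have "e x = (- 1 / c) * f' x" if "x \<in> N" for x
        proof -
          have "c * e x + f' x = 0" using f(2) that unfolding f'(1) by simp
          then have "c * e x = - f' x" by (simp only: eq_neg_iff_add_eq_0)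
          moreover have "e x = (c * e x) / c" using c by simp
          ultimately show ?thesis by simp
        qed
        then have "\<exists>N\<in>\<N>. N \<subseteq> N0 \<and> (\<exists>g\<in>lin_span es. \<forall>x\<in>N. e x = g x)"
          by (intro bexI[OF _ N(1)] conjI N(2) bexI[OF _ lin_span_smult[OF f'(2), of "- 1 / c"]] ballI)
        then show False using False by contradiction
      qed
      then have "f = f'" unfolding f'(1) by simp
      then show ?thesis using stable[OF N f'(2) _ x] f(2) by simp
    qed
    then show ?thesis by (intro bexI[OF _ N0] ballI impI)
  qed
qed

section \<open>Word entries as functions of one argument\<close>

context matrix_group begin

text \<open>Entries of the inverse are listed because words contain inverse letters. The constant
  \<open>1\<close> makes products of exactly \<open>d\<close> functions cover all degrees up to
  \<open>d\<close>.\<close>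

definition coord_functions :: "('a \<Rightarrow> 'k) list" where
  "coord_functions = (\<lambda>x. 1) # map (\<lambda>ij x. h x $$ ij) (List.product [0..<n] [0..<n]) @
     map (\<lambda>ij x. h (inv x) $$ ij) (List.product [0..<n] [0..<n])"

primrec coord_monomials :: "nat \<Rightarrow> ('a \<Rightarrow> 'k) list" where
  "coord_monomials 0 = [\<lambda>x. 1]"
| "coord_monomials (Suc d) = [\<lambda>x. e x * e' x. e \<leftarrow> coord_functions, e' \<leftarrow> coord_monomials d]"

lemma coord_functions_mem:
  shows "(\<lambda>x. 1) \<in> lin_span coord_functions"
    and "i < n \<Longrightarrow> j < n \<Longrightarrow> (\<lambda>x. h x $$ (i, j)) \<in> lin_span coord_functions"
    and "i < n \<Longrightarrow> j < n \<Longrightarrow> (\<lambda>x. h (inv x) $$ (i, j)) \<in> lin_span coord_functions"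
proof -
  show "(\<lambda>x. 1) \<in> lin_span coord_functions"
    unfolding coord_functions_def by (intro lin_span_base list.set_intros)
next
  assume "i < n" "j < n"
  then have p: "(i, j) \<in> set (List.product [0..<n] [0..<n])" by simp
  show "(\<lambda>x. h x $$ (i, j)) \<in> lin_span coord_functions"
    unfolding coord_functions_def
    by (intro lin_span_base list.set_intros(2)) (simp only: set_append set_map, rule UnI1, rule imageI[OF p])
  show "(\<lambda>x. h (inv x) $$ (i, j)) \<in> lin_span coord_functions"
    unfolding coord_functions_def
    by (intro lin_span_base list.set_intros(2)) (simp only: set_append set_map, rule UnI2, rule imageI[OF p])
qed

lemma coord_functions_const: "(\<lambda>x. c) \<in> lin_span coord_functions"
  using lin_span_smult[OF coord_functions_mem(1), of c] by simp

lemma coord_monomials_const: "(\<lambda>x. c) \<in> lin_span (coord_monomials d)"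
proof -
  have "(\<lambda>x. 1) \<in> lin_span (coord_monomials d)"
  proof (induction d)
    case 0
    show ?case by (rule lin_span_base) simp
  next
    case (Suc d)
    show ?case using lin_span_mult[OF coord_functions_mem(1) Suc] by simp
  qed
  from lin_span_smult[OF this, of c] show ?thesis by simp
qed

text \<open>Each letter contributes at most one factor from the entries of \<open>y\<close> or of
  its inverse, so the degree is bounded by the length of \<open>w\<close>. The other arguments
  affect only the coefficients, so the space does not depend on \<open>g\<close>.\<close>

lemma word_entry_in_span:
  assumes w: "fst ` set w \<subseteq> {..<k}" and g: "g \<in> {..<k} \<rightarrow> carrier G" and ij: "i < n" "j < n"
  shows "\<exists>f\<in>lin_span (coord_monomials (length w)).
    \<forall>y\<in>carrier G. h (word_map G w (g(v := y \<otimes> g v))) $$ (i, j) = f y"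
  using w ij(1)
proof (induction w arbitrary: i)
  case Nil
  then show ?case
    using ij(2) coord_monomials_const[of "1\<^sub>m n $$ (i, j)" 0] by (intro bexI[of _ "\<lambda>y. 1\<^sub>m n $$ (i, j)"]) (auto simp: h_one)
next
  case (Cons l w)
  obtain a s where l: "l = (a, s)" by (cases l)
  have a: "a < k" "g a \<in> carrier G" and w: "fst ` set w \<subseteq> {..<k}" using Cons.prems g l by auto
  define L where "L y = (if s then (g(v := y \<otimes> g v)) a else inv ((g(v := y \<otimes> g v)) a))" for y
  define W where "W y = word_map G w (g(v := y \<otimes> g v))" for y
  have gy: "(g(v := y \<otimes> g v)) \<in> {..<k} \<rightarrow> carrier G" if "v < k \<Longrightarrow> y \<in> carrier G" for y
    using g that by (auto simp: Pi_iff)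
  have "\<forall>r\<in>{..<n}. \<exists>f. f \<in> lin_span (coord_monomials (length w)) \<and> (\<forall>y\<in>carrier G. h (W y) $$ (r, j) = f y)"
    using Cons.IH[OF w] unfolding W_def by blast
  from bchoice[OF this] obtain f where
    f: "\<And>r. r < n \<Longrightarrow> f r \<in> lin_span (coord_monomials (length w))"
    "\<And>r y. r < n \<Longrightarrow> y \<in> carrier G \<Longrightarrow> h (W y) $$ (r, j) = f r y" by auto
  have "\<exists>p\<in>lin_span coord_functions. \<forall>y\<in>carrier G. h (L y) $$ (i, r) = p y" if r: "r < n" for r
  proof (cases "a = v")
    case False
    then show ?thesis unfolding L_def
      using coord_functions_const[of "h (if s then g a else inv (g a)) $$ (i, r)"] by (intro bexI) auto
  next
    case True
    show ?thesis
    proof (cases s)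
      case True
      have e: "h (L y) $$ (i, r) = (\<Sum>t<n. h (g a) $$ (t, r) * h y $$ (i, t))" if y: "y \<in> carrier G" for y
      proof -
        have "h (L y) = h y * h (g a)" unfolding L_def using True \<open>a = v\<close> a y by (simp add: h_mult)
        then show ?thesis
          using index_mult_mat_sum[OF h_carrier[OF y] h_carrier[OF a(2)] Cons.prems(2) r] by (simp add: mult.commute)
      qed
      have "(\<lambda>y. \<Sum>t<n. h (g a) $$ (t, r) * h y $$ (i, t)) \<in> lin_span coord_functions"
        using Cons.prems(2) by (intro lin_span_sum lin_span_smult coord_functions_mem) auto
      then show ?thesis using e by (intro bexI[of _ "\<lambda>y. \<Sum>t<n. h (g a) $$ (t, r) * h y $$ (i, t)"]) auto
    next
      case False
      have e: "h (L y) $$ (i, r) = (\<Sum>t<n. h (inv (g a)) $$ (i, t) * h (inv y) $$ (t, r))" if y: "y \<in> carrier G" for y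
      proof -
        have "h (L y) = h (inv (g a)) * h (inv y)"
          unfolding L_def using False \<open>a = v\<close> a y by (simp add: h_mult inv_mult_group)
        then show ?thesis
          using index_mult_mat_sum[OF h_carrier[OF inv_closed[OF a(2)]] h_carrier[OF inv_closed[OF y]] Cons.prems(2) r] by simp
      qed
      have "(\<lambda>y. \<Sum>t<n. h (inv (g a)) $$ (i, t) * h (inv y) $$ (t, r)) \<in> lin_span coord_functions"
        using r by (intro lin_span_sum lin_span_smult coord_functions_mem) auto
      then show ?thesis using e by (intro bexI[of _ "\<lambda>y. \<Sum>t<n. h (inv (g a)) $$ (i, t) * h (inv y) $$ (t, r)"]) auto
    qed
  qed
  then have "\<forall>r\<in>{..<n}. \<exists>p. p \<in> lin_span coord_functions \<and> (\<forall>y\<in>carrier G. h (L y) $$ (i, r) = p y)" by blast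
  from bchoice[OF this] obtain p where
    p: "\<And>r. r < n \<Longrightarrow> p r \<in> lin_span coord_functions"
    "\<And>r y. r < n \<Longrightarrow> y \<in> carrier G \<Longrightarrow> h (L y) $$ (i, r) = p r y" by auto
  have "h (word_map G (l # w) (g(v := y \<otimes> g v))) $$ (i, j) = (\<Sum>r<n. p r y * f r y)" if y: "y \<in> carrier G" for y
  proof -
    have c: "L y \<in> carrier G" "W y \<in> carrier G"
      unfolding L_def W_def using a y gy[OF y] word_map_closed[OF group_axioms w] by auto
    have "word_map G (l # w) (g(v := y \<otimes> g v)) = L y \<otimes> W y" unfolding L_def W_def l by simp
    then show ?thesis
      using index_mult_mat_sum[OF h_carrier[OF c(1)] h_carrier[OF c(2)] Cons.prems(2) ij(2)] p(2) f(2) y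
      by (simp add: h_mult[OF c])
  qed
  then have "\<forall>y\<in>carrier G. h (word_map G (l # w) (g(v := y \<otimes> g v))) $$ (i, j) = (\<Sum>r<n. p r y * f r y)" ..
  moreover have "(\<lambda>y. \<Sum>r<n. p r y * f r y) \<in> lin_span (coord_monomials (length (l # w)))"
    using lin_span_mult[OF p(1) f(1)] by (intro lin_span_sum) auto
  ultimately show ?case by (rule bexI)
qed

text \<open>Constancy in one argument says that certain functions in the span, the entries minus
  those of \<open>c\<close>, vanish; by stability this passes from \<open>N\<close> to
  \<open>N0\<close>.\<close>

lemma word_const_extend:
  assumes w: "fst ` set w \<subseteq> {..<k}" and g: "g \<in> {..<k} \<rightarrow> carrier G"
    and N: "N \<subseteq> N0" "N0 \<subseteq> carrier G"
    and stable: "\<And>f. f \<in> lin_span (coord_monomials (length w)) \<Longrightarrow> \<forall>x\<in>N. f x = 0 \<Longrightarrow> \<forall>x\<in>N0. f x = 0"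
    and const: "\<And>y. y \<in> N \<Longrightarrow> word_map G w (g(v := y \<otimes> g v)) = c"
    and v: "v < k" and c: "c \<in> carrier G" and y: "y \<in> N0"
  shows "word_map G w (g(v := y \<otimes> g v)) = c"
proof -
  have yc: "y \<in> carrier G" using y N by blast
  have car: "word_map G w (g(v := y \<otimes> g v)) \<in> carrier G"
    using g v yc by (intro word_map_closed[OF group_axioms w]) (auto simp: Pi_iff)
  have "h (word_map G w (g(v := y \<otimes> g v))) = h c"
  proof (rule eq_matI)
    fix i j assume "i < dim_row (h c)" "j < dim_col (h c)"
    then have ij: "i < n" "j < n" using h_carrier[OF c] by auto
    obtain f where f: "f \<in> lin_span (coord_monomials (length w))"
      "\<forall>y\<in>carrier G. h (word_map G w (g(v := y \<otimes> g v))) $$ (i, j) = f y"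
      using word_entry_in_span[OF w g ij, of v] by (elim bexE)
    have "(\<lambda>y. f y - h c $$ (i, j)) \<in> lin_span (coord_monomials (length w))"
      by (intro lin_span_diff f(1) coord_monomials_const)
    moreover have "\<forall>y\<in>N. f y - h c $$ (i, j) = 0"
    proof
      fix y assume "y \<in> N"
      then have "y \<in> carrier G" "word_map G w (g(v := y \<otimes> g v)) = c" using N const by auto
      then show "f y - h c $$ (i, j) = 0" using f(2) by auto
    qed
    ultimately have "\<forall>y\<in>N0. f y - h c $$ (i, j) = 0" by (rule stable)
    then show "h (word_map G w (g(v := y \<otimes> g v))) $$ (i, j) = h c $$ (i, j)" using f(2) y yc by simp
  qed (use h_carrier[OF c] h_carrier[OF car] in auto)
  then show ?thesis using h_inj car c by (meson inj_onD)
qed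

text \<open>The arguments are released one at a time: the first \<open>m\<close> range over cosets
  of \<open>N0\<close>, the others still over cosets of \<open>N\<close>. Each step is a statement
  about a single argument, so functions of several variables are avoided.\<close>

lemma word_const_on_cell_extend:
  assumes w: "fst ` set w \<subseteq> {..<k}" and g: "g \<in> {..<k} \<rightarrow> carrier G"
    and N: "subgroup N G" "N \<subseteq> N0" "subgroup N0 G"
    and stable: "\<And>f. f \<in> lin_span (coord_monomials (length w)) \<Longrightarrow> \<forall>x\<in>N. f x = 0 \<Longrightarrow> \<forall>x\<in>N0. f x = 0"
    and const: "\<And>g'. \<forall>i<k. \<exists>y\<in>N. g' i = y \<otimes> g i \<Longrightarrow> word_map G w g' = word_map G w g"
    and g': "\<forall>i<k. \<exists>y\<in>N0. g' i = y \<otimes> g i"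
  shows "word_map G w g' = word_map G w g"
proof -
  have N0c: "N0 \<subseteq> carrier G" using N(3) subgroup.subset by blast
  have gc: "g i \<in> carrier G" if "i < k" for i using g that by auto
  have "word_map G w g' = word_map G w g"
    if "m \<le> k" "\<forall>i<m. \<exists>y\<in>N0. g' i = y \<otimes> g i" "\<forall>i<k. m \<le> i \<longrightarrow> (\<exists>y\<in>N. g' i = y \<otimes> g i)" for m g'
    using that
  proof (induction m arbitrary: g')
    case 0
    then show ?case by (intro const) auto
  next
    case (Suc m)
    have m: "m < k" using Suc.prems(1) by simp
    obtain y where y: "y \<in> N0" "g' m = y \<otimes> g m" using Suc.prems(2) by blast
    \<comment> \<open>The argument at \<open>m\<close> is put back to its base value, so that
      multiplying it by \<open>y\<close> restores \<open>g'\<close>.\<close>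
    define f where "f = g'(m := g m)"
    have fc: "f \<in> {..<k} \<rightarrow> carrier G"
    proof
      fix i assume "i \<in> {..<k}"
      then have i: "i < k" by simp
      have "\<exists>y\<in>N0. g' i = y \<otimes> g i"
      proof (cases "i < Suc m")
        case True
        then show ?thesis using Suc.prems(2) by simp
      next
        case False
        then have "\<exists>y\<in>N. g' i = y \<otimes> g i" using Suc.prems(3) i by simp
        then obtain y where y: "y \<in> N" "g' i = y \<otimes> g i" by (elim bexE)
        show ?thesis using y(2) subsetD[OF N(2) y(1)] by (rule bexI)
      qed
      then show "f i \<in> carrier G" unfolding f_def using N0c gc[OF i] by auto
    qed
    have fm: "f m = g m" unfolding f_def by simp
    have "word_map G w (f(m := y \<otimes> f m)) = word_map G w g"
    proof (rule word_const_extend[OF w fc N(2) N0c stable _ m _ y(1)])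
      show "word_map G w g \<in> carrier G" by (rule word_map_closed[OF group_axioms w g])
      fix x assume x: "x \<in> N"
      show "word_map G w (f(m := x \<otimes> f m)) = word_map G w g"
      proof (rule Suc.IH)
        show "\<forall>i<m. \<exists>y\<in>N0. (f(m := x \<otimes> f m)) i = y \<otimes> g i"
          using Suc.prems(2) unfolding f_def by auto
        show "\<forall>i<k. m \<le> i \<longrightarrow> (\<exists>y\<in>N. (f(m := x \<otimes> f m)) i = y \<otimes> g i)"
          using Suc.prems(3) x unfolding f_def by auto
      qed (use m in simp)
    qed
    moreover have "f(m := y \<otimes> f m) = g'" unfolding f_def using y(2) by auto
    ultimately show ?case by simp
  qed
  from this[of k g'] show ?thesis using g' by simp
qed

end

section \<open>Inverse limits\<close>

text \<open>By Zorn's lemma there is a minimal proper filter below \<open>F0\<close>. If the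
  negation of \<open>P\<close> does not hold eventually, adding \<open>P\<close> keeps the filter
  proper, and so minimality shows that \<open>P\<close> was already eventually true.\<close>

lemma exists_ultrafilter_le:
  fixes F0 :: "'i filter"
  assumes "F0 \<noteq> bot"
  shows "\<exists>U. U \<noteq> bot \<and> U \<le> F0 \<and> (\<forall>P. eventually P U \<or> eventually (\<lambda>x. \<not> P x) U)"
proof -
  define A where "A = {F. F \<noteq> bot \<and> F \<le> F0}"
  define R where "R = relation_of (\<ge>) A"
  have "partial_order_on A R"
    unfolding R_def by (rule partial_order_on_relation_ofI) auto
  moreover have "\<exists>u\<in>A. \<forall>a\<in>C. a \<ge> u" if C: "C \<in> Chains R" for C
  proof (cases "C = {}")
    case True
    then show ?thesis using assms unfolding A_def by auto
  next
    case False
    have CA: "C \<subseteq> A" using C unfolding Chains_def R_def relation_of_def by auto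
    have chain: "a \<le> b \<or> b \<le> a" if "a \<in> C" "b \<in> C" for a b
      using C that unfolding Chains_def R_def relation_of_def by auto
    \<comment> \<open>Whatever holds eventually for the infimum of a chain holds eventually for one
      of its members, and these are proper.\<close>
    have "\<not> eventually (\<lambda>x. False) (Inf C)"
    proof
      assume "eventually (\<lambda>x. False) (Inf C)"
      moreover have "\<exists>x\<in>C. x \<le> inf F G" if "F \<in> C" "G \<in> C" for F G
        using chain[OF that] that by (metis inf.absorb1 inf.absorb2 order_refl)
      ultimately obtain F where "F \<in> C" "eventually (\<lambda>x. False) F"
        using eventually_Inf_base[OF False, of "\<lambda>x. False"] by auto
      then show False using CA unfolding A_def by (auto simp: eventually_False)
    qed
    then have "Inf C \<noteq> bot" by (simp add: eventually_False)
    moreover have "Inf C \<le> F0"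
    proof -
      obtain F where "F \<in> C" using False by blast
      then have "Inf C \<le> F" "F \<le> F0" using CA unfolding A_def by (auto intro: Inf_lower)
      then show ?thesis by (rule order_trans)
    qed
    ultimately have "Inf C \<in> A" unfolding A_def by simp
    then show ?thesis by (intro bexI[of _ "Inf C"]) (auto intro: Inf_lower)
  qed
  ultimately obtain U where U: "U \<in> A" "\<And>F. F \<in> A \<Longrightarrow> F \<le> U \<Longrightarrow> F = U"
    using predicate_Zorn[of A "(\<ge>)"] unfolding R_def by metis
  have "eventually P U \<or> eventually (\<lambda>x. \<not> P x) U" for P
  proof (rule disjCI)
    assume n: "\<not> eventually (\<lambda>x. \<not> P x) U"
    have "inf U (principal {x. P x}) \<noteq> bot"
      using n by (auto simp: trivial_limit_def eventually_inf_principal)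
    then have "inf U (principal {x. P x}) \<in> A" using U(1) unfolding A_def by (auto intro: le_infI1)
    then have "inf U (principal {x. P x}) = U" using U(2) by simp
    then have "U \<le> principal {x. P x}" by (simp add: le_iff_inf)
    then show "eventually P U" by (simp add: le_principal)
  qed
  then show ?thesis using U(1) unfolding A_def by blast
qed

lemma ultrafilter_finite_limit:
  assumes U: "U \<noteq> bot" "\<And>P. eventually P U \<or> eventually (\<lambda>x. \<not> P x) U"
    and fin: "finite A" "\<And>j. f j \<in> A"
  shows "\<exists>a\<in>A. eventually (\<lambda>j. f j = a) U"
proof (rule ccontr)
  assume "\<not> ?thesis"
  then have "\<forall>a\<in>A. eventually (\<lambda>j. f j \<noteq> a) U" using U(2) by blast
  then have "eventually (\<lambda>j. \<forall>a\<in>A. f j \<noteq> a) U" using fin(1) by (simp add: eventually_ball_finite)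
  then have "eventually (\<lambda>j. False) U" by (rule eventually_mono) (use fin(2) in auto)
  then show False using U(1) by (simp add: eventually_False)
qed

text \<open>The construction of \<open>pro_completion\<close> for an arbitrary family, which
  separates the limit argument from the class of finite groups.\<close>

definition completion :: "('a, 'c) monoid_scheme \<Rightarrow> 'a set set \<Rightarrow> ('a set \<Rightarrow> 'a set) monoid" where
  "completion G \<N> =
     (let P = product_group \<N> (\<lambda>N. G Mod N)
      in P\<lparr>carrier := {x \<in> carrier P. \<forall>N\<in>\<N>. \<forall>M\<in>\<N>. N \<subseteq> M \<longrightarrow> M <#>\<^bsub>G\<^esub> x N = x M}\<rparr>)"

lemma pro_completion_eq: "pro_completion \<C> \<Gamma> = completion \<Gamma> (class_normals \<C> \<Gamma>)"
  by (simp add: pro_completion_def completion_def Let_def)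

section \<open>The completion along a family of normal subgroups\<close>

locale normal_family = group G for G :: "('a, 'c) monoid_scheme" (structure) +
  fixes \<N> :: "'a set set"
  assumes normal: "N \<in> \<N> \<Longrightarrow> N \<lhd> G"
begin

abbreviation "CG \<equiv> completion G \<N>"
abbreviation "PG \<equiv> product_group \<N> (\<lambda>N. G Mod N)"

lemma sub: "N \<in> \<N> \<Longrightarrow> subgroup N G"
  using normal normal_imp_subgroup by blast

lemma group_PG: "group PG"
  by (rule product_group) (rule normal.factorgroup_is_group[OF normal])

lemma coset_mono:
  assumes "N \<in> \<N>" "M \<in> \<N>" "N \<subseteq> M" "g \<in> carrier G"
  shows "M <#> (N #> g) = M #> g"
proof -
  have "M <#> (N #> g) = (M <#> N) #> g"
    using assms sub by (intro setmult_rcos_assoc) (auto dest: subgroup.subset)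
  also have "M <#> N = M"
  proof
    show "M <#> N \<subseteq> M" using assms(3) subgroup.m_closed[OF sub[OF assms(2)]] by (auto simp: set_mult_def)
    show "M \<subseteq> M <#> N"
    proof
      fix x assume "x \<in> M"
      then have "x = x \<otimes> \<one>" using subgroup.mem_carrier[OF sub[OF assms(2)]] by simp
      then show "x \<in> M <#> N" using \<open>x \<in> M\<close> subgroup.one_closed[OF sub[OF assms(1)]] unfolding set_mult_def by blast
    qed
  qed
  finally show ?thesis .
qed

lemma carrier_CG:
  "carrier CG = {x \<in> carrier PG. \<forall>N\<in>\<N>. \<forall>M\<in>\<N>. N \<subseteq> M \<longrightarrow> M <#> x N = x M}"
  unfolding completion_def Let_def by simp

lemma carrier_PG: "carrier PG = (\<Pi>\<^sub>E N\<in>\<N>. rcosets N)"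
  by (simp add: FactGroup_def)

lemma carrier_CG_subset: "carrier CG \<subseteq> carrier PG"
  unfolding carrier_CG by (rule Collect_restrict)

lemma carrier_CG_iff:
  "x \<in> carrier CG \<longleftrightarrow> x \<in> extensional \<N> \<and> (\<forall>N\<in>\<N>. x N \<in> rcosets N) \<and>
     (\<forall>N\<in>\<N>. \<forall>M\<in>\<N>. \<forall>g\<in>carrier G. N \<subseteq> M \<longrightarrow> x N = N #> g \<longrightarrow> x M = M #> g)"
  (is "?l \<longleftrightarrow> ?r")
proof
  assume ?l
  then have x: "x \<in> (\<Pi>\<^sub>E N\<in>\<N>. rcosets N)" "\<forall>N\<in>\<N>. \<forall>M\<in>\<N>. N \<subseteq> M \<longrightarrow> M <#> x N = x M"
    unfolding carrier_CG carrier_PG by simp_all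
  show ?r
  proof (intro conjI ballI impI)
    show "x \<in> extensional \<N>" using x(1) by (simp add: PiE_def)
    show "x N \<in> rcosets N" if "N \<in> \<N>" for N using x(1) that by auto
    show "x M = M #> g" if "N \<in> \<N>" "M \<in> \<N>" "g \<in> carrier G" "N \<subseteq> M" "x N = N #> g" for N M g
      using x(2) that coset_mono[OF that(1,2,4,3)] by metis
  qed
next
  assume r: ?r
  have "M <#> x N = x M" if "N \<in> \<N>" "M \<in> \<N>" "N \<subseteq> M" for N M
  proof -
    have "x N \<in> rcosets N" using r that by blast
    then obtain g where g: "g \<in> carrier G" "x N = N #> g" by (auto simp: RCOSETS_def)
    then have "x M = M #> g" using r that by blast
    then show ?thesis unfolding g(2) using coset_mono[OF that g(1)] by simp
  qed
  moreover have "x \<in> carrier PG" using r unfolding carrier_PG by (simp add: PiE_iff)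
  ultimately show ?l unfolding carrier_CG by blast
qed

lemma CG_coset:
  assumes "x \<in> carrier CG" "N \<in> \<N>"
  shows "\<exists>g\<in>carrier G. x N = N #> g"
proof -
  have "x N \<in> rcosets N" using assms unfolding carrier_CG_iff by blast
  then show ?thesis unfolding RCOSETS_def by blast
qed

lemma CG_compat:
  assumes "x \<in> carrier CG" "N \<in> \<N>" "M \<in> \<N>" "g \<in> carrier G" "N \<subseteq> M" "x N = N #> g"
  shows "x M = M #> g"
  using assms(1)[unfolded carrier_CG_iff] assms(2-) by blast

lemma mult_CG: "N \<in> \<N> \<Longrightarrow> (x \<otimes>\<^bsub>CG\<^esub> y) N = x N \<otimes>\<^bsub>G Mod N\<^esub> y N"
  by (simp add: completion_def Let_def product_group_def)

lemma coset_hom: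
  assumes "N \<in> \<N>"
  shows "group_hom G (G Mod N) (\<lambda>x. N #> x)"
  using normal.r_coset_surj_hom(1)[OF normal[OF assms]] .

lemma subgroup_CG: "subgroup (carrier CG) PG"
proof -
  interpret PG: group PG by (rule group_PG)
  have memI: "x \<in> carrier CG" if prem: "x \<in> carrier PG"
    "\<And>N M. N \<in> \<N> \<Longrightarrow> M \<in> \<N> \<Longrightarrow> N \<subseteq> M \<Longrightarrow> \<exists>g\<in>carrier G. x N = N #> g \<and> x M = M #> g" for x
  proof -
    have "M <#> x N = x M" if NM: "N \<in> \<N>" "M \<in> \<N>" "N \<subseteq> M" for N M
    proof -
      obtain g where g: "g \<in> carrier G" "x N = N #> g" "x M = M #> g" using prem(2)[OF NM] by blast
      show ?thesis unfolding g(2,3) by (rule coset_mono[OF NM g(1)])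
    qed
    then show ?thesis using prem(1) unfolding carrier_CG by blast
  qed
  show ?thesis
  proof (rule PG.subgroupI)
    show "carrier CG \<subseteq> carrier PG" by (rule carrier_CG_subset)
    have "\<one>\<^bsub>PG\<^esub> \<in> carrier CG"
    proof (rule memI)
      show "\<one>\<^bsub>PG\<^esub> \<in> carrier PG" by (rule PG.one_closed)
    next
      fix N M assume NM: "N \<in> \<N>" "M \<in> \<N>" "N \<subseteq> M"
      then have "\<one>\<^bsub>PG\<^esub> N = N #> \<one>" "\<one>\<^bsub>PG\<^esub> M = M #> \<one>"
        using subgroup.subset[OF sub] by (auto simp: FactGroup_def)
      then show "\<exists>g\<in>carrier G. \<one>\<^bsub>PG\<^esub> N = N #> g \<and> \<one>\<^bsub>PG\<^esub> M = M #> g" by blast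
    qed
    then show "carrier CG \<noteq> {}" by blast
    show "inv\<^bsub>PG\<^esub> x \<in> carrier CG" if x: "x \<in> carrier CG" for x
    proof (rule memI)
      have xP: "x \<in> carrier PG" using x carrier_CG_subset by (rule rev_subsetD)
      show "inv\<^bsub>PG\<^esub> x \<in> carrier PG" by (rule PG.inv_closed[OF xP])
    next
      have xP: "x \<in> carrier PG" using x carrier_CG_subset by (rule rev_subsetD)
      fix N M assume NM: "N \<in> \<N>" "M \<in> \<N>" "N \<subseteq> M"
      obtain g where g: "g \<in> carrier G" "x N = N #> g" using CG_coset[OF x NM(1)] by blast
      have xM: "x M = M #> g" by (rule CG_compat[OF x NM(1,2) g(1) NM(3) g(2)])
      have inv: "(inv\<^bsub>PG\<^esub> x) K = inv\<^bsub>G Mod K\<^esub> (x K)" if "K \<in> \<N>" for K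
      proof -
        have "inv\<^bsub>PG\<^esub> x = (\<lambda>N\<in>\<N>. inv\<^bsub>G Mod N\<^esub> x N)"
          using xP by (intro inv_product_group normal.factorgroup_is_group normal) simp_all
        then show ?thesis using that by simp
      qed
      have "(inv\<^bsub>PG\<^esub> x) N = N #> inv g" "(inv\<^bsub>PG\<^esub> x) M = M #> inv g"
        unfolding inv[OF NM(1)] inv[OF NM(2)] g(2) xM
        using group_hom.hom_inv[OF coset_hom[OF NM(1)] g(1)] group_hom.hom_inv[OF coset_hom[OF NM(2)] g(1)] by auto
      then show "\<exists>g\<in>carrier G. (inv\<^bsub>PG\<^esub> x) N = N #> g \<and> (inv\<^bsub>PG\<^esub> x) M = M #> g" using g(1) by blast
    qed
    show "x \<otimes>\<^bsub>PG\<^esub> y \<in> carrier CG" if x: "x \<in> carrier CG" and y: "y \<in> carrier CG" for x y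
    proof (rule memI)
      have P: "x \<in> carrier PG" "y \<in> carrier PG" using x y carrier_CG_subset by (blast intro: rev_subsetD)+
      then show "x \<otimes>\<^bsub>PG\<^esub> y \<in> carrier PG" by (rule PG.m_closed)
    next
      fix N M assume NM: "N \<in> \<N>" "M \<in> \<N>" "N \<subseteq> M"
      obtain g where g: "g \<in> carrier G" "x N = N #> g" using CG_coset[OF x NM(1)] by blast
      obtain g' where g': "g' \<in> carrier G" "y N = N #> g'" using CG_coset[OF y NM(1)] by blast
      have xM: "x M = M #> g" by (rule CG_compat[OF x NM(1,2) g(1) NM(3) g(2)])
      have yM: "y M = M #> g'" by (rule CG_compat[OF y NM(1,2) g'(1) NM(3) g'(2)])
      have "(x \<otimes>\<^bsub>PG\<^esub> y) N = N #> (g \<otimes> g')" "(x \<otimes>\<^bsub>PG\<^esub> y) M = M #> (g \<otimes> g')"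
        using NM g(2) g'(2) xM yM group_hom.hom_mult[OF coset_hom[OF NM(1)] g(1) g'(1)]
          group_hom.hom_mult[OF coset_hom[OF NM(2)] g(1) g'(1)] by auto
      then show "\<exists>k\<in>carrier G. (x \<otimes>\<^bsub>PG\<^esub> y) N = N #> k \<and> (x \<otimes>\<^bsub>PG\<^esub> y) M = M #> k" using g(1) g'(1) by blast
    qed
  qed
qed

lemma group_CG: "group CG"
proof -
  have "CG = PG\<lparr>carrier := carrier CG\<rparr>" by (simp add: completion_def Let_def)
  then show ?thesis using group.subgroup_imp_group[OF group_PG subgroup_CG] by metis
qed

lemma projection_hom: "N \<in> \<N> \<Longrightarrow> (\<lambda>x. x N) \<in> hom CG (G Mod N)"
  by (rule homI) (auto simp: mult_CG carrier_CG_iff FactGroup_def)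

lemma completion_word:
  assumes w: "fst ` set w \<subseteq> {..<k}" and x: "x \<in> {..<k} \<rightarrow> carrier CG"
    and g: "g \<in> {..<k} \<rightarrow> carrier G" and N: "N \<in> \<N>" and xg: "\<And>i. i < k \<Longrightarrow> x i N = N #> g i"
  shows "word_map CG w x N = N #> word_map G w g"
proof -
  interpret N: group_hom G "G Mod N" "\<lambda>x. N #> x" by (rule coset_hom[OF N])
  have "word_map CG w x N = word_map (G Mod N) w (\<lambda>i. x i N)"
    by (rule word_map_hom[OF group_CG N.H.group_axioms projection_hom[OF N] w x])
  also have "\<dots> = word_map (G Mod N) w (\<lambda>i. N #> g i)" by (rule word_map_cong[OF w xg])
  also have "\<dots> = N #> word_map G w g"
    by (rule word_map_hom[OF group_axioms N.H.group_axioms N.homh w g, symmetric])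
  finally show ?thesis .
qed

text \<open>The canonical map of the group into its completion.\<close>

definition diag :: "'a \<Rightarrow> 'a set \<Rightarrow> 'a set" where
  "diag g = (\<lambda>N\<in>\<N>. N #> g)"

lemma coset_eq_mono:
  assumes "N \<in> \<N>" "M \<in> \<N>" "N \<subseteq> M" "g \<in> carrier G" "g' \<in> carrier G" "N #> g = N #> g'"
  shows "M #> g = M #> g'"
  using coset_mono[OF assms(1-3)] assms(4-6) by metis

lemma diag_hom: "diag \<in> hom G CG"
proof (rule homI)
  show "diag g \<in> carrier CG" if g: "g \<in> carrier G" for g
    unfolding carrier_CG_iff
  proof (intro conjI ballI impI)
    show "diag g \<in> extensional \<N>" by (simp add: diag_def)
    show "diag g N \<in> rcosets N" if "N \<in> \<N>" for N
      using that g by (auto simp: diag_def RCOSETS_def)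
    show "diag g M = M #> g'"
      if "N \<in> \<N>" "M \<in> \<N>" "g' \<in> carrier G" "N \<subseteq> M" "diag g N = N #> g'" for N M g'
      using coset_eq_mono[OF that(1,2,4) g that(3)] that(1,2,5) by (simp add: diag_def)
  qed
  show "diag (g \<otimes> g') = diag g \<otimes>\<^bsub>CG\<^esub> diag g'" if g: "g \<in> carrier G" "g' \<in> carrier G" for g g'
  proof
    fix N
    show "diag (g \<otimes> g') N = (diag g \<otimes>\<^bsub>CG\<^esub> diag g') N"
    proof (cases "N \<in> \<N>")
      case True
      then show ?thesis using group_hom.hom_mult[OF coset_hom[OF True] g] by (simp add: mult_CG diag_def)
    next
      case False
      then show ?thesis by (simp add: diag_def completion_def Let_def product_group_def)
    qed
  qed
qed

end

section \<open>Groups with few word values\<close>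

text \<open>A subset of the natural numbers encodes a branch: membership of \<open>j\<close> decides
  the child taken at level \<open>j\<close>. Two branches agree up to the least number that
  distinguishes the subsets, and there they take different children. As \<open>D\<close> need not be
  symmetric, both orders occur in the conclusion.\<close>

lemma binary_tree_branches:
  assumes "P c"
    and step: "\<And>c. P c \<Longrightarrow> \<exists>c0 c1. P c0 \<and> P c1 \<and> R c c0 \<and> R c c1 \<and> D c0 c1"
  shows "\<exists>T :: nat set \<Rightarrow> nat \<Rightarrow> 'c. (\<forall>s j. P (T s j) \<and> R (T s j) (T s (Suc j))) \<and>
           (\<forall>s t. s \<noteq> t \<longrightarrow> (\<exists>j. D (T s j) (T t j) \<or> D (T t j) (T s j)))"
proof -
  obtain c0 c1 where st: "\<And>c. P c \<Longrightarrow> P (c0 c) \<and> P (c1 c) \<and> R c (c0 c) \<and> R c (c1 c) \<and> D (c0 c) (c1 c)"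
    using step by metis
  define T where "T s = rec_nat c (\<lambda>j d. if j \<in> s then c0 d else c1 d)" for s :: "nat set"
  have T0: "T s 0 = c" and TS: "T s (Suc j) = (if j \<in> s then c0 (T s j) else c1 (T s j))" for s j
    by (simp_all add: T_def)
  have P: "P (T s j)" for s j by (induction j) (use assms(1) st T0 TS in auto)
  have R: "R (T s j) (T s (Suc j))" for s j using st[OF P[of s j]] by (simp add: TS)
  have D: "\<exists>j. D (T s j) (T t j) \<or> D (T t j) (T s j)" if "s \<noteq> t" for s t
  proof -
    have ex: "\<exists>j. (j \<in> s) \<noteq> (j \<in> t)" using that by blast
    define j where "j = (LEAST j. (j \<in> s) \<noteq> (j \<in> t))"
    have j: "(j \<in> s) \<noteq> (j \<in> t)" unfolding j_def by (rule LeastI_ex[OF ex])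
    have less: "(i \<in> s) = (i \<in> t)" if "i < j" for i using not_less_Least that unfolding j_def by blast
    have "i \<le> j \<Longrightarrow> T s i = T t i" for i by (induction i) (use less in \<open>auto simp: T0 TS\<close>)
    then have "T s j = T t j" by simp
    then have "D (T s (Suc j)) (T t (Suc j)) \<or> D (T t (Suc j)) (T s (Suc j))"
      using j st[OF P[of t j]] by (auto simp: TS)
    then show ?thesis by blast
  qed
  show ?thesis using P R D by blast
qed

locale residual_family = normal_family +
  assumes finite_index: "N \<in> \<N> \<Longrightarrow> finite (rcosets N)"
    and inter_closed: "N \<in> \<N> \<Longrightarrow> M \<in> \<N> \<Longrightarrow> N \<inter> M \<in> \<N>"
    and nonempty: "\<N> \<noteq> {}"
    and separating: "x \<in> carrier G \<Longrightarrow> x \<noteq> \<one> \<Longrightarrow> \<exists>N\<in>\<N>. x \<notin> N"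
begin

text \<open>A form of compactness. Since each quotient is finite, an ultrafilter on the indices
  selects one coset for every \<open>N\<close> simultaneously, and the selected cosets are
  compatible. Where the sequence stabilizes, the selected coset is the stable one.\<close>

lemma limit_point:
  assumes h: "\<And>j :: nat. h j \<in> carrier G"
  shows "\<exists>x\<in>carrier CG. \<forall>N\<in>\<N>. \<forall>g. eventually (\<lambda>j. N #> h j = N #> g) sequentially \<longrightarrow> x N = N #> g"
proof -
  obtain U :: "nat filter" where U: "U \<noteq> bot" "U \<le> sequentially"
    "\<And>P. eventually P U \<or> eventually (\<lambda>x. \<not> P x) U"
    using exists_ultrafilter_le[OF sequentially_bot] by blast
  have "\<exists>Y. Y \<in> rcosets N \<and> eventually (\<lambda>j. N #> h j = Y) U" if "N \<in> \<N>" for N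
  proof -
    have "\<exists>Y\<in>rcosets N. eventually (\<lambda>j. N #> h j = Y) U"
      by (rule ultrafilter_finite_limit[OF U(1,3) finite_index[OF that]])
        (use h that sub in \<open>auto simp: RCOSETS_def\<close>)
    then show ?thesis by blast
  qed
  then obtain y where y: "\<And>N. N \<in> \<N> \<Longrightarrow> y N \<in> rcosets N"
    "\<And>N. N \<in> \<N> \<Longrightarrow> eventually (\<lambda>j. N #> h j = y N) U" by metis
  have unique: "Y = Z" if Y: "eventually (\<lambda>j. f j = Y) U" and Z: "eventually (\<lambda>j. f j = Z) U"
    for f :: "nat \<Rightarrow> 'a set" and Y Z
  proof (rule ccontr)
    assume ne: "Y \<noteq> Z"
    have "eventually (\<lambda>j. False) U"
      using Y Z by eventually_elim (use ne in auto)
    then show False using U(1) by (simp add: eventually_False)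
  qed
  define x where "x = restrict y \<N>"
  have "x \<in> carrier CG"
    unfolding carrier_CG_iff
  proof (intro conjI ballI impI)
    show "x \<in> extensional \<N>" by (simp add: x_def)
    show "x N \<in> rcosets N" if "N \<in> \<N>" for N using y(1)[OF that] that by (simp add: x_def)
    show "x M = M #> g"
      if NM: "N \<in> \<N>" "M \<in> \<N>" "g \<in> carrier G" "N \<subseteq> M" "x N = N #> g" for N M g
    proof -
      have "eventually (\<lambda>j. N #> h j = N #> g) U" using y(2)[OF NM(1)] NM(1,5) by (simp add: x_def)
      then have "eventually (\<lambda>j. M #> h j = M #> g) U"
        by eventually_elim (rule coset_eq_mono[OF NM(1,2,4) h NM(3)])
      then have "y M = M #> g" by (rule unique[OF y(2)[OF NM(2)]])
      then show ?thesis using NM(2) by (simp add: x_def)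
    qed
  qed
  moreover have "x N = N #> g" if N: "N \<in> \<N>" and ev: "eventually (\<lambda>j. N #> h j = N #> g) sequentially" for N g
  proof -
    have "eventually (\<lambda>j. N #> h j = N #> g) U" using U(2) ev by (auto simp: le_filter_def)
    then have "y N = N #> g" by (rule unique[OF y(2)[OF N]])
    then show ?thesis using N by (simp add: x_def)
  qed
  ultimately show ?thesis by blast
qed

text \<open>Arguments outside \<open>{..<k}\<close> are left arbitrary, since the word does not read
  them.\<close>

definition cell :: "nat \<Rightarrow> 'a set \<Rightarrow> (nat \<Rightarrow> 'a) \<Rightarrow> (nat \<Rightarrow> 'a) set" where
  "cell k N g = {h \<in> {..<k} \<rightarrow> carrier G. \<forall>i<k. N #> h i = N #> g i}"

lemma cell_mono:
  assumes "N' \<in> \<N>" "N \<in> \<N>" "N' \<subseteq> N" "g \<in> {..<k} \<rightarrow> carrier G"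
  shows "cell k N' g \<subseteq> cell k N g"
proof
  fix h assume h: "h \<in> cell k N' g"
  have "N #> h i = N #> g i" if "i < k" for i
    by (rule coset_eq_mono[OF assms(1-3)]) (use h assms(4) that in \<open>auto simp: cell_def\<close>)
  then show "h \<in> cell k N g" using h by (simp add: cell_def)
qed

lemma exists_constant_subcell:
  assumes w: "fst ` set w \<subseteq> {..<k}"
    and few: "word_values CG k w \<prec> (UNIV :: nat set set)"
    and g0: "g0 \<in> {..<k} \<rightarrow> carrier G" and N0: "N0 \<in> \<N>"
  shows "\<exists>g N. g \<in> cell k N0 g0 \<and> N \<in> \<N> \<and> N \<subseteq> N0 \<and>
           (\<forall>h\<in>cell k N g. word_map G w h = word_map G w g)"
proof (rule ccontr)
  assume no: "\<not> ?thesis"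
  define P where "P = (\<lambda>(g, N). g \<in> cell k N0 g0 \<and> N \<in> \<N> \<and> N \<subseteq> N0)"
  define R where "R = (\<lambda>(g, N) (g', N'). N' \<subseteq> N \<and> g' \<in> cell k N g)"
  \<comment> \<open>Both children carry the same subgroup, so their values can be compared in one
    and the same quotient.\<close>
  define D where "D = (\<lambda>(g, N :: 'a set) (g', N'). N = N' \<and> N #> word_map G w g \<noteq> N #> word_map G w g')"
  have P_carrier: "g \<in> {..<k} \<rightarrow> carrier G" if "P (g, N)" for g N
    using that by (simp add: P_def cell_def)
  have "\<exists>c0 c1. P c0 \<and> P c1 \<and> R c c0 \<and> R c c1 \<and> D c0 c1" if "P c" for c
  proof -
    obtain g N where c: "c = (g, N)" by (cases c)
    have P: "g \<in> cell k N0 g0" "N \<in> \<N>" "N \<subseteq> N0" using that unfolding c P_def by auto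
    have g: "g \<in> {..<k} \<rightarrow> carrier G" using P(1) by (simp add: cell_def)
    obtain h where h: "h \<in> cell k N g" "word_map G w h \<noteq> word_map G w g" using no P by blast
    have hc: "h \<in> {..<k} \<rightarrow> carrier G" using h(1) by (simp add: cell_def)
    have wc: "word_map G w h \<in> carrier G" "word_map G w g \<in> carrier G"
      using word_map_closed[OF group_axioms w] g hc by auto
    have ne: "word_map G w h \<otimes> inv (word_map G w g) \<noteq> \<one>"
    proof
      assume "word_map G w h \<otimes> inv (word_map G w g) = \<one>"
      then have "word_map G w h = inv (inv (word_map G w g))"
        by (rule inv_equality[symmetric]) (use wc in auto)
      then show False using h(2) wc by simp
    qed
    \<comment> \<open>The two values differ in the group, so some member of the family separates
      them. Intersecting it with \<open>N\<close> yields a refinement that still separates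
      them.\<close>
    obtain M where M: "M \<in> \<N>" "word_map G w h \<otimes> inv (word_map G w g) \<notin> M"
      using separating[OF _ ne] wc by auto
    define N' where "N' = N \<inter> M"
    have N': "N' \<in> \<N>" "N' \<subseteq> N" using inter_closed[OF P(2) M(1)] by (auto simp: N'_def)
    have "word_map G w h \<otimes> inv (word_map G w g) \<in> N'"
      if "N' #> word_map G w h = N' #> word_map G w g"
      by (rule rcos_eq_imp_diff[OF sub[OF N'(1)] wc that])
    then have diff: "N' #> word_map G w h \<noteq> N' #> word_map G w g" using M(2) by (auto simp: N'_def)
    have "h \<in> cell k N0 g" using h(1) cell_mono[OF P(2) N0 P(3) g] by blast
    then have "h \<in> cell k N0 g0" using P(1) by (simp add: cell_def)
    then have "P (h, N')" "P (g, N')" "R c (h, N')" "R c (g, N')" "D (h, N') (g, N')"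
      using P N' h(1) g diff by (auto simp: P_def R_def D_def c cell_def)
    then show ?thesis by blast
  qed
  moreover have "P (g0, N0)" using g0 N0 by (simp add: P_def cell_def)
  ultimately obtain T :: "nat set \<Rightarrow> nat \<Rightarrow> (nat \<Rightarrow> 'a) \<times> 'a set" where
    T: "\<And>s j. P (T s j)" "\<And>s j. R (T s j) (T s (Suc j))"
      "\<And>s t. s \<noteq> t \<Longrightarrow> \<exists>j. D (T s j) (T t j) \<or> D (T t j) (T s j)"
    using binary_tree_branches[of P "(g0, N0)" R D] by blast
  define g where "g s j = fst (T s j)" for s j
  define N where "N s j = snd (T s j)" for s j
  have Tgn: "T s j = (g s j, N s j)" for s j by (simp add: g_def N_def)
  have NN: "N s j \<in> \<N>" for s j using T(1)[of s j] by (simp add: Tgn P_def)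
  have gc: "g s j \<in> {..<k} \<rightarrow> carrier G" for s j using P_carrier T(1)[of s j] by (simp add: Tgn)
  have dec: "N s (Suc j) \<subseteq> N s j" and gcell: "g s (Suc j) \<in> cell k (N s j) (g s j)" for s j
    using T(2)[of s j] by (simp_all add: Tgn R_def)
  \<comment> \<open>Cells are nested along a branch, so from level \<open>m\<close> on the cosets
    modulo \<open>N s m\<close> no longer change. They are therefore the components of the
    limit.\<close>
  have stable: "N s j \<subseteq> N s m \<and> N s m #> g s j i = N s m #> g s m i" if "m \<le> j" "i < k" for s m j i
    using that(1)
  proof (induction j rule: dec_induct)
    case (step j)
    have "N s j #> g s (Suc j) i = N s j #> g s j i" using gcell[of s j] that(2) by (simp add: cell_def)
    then have "N s m #> g s (Suc j) i = N s m #> g s j i"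
      using step.IH gc[of s j] gc[of s "Suc j"] that(2) by (intro coset_eq_mono[OF NN NN, of s j s m]) auto
    then show ?case using step.IH dec[of s j] by auto
  qed simp
  define Lim where "Lim s i x \<longleftrightarrow>
    (\<forall>N\<in>\<N>. \<forall>a. eventually (\<lambda>j. N #> g s j i = N #> a) sequentially \<longrightarrow> x N = N #> a)" for s i x
  have ex: "\<exists>x. x \<in> carrier CG \<and> Lim s i x" if "i < k" for s i
  proof -
    have "g s j i \<in> carrier G" for j using gc[of s j] that by auto
    from limit_point[of "\<lambda>j. g s j i", OF this] show ?thesis unfolding Lim_def Bex_def .
  qed
  \<comment> \<open>The value \<open>undefined\<close> outside \<open>{..<k}\<close> makes
    \<open>y s\<close> an element of the extensional function space in
    \<open>word_values\<close>.\<close>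
  define y where "y s i = (if i < k then SOME x. x \<in> carrier CG \<and> Lim s i x else undefined)" for s i
  have y: "y s i \<in> carrier CG \<and> Lim s i (y s i)" if "i < k" for s i
    unfolding y_def if_P[OF that] by (rule someI_ex[OF ex[OF that]])
  have yN: "y s i (N s m) = N s m #> g s m i" if "i < k" for s m i
  proof -
    have "eventually (\<lambda>j. N s m #> g s j i = N s m #> g s m i) sequentially"
      using stable that by (intro eventually_sequentiallyI[of m]) blast
    then show ?thesis using conjunct2[OF y[OF that, of s]] NN[of s m] unfolding Lim_def by blast
  qed
  have yc: "y s \<in> {..<k} \<rightarrow>\<^sub>E carrier CG" for s
  proof (rule PiE_I)
    show "y s i \<in> carrier CG" if "i \<in> {..<k}" for i using y[of i s] that by simp
  qed (simp add: y_def)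
  have val: "word_map CG w (y s) (N s m) = N s m #> word_map G w (g s m)" for s m
  proof (rule completion_word[OF w _ gc NN])
    show "y s \<in> {..<k} \<rightarrow> carrier CG" using yc[of s] by (auto simp: PiE_iff)
    show "y s i (N s m) = N s m #> g s m i" if "i < k" for i by (rule yN[OF that])
  qed
  have sep: "word_map CG w (y s) \<noteq> word_map CG w (y t)" if D: "D (T s m) (T t m)" for s t m
  proof
    assume "word_map CG w (y s) = word_map CG w (y t)"
    moreover have "N s m = N t m" "N s m #> word_map G w (g s m) \<noteq> N s m #> word_map G w (g t m)"
      using D by (auto simp: D_def Tgn)
    ultimately show False using val[of s m] val[of t m] by simp
  qed
  have "inj (\<lambda>s. word_map CG w (y s))"
  proof (rule injI, rule ccontr)
    fix s t :: "nat set" assume eq: "word_map CG w (y s) = word_map CG w (y t)" and "s \<noteq> t"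
    then obtain j where "D (T s j) (T t j) \<or> D (T t j) (T s j)" using T(3) by blast
    then show False using sep[of s j t] sep[of t j s] eq by auto
  qed
  moreover have "range (\<lambda>s. word_map CG w (y s)) \<subseteq> word_values CG k w"
    using yc by (auto simp: word_values_def)
  ultimately have ge: "(UNIV :: nat set set) \<lesssim> word_values CG k w"
    unfolding lepoll_def by (intro exI conjI)
  have "word_values CG k w \<lesssim> (UNIV :: nat set set)"
    using few unfolding lesspoll_def by (rule conjunct1)
  then have "word_values CG k w \<approx> (UNIV :: nat set set)" using ge by (rule lepoll_antisym)
  then show False using few unfolding lesspoll_def by (elim conjE notE)
qed

end

lemma (in group) rcos_eq_iff:
  assumes "subgroup N G" "a \<in> carrier G" "b \<in> carrier G"
  shows "N #> a = N #> b \<longleftrightarrow> (\<exists>y\<in>N. a = y \<otimes> b)"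
proof
  assume "N #> a = N #> b"
  then have "a \<in> N #> b" using rcos_self[OF assms(2,1)] by simp
  then show "\<exists>y\<in>N. a = y \<otimes> b" by (auto simp: r_coset_def)
next
  assume "\<exists>y\<in>N. a = y \<otimes> b"
  then have "a \<in> N #> b" by (auto simp: r_coset_def)
  then show "N #> a = N #> b" using repr_independence[OF _ assms(3,1)] by simp
qed

context residual_family
begin

lemma finite_verbal_subgroup:
  fixes h :: "'a \<Rightarrow> 'k::alg_closed_field mat"
  assumes mat: "matrix_group G h n" and w: "fst ` set w \<subseteq> {..<k}"
    and few: "word_values CG k w \<prec> (UNIV :: nat set set)"
  shows "finite (verbal_subgroup CG k w)"
proof -
  interpret M: matrix_group G h n by (rule mat)
  \<comment> \<open>\<open>N0\<close> is fixed before any arguments are considered; this is possible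
    because the span depends only on the length of \<open>w\<close>.\<close>
  obtain N0 where N0: "N0 \<in> \<N>" and stable: "\<forall>N\<in>\<N>. N \<subseteq> N0 \<longrightarrow>
    (\<forall>f\<in>lin_span (M.coord_monomials (length w)). (\<forall>x\<in>N. f x = 0) \<longrightarrow> (\<forall>x\<in>N0. f x = 0))"
    using exists_member_vanishing_stable[OF nonempty, of "M.coord_monomials (length w)"] by (elim bexE)
  have const: "word_map G w g' = word_map G w g"
    if g: "g \<in> {..<k} \<rightarrow> carrier G" and g': "g' \<in> {..<k} \<rightarrow> carrier G"
      and eq: "\<forall>i<k. N0 #> g' i = N0 #> g i" for g g'
  proof -
    \<comment> \<open>The constant subcell lies around some \<open>u\<close> in the cell of
      \<open>g\<close>, not around \<open>g\<close> itself. Modulo \<open>N0\<close> the cells of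
      \<open>u\<close> and \<open>g\<close> coincide, so extending to the cell of \<open>u\<close>
      reaches \<open>g\<close> as well.\<close>
    obtain u N where u: "u \<in> cell k N0 g" and N: "N \<in> \<N>" "N \<subseteq> N0"
      and uconst: "\<forall>v\<in>cell k N u. word_map G w v = word_map G w u"
      using exists_constant_subcell[OF w few g N0] by (elim exE conjE)
    have uc: "u \<in> {..<k} \<rightarrow> carrier G" and ug: "\<And>i. i < k \<Longrightarrow> N0 #> u i = N0 #> g i"
      using u by (auto simp: cell_def)
    have *: "word_map G w v = word_map G w u"
      if v: "v \<in> {..<k} \<rightarrow> carrier G" "\<forall>i<k. N0 #> v i = N0 #> u i" for v
    proof (rule M.word_const_on_cell_extend[OF w uc sub[OF N(1)] N(2) sub[OF N0]])
      show "\<forall>x\<in>N0. f x = 0" if "f \<in> lin_span (M.coord_monomials (length w))" "\<forall>x\<in>N. f x = 0" for f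
        using stable N that by blast
      show "\<forall>i<k. \<exists>y\<in>N0. v i = y \<otimes> u i"
        using v uc rcos_eq_iff[OF sub[OF N0]] by (auto simp: Pi_iff)
      fix v' assume v': "\<forall>i<k. \<exists>y\<in>N. v' i = y \<otimes> u i"
      have "v' i \<in> carrier G \<and> N #> v' i = N #> u i" if "i < k" for i
      proof -
        obtain y where y: "y \<in> N" "v' i = y \<otimes> u i" using v' \<open>i < k\<close> by blast
        have "y \<in> carrier G" using y(1) sub[OF N(1)] by (rule subgroup.mem_carrier[rotated])
        moreover have "u i \<in> carrier G" using uc \<open>i < k\<close> by blast
        ultimately have "v' i \<in> carrier G" using y(2) by simp
        then show ?thesis using rcos_eq_iff[OF sub[OF N(1)] _ \<open>u i \<in> carrier G\<close>] y by blast
      qed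
      then have "v' \<in> cell k N u" by (simp add: cell_def)
      then show "word_map G w v' = word_map G w u" using uconst by blast
    qed
    have "word_map G w g' = word_map G w u" by (rule *[OF g']) (use eq ug in auto)
    moreover have "word_map G w g = word_map G w u" by (rule *[OF g]) (use ug in auto)
    ultimately show ?thesis by simp
  qed
  have finW: "finite (word_values G k w)"
    unfolding word_values_def
  proof (rule finite_image_factor)
    have "(\<lambda>g. \<lambda>i\<in>{..<k}. N0 #> g i) ` ({..<k} \<rightarrow>\<^sub>E carrier G) \<subseteq> {..<k} \<rightarrow>\<^sub>E (rcosets N0)"
    proof (rule image_subsetI)
      fix g assume g: "g \<in> {..<k} \<rightarrow>\<^sub>E carrier G"
      show "(\<lambda>i\<in>{..<k}. N0 #> g i) \<in> {..<k} \<rightarrow>\<^sub>E (rcosets N0)"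
        by (rule restrict_PiE_iff[THEN iffD2])
          (intro ballI rcosetsI subgroup.subset[OF sub[OF N0]] PiE_mem[OF g])
    qed
    then show "finite ((\<lambda>g. \<lambda>i\<in>{..<k}. N0 #> g i) ` ({..<k} \<rightarrow>\<^sub>E carrier G))"
      by (rule finite_subset) (intro finite_PiE finite_index N0 finite_lessThan)
    fix g g' assume g: "g \<in> {..<k} \<rightarrow>\<^sub>E carrier G" "g' \<in> {..<k} \<rightarrow>\<^sub>E carrier G"
      and eq: "(\<lambda>i\<in>{..<k}. N0 #> g i) = (\<lambda>i\<in>{..<k}. N0 #> g' i)"
    have "N0 #> g i = N0 #> g' i" if "i < k" for i using fun_cong[OF eq, of i] that by simp
    then have "\<forall>i<k. N0 #> g i = N0 #> g' i" by blast
    moreover have "g \<in> {..<k} \<rightarrow> carrier G" "g' \<in> {..<k} \<rightarrow> carrier G"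
      using g by (simp_all add: PiE_iff Pi_iff)
    ultimately show "word_map G w g = word_map G w g'" by (intro const)
  qed
  have "finite (generate G (word_values G k w))"
  proof (rule finite_generate_word_values[OF mat normal[OF N0] finite_index[OF N0] w _ finW])
    fix g g' assume g: "g \<in> {..<k} \<rightarrow> carrier G" "g' \<in> {..<k} \<rightarrow> carrier G"
      and eq: "\<forall>i<k. \<exists>c\<in>N0. g' i = c \<otimes> g i"
    show "word_map G w g' = word_map G w g"
      by (rule const[OF g]) (use eq g rcos_eq_iff[OF sub[OF N0]] in \<open>auto simp: Pi_iff\<close>)
  qed
  interpret CG: group CG by (rule group_CG)
  interpret diag: group_hom G CG diag
    by (simp add: group_hom_def group_hom_axioms_def group_CG group_axioms diag_hom)
  have "word_values CG k w \<subseteq> diag ` word_values G k w"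
  proof
    fix z assume "z \<in> word_values CG k w"
    then obtain x where x: "x \<in> {..<k} \<rightarrow>\<^sub>E carrier CG" and z: "z = word_map CG w x"
      unfolding word_values_def by blast
    have x': "x \<in> {..<k} \<rightarrow> carrier CG" and xc: "\<And>i. i < k \<Longrightarrow> x i \<in> carrier CG" using x by auto
    have lift: "\<exists>g. g \<in> {..<k} \<rightarrow>\<^sub>E carrier G \<and> (\<forall>i<k. x i N = N #> g i)" if N: "N \<in> \<N>" for N
    proof -
      have "\<forall>i\<in>{..<k}. \<exists>g. g \<in> carrier G \<and> x i N = N #> g"
        using CG_coset[OF xc N] by blast
      then obtain g where "\<forall>i\<in>{..<k}. g i \<in> carrier G \<and> x i N = N #> g i" by (rule bchoice[THEN exE])
      then show ?thesis by (intro exI[of _ "restrict g {..<k}"]) simp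
    qed
    obtain g where g: "g \<in> {..<k} \<rightarrow>\<^sub>E carrier G" "\<forall>i<k. x i N0 = N0 #> g i" using lift[OF N0] by blast
    \<comment> \<open>The tuple \<open>g\<close> approximates \<open>x\<close> only modulo
      \<open>N0\<close>. For any other \<open>N\<close>, an approximation \<open>g'\<close> modulo
      \<open>N \<inter> N0\<close> computes the component at \<open>N\<close>, and it agrees with
      \<open>g\<close> modulo \<open>N0\<close>, so both have the same value.\<close>
    have "z N = diag (word_map G w g) N" for N
    proof (cases "N \<in> \<N>")
      case True
      have N': "N \<inter> N0 \<in> \<N>" by (rule inter_closed[OF True N0])
      obtain g' where g': "g' \<in> {..<k} \<rightarrow>\<^sub>E carrier G" "\<forall>i<k. x i (N \<inter> N0) = (N \<inter> N0) #> g' i"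
        using lift[OF N'] by blast
      have g'c: "g' i \<in> carrier G" if "i < k" for i using g'(1) that by auto
      have xN: "x i N = N #> g' i" "x i N0 = N0 #> g' i" if "i < k" for i
        using CG_compat[OF xc[OF that] N' _ g'c[OF that]] True N0 g'(2) that by auto
      have "z N = N #> word_map G w g'"
        unfolding z by (rule completion_word[OF w x' _ True xN(1)]) (use g' in auto)
      also have "word_map G w g' = word_map G w g"
        by (rule const) (use g g' xN(2) in auto)
      finally show ?thesis using True by (simp add: diag_def)
    next
      case False
      have "z \<in> carrier CG" unfolding z by (rule word_map_closed[OF group_CG w x'])
      then have "z \<in> extensional \<N>" unfolding carrier_CG_iff by (rule conjunct1)
      then show ?thesis using False by (simp add: diag_def extensional_def)
    qed
    then have "z = diag (word_map G w g)" by (rule ext)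
    then show "z \<in> diag ` word_values G k w" unfolding word_values_def using g(1) by blast
  qed
  then have "verbal_subgroup CG k w \<subseteq> generate CG (diag ` word_values G k w)"
    unfolding verbal_subgroup_def by (rule CG.mono_generate)
  also have "\<dots> = diag ` generate G (word_values G k w)"
    by (rule diag.generate_img)
      (use word_map_closed[OF group_axioms w] in \<open>auto simp: word_values_def\<close>)
  finally show ?thesis
    by (rule finite_subset) (rule finite_imageI[OF \<open>finite (generate G (word_values G k w))\<close>])
qed

end

section \<open>Completions of linear groups\<close>

text \<open>Presents the quotient as an actual member of \<open>\<C>\<close>, over the natural
  numbers, which is the form in which \<open>formation\<close> handles subdirect products.\<close>

lemma class_normals_imp_hom:
  assumes "class_of_finite_groups \<C>" "group G" "N \<in> class_normals \<C> G"
  shows "\<exists>H f. H \<in> \<C> \<and> group_hom G H f \<and> f ` carrier G = carrier H \<and> kernel G H f = N"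
proof -
  interpret G: group G by fact
  have N: "N \<lhd> G" using assms(3) by (simp add: class_normals_def)
  obtain H \<phi> where H: "H \<in> \<C>" and \<phi>: "\<phi> \<in> iso (G Mod N) H"
    using assms(3) by (auto simp: class_normals_def in_class_def is_iso_def)
  interpret N: normal N G by (rule N)
  interpret H: group H using assms(1) H by (auto simp: class_of_finite_groups_def)
  interpret q: group_hom G "G Mod N" "\<lambda>x. N #>\<^bsub>G\<^esub> x" by (rule N.r_coset_surj_hom)
  interpret \<phi>: group_hom "G Mod N" H \<phi>
    using \<phi> by (simp add: group_hom_def group_hom_axioms_def iso_def q.H.group_axioms H.group_axioms)
  have bij: "bij_betw \<phi> (carrier (G Mod N)) (carrier H)" using \<phi> by (simp add: iso_def)
  have hom: "group_hom G H (\<lambda>x. \<phi> (N #>\<^bsub>G\<^esub> x))"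
    using hom_compose[OF q.homh \<phi>.homh]
    by (simp add: group_hom_def group_hom_axioms_def H.group_axioms G.group_axioms comp_def)
  moreover have "(\<lambda>x. \<phi> (N #>\<^bsub>G\<^esub> x)) ` carrier G = carrier H"
  proof -
    have "(\<lambda>x. \<phi> (N #>\<^bsub>G\<^esub> x)) ` carrier G = \<phi> ` (\<lambda>x. N #>\<^bsub>G\<^esub> x) ` carrier G"
      by (simp add: image_image)
    then show ?thesis unfolding N.r_coset_surj_hom(2) using bij by (simp add: bij_betw_def)
  qed
  moreover have "kernel G H (\<lambda>x. \<phi> (N #>\<^bsub>G\<^esub> x)) = N"
  proof -
    have "\<phi> (N #>\<^bsub>G\<^esub> x) = \<one>\<^bsub>H\<^esub> \<longleftrightarrow> x \<in> N" if x: "x \<in> carrier G" for x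
    proof
      assume "\<phi> (N #>\<^bsub>G\<^esub> x) = \<one>\<^bsub>H\<^esub>"
      then have "\<phi> (N #>\<^bsub>G\<^esub> x) = \<phi> \<one>\<^bsub>G Mod N\<^esub>" unfolding \<phi>.hom_one .
      then have "N #>\<^bsub>G\<^esub> x = \<one>\<^bsub>G Mod N\<^esub>"
        using bij_betw_imp_inj_on[OF bij] q.hom_closed[OF x] q.H.one_closed by (blast dest: inj_onD)
      then have "N #>\<^bsub>G\<^esub> x = N" by (simp add: FactGroup_def)
      then show "x \<in> N" using x N.subgroup_axioms by (rule G.coset_join1)
    next
      assume "x \<in> N"
      then have "N #>\<^bsub>G\<^esub> x = \<one>\<^bsub>G Mod N\<^esub>"
        using G.coset_join2[OF x N.subgroup_axioms] by (simp add: FactGroup_def)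
      then show "\<phi> (N #>\<^bsub>G\<^esub> x) = \<one>\<^bsub>H\<^esub>" using \<phi>.hom_one by (rule ssubst)
    qed
    then show ?thesis using N.subset by (auto simp: kernel_def)
  qed
  ultimately show ?thesis using H by (intro exI conjI)
qed

text \<open>The quotient by the intersection is a subdirect product of the two quotients: it is the
  image of the group in their product, and both projections are onto.\<close>

lemma class_normals_inter:
  assumes F: "formation \<C>" and G: "group G" and N: "N \<in> class_normals \<C> G" and M: "M \<in> class_normals \<C> G"
  shows "N \<inter> M \<in> class_normals \<C> G"
proof -
  interpret G: group G by fact
  have fin: "class_of_finite_groups \<C>" using F by (simp add: formation_def)
  obtain H0 f0 where f0: "H0 \<in> \<C>" "group_hom G H0 f0" "f0 ` carrier G = carrier H0" "kernel G H0 f0 = N"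
    using class_normals_imp_hom[OF fin G N] by (elim exE conjE)
  obtain H1 f1 where f1: "H1 \<in> \<C>" "group_hom G H1 f1" "f1 ` carrier G = carrier H1" "kernel G H1 f1 = M"
    using class_normals_imp_hom[OF fin G M] by (elim exE conjE)
  interpret f0: group_hom G H0 f0 by (rule f0(2))
  interpret f1: group_hom G H1 f1 by (rule f1(2))
  define H where "H i = (if i = 0 then H0 else H1)" for i :: nat
  define f where "f i = (if i = 0 then f0 else f1)" for i :: nat
  define P where "P = product_group {..<2::nat} H"
  define \<psi> where "\<psi> x = (\<lambda>i\<in>{..<2}. f i x)" for x
  have H: "H i \<in> \<C>" "group (H i)" and f: "f i \<in> hom G (H i)" "f i ` carrier G = carrier (H i)" for i
    using f0(1,3) f1(1,3) f0.homh f1.homh f0.H.group_axioms f1.H.group_axioms by (auto simp: H_def f_def)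
  interpret P: group P unfolding P_def by (rule product_group) (rule H(2))
  interpret \<psi>: group_hom G P \<psi>
  proof (unfold group_hom_def group_hom_axioms_def, intro conjI homI)
    show "\<psi> x \<in> carrier P" if x: "x \<in> carrier G" for x
      using hom_in_carrier[OF f(1) x] by (simp add: P_def \<psi>_def)
    show "\<psi> (x \<otimes>\<^bsub>G\<^esub> y) = \<psi> x \<otimes>\<^bsub>P\<^esub> \<psi> y" if xy: "x \<in> carrier G" "y \<in> carrier G" for x y
      unfolding P_def \<psi>_def using hom_mult[OF f(1) xy] by (auto simp: restrict_def)
  qed (rule G.group_axioms P.group_axioms)+
  define S where "S = \<psi> ` carrier G"
  have S: "subgroup S P" unfolding S_def by (rule \<psi>.img_is_subgroup)
  have "(\<lambda>x. x i) ` S = carrier (H i)" if "i < 2" for i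
    unfolding S_def image_image using that by (simp add: \<psi>_def f(2))
  then have "subdirect_product S {..<2} H" using S by (simp add: subdirect_product_def P_def)
  moreover have "\<forall>n :: nat. \<forall>H S. n > 0 \<and> (\<forall>i<n. H i \<in> \<C>) \<and> subdirect_product S {..<n} H \<longrightarrow>
        in_class \<C> ((product_group {..<n} H)\<lparr>carrier := S\<rparr>)"
    using F unfolding formation_def by (elim conjE)
  ultimately have "in_class \<C> (P\<lparr>carrier := S\<rparr>)" using H(1) unfolding P_def by simp
  then obtain K where K: "K \<in> \<C>" "P\<lparr>carrier := S\<rparr> \<cong> K" by (auto simp: in_class_def)
  interpret PS: group "P\<lparr>carrier := S\<rparr>" by (rule P.subgroup_imp_group[OF S])
  interpret \<psi>S: group_hom G "P\<lparr>carrier := S\<rparr>" \<psi>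
    using \<psi>.hom_mult by unfold_locales (auto simp: hom_def S_def)
  have "kernel G (P\<lparr>carrier := S\<rparr>) \<psi> = N \<inter> M"
  proof -
    have "\<psi> x = \<one>\<^bsub>P\<^esub> \<longleftrightarrow> (\<forall>i<2. f i x = \<one>\<^bsub>H i\<^esub>)" for x
      by (auto simp: \<psi>_def P_def fun_eq_iff restrict_def)
    then have "\<psi> x = \<one>\<^bsub>P\<^esub> \<longleftrightarrow> f0 x = \<one>\<^bsub>H0\<^esub> \<and> f1 x = \<one>\<^bsub>H1\<^esub>" for x
      by (simp add: f_def H_def less_2_cases_iff all_conj_distrib imp_disjL disj_imp)
    then show ?thesis by (auto simp: kernel_def simp flip: f0(4) f1(4))
  qed
  moreover have "G Mod kernel G (P\<lparr>carrier := S\<rparr>) \<psi> \<cong> P\<lparr>carrier := S\<rparr>"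
    by (rule \<psi>S.FactGroup_iso) (simp add: S_def)
  ultimately have "N \<inter> M \<lhd> G" "G Mod (N \<inter> M) \<cong> K"
    using \<psi>S.normal_kernel iso_trans[OF _ K(2)] by auto
  then show ?thesis using K(1) by (auto simp: class_normals_def in_class_def)
qed

lemma residual_family_class_normals:
  assumes "formation \<C>" "group G" "residually \<C> G" "class_normals \<C> G \<noteq> {}"
  shows "residual_family G (class_normals \<C> G)"
proof -
  interpret G: group G by fact
  have fin: "class_of_finite_groups \<C>" using assms(1) by (simp add: formation_def)
  show ?thesis
  proof (unfold residual_family_def normal_family_def normal_family_axioms_def
      residual_family_axioms_def, intro conjI allI impI)
    show "N \<lhd> G" if "N \<in> class_normals \<C> G" for N using that by (simp add: class_normals_def)
    fix N assume N: "N \<in> class_normals \<C> G"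
    obtain H where "H \<in> \<C>" "G Mod N \<cong> H" using N by (auto simp: class_normals_def in_class_def)
    then obtain \<phi> where "finite (carrier H)" "bij_betw \<phi> (carrier (G Mod N)) (carrier H)"
      using fin by (auto simp: class_of_finite_groups_def is_iso_def iso_def)
    then have "finite (carrier (G Mod N))" using bij_betw_finite by blast
    then show "finite (rcosets\<^bsub>G\<^esub> N)" by (simp add: FactGroup_def)
    show "N \<inter> M \<in> class_normals \<C> G" if "M \<in> class_normals \<C> G" for M
      by (rule class_normals_inter[OF assms(1,2) N that])
  next
    show "\<exists>N\<in>class_normals \<C> G. x \<notin> N" if "x \<in> carrier G" "x \<noteq> \<one>\<^bsub>G\<^esub>" for x
      using assms(3) that by (auto simp: residually_def)
  qed (rule assms(4) assms(2))+
qed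

text \<open>Extending scalars to the algebraic closure keeps the representation faithful, and there
  characteristic polynomials split.\<close>

lemma linear_group_imp_matrix_group:
  assumes "linear_group TYPE('k::field) G"
  shows "\<exists>(h :: 'a \<Rightarrow> 'k alg_closure mat) n. matrix_group (G :: ('a, 'c) monoid_scheme) h n"
proof -
  obtain n h where G: "group G" and h: "h \<in> hom G (general_linear_group TYPE('k) n)" "inj_on h (carrier G)"
    using assms by (auto simp: linear_group_def)
  interpret G: group G by fact
  interpret ac: inj_semiring_hom "to_ac :: 'k \<Rightarrow> 'k alg_closure" by unfold_locales auto
  interpret R: ring "ring_mat TYPE('k) n ()" by (rule ring_mat)
  interpret h: group_hom G "general_linear_group TYPE('k) n" h
    using h(1) R.units_group G.group_axioms
    by (simp add: group_hom_def group_hom_axioms_def general_linear_group_def)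
  have carr: "h x \<in> carrier_mat n n" if "x \<in> carrier G" for x
    using h.hom_closed[OF that]
    by (auto simp: general_linear_group_def units_of_carrier Units_def ring_mat_simps)
  have "matrix_group G (\<lambda>x. map_mat to_ac (h x)) n"
  proof
    show "map_mat to_ac (h x) \<in> carrier_mat n n" if "x \<in> carrier G" for x
      using carr[OF that] by simp
    show "map_mat to_ac (h (x \<otimes>\<^bsub>G\<^esub> y)) = map_mat to_ac (h x) * map_mat to_ac (h y)"
      if "x \<in> carrier G" "y \<in> carrier G" for x y
      using h.hom_mult[OF that] ac.mat_hom_mult[OF carr[OF that(1)] carr[OF that(2)]]
      by (simp add: general_linear_group_def units_of_mult ring_mat_simps)
    show "map_mat to_ac (h \<one>\<^bsub>G\<^esub>) = 1\<^sub>m n"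
      using h.hom_one ac.mat_hom_one by (simp add: general_linear_group_def units_of_one ring_mat_simps)
    show "inj_on (\<lambda>x. map_mat (to_ac :: 'k \<Rightarrow> 'k alg_closure) (h x)) (carrier G)"
      using h(2) ac.mat_hom_inj by (auto simp: inj_on_def)
  qed
  then show ?thesis by blast
qed

theorem corollary1p3:
  fixes \<C> :: "nat monoid set"
    and \<Gamma> :: "'a monoid"
    and k :: nat
    and w :: word
  assumes "formation \<C>"
    and "w \<in> free_group_words k"
    and "linear_group TYPE('k::field) \<Gamma>"
    and "residually \<C> \<Gamma>"
    and "word_values (pro_completion \<C> \<Gamma>) k w \<prec> (UNIV :: nat set set)"
  shows "finite (verbal_subgroup (pro_completion \<C> \<Gamma>) k w)"
proof -
  have w: "fst ` set w \<subseteq> {..<k}" using assms(2) by (simp add: free_group_words_def)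
  have \<Gamma>: "group \<Gamma>" using assms(3) by (simp add: linear_group_def)
  show ?thesis
  proof (cases "class_normals \<C> \<Gamma> = {}")
    \<comment> \<open>For an empty family the completion is the empty product, a single
      point.\<close>
    case True
    interpret normal_family \<Gamma> "{}" using \<Gamma> by (simp add: normal_family_def normal_family_axioms_def)
    interpret CG: group CG by (rule group_CG)
    have "verbal_subgroup CG k w \<subseteq> carrier CG"
      unfolding verbal_subgroup_def using word_map_closed[OF group_CG w]
      by (intro CG.generate_incl) (auto simp: word_values_def)
    moreover have "finite (carrier CG)"
      by (rule finite_subset[OF carrier_CG_subset]) simp
    ultimately show ?thesis unfolding pro_completion_eq True by (rule finite_subset)
  next
    case False
    interpret residual_family \<Gamma> "class_normals \<C> \<Gamma>"
      by (rule residual_family_class_normals[OF assms(1) \<Gamma> assms(4) False])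
    obtain h :: "'a \<Rightarrow> 'k alg_closure mat" and n where "matrix_group \<Gamma> h n"
      using linear_group_imp_matrix_group[OF assms(3)] by blast
    then show ?thesis
      using finite_verbal_subgroup[OF _ w] assms(5) unfolding pro_completion_eq by blast
  qed
qed

end
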